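(* Consider the Gaussian model with $r=n$: let $X_1,\ldots,X_{n+1}$ be i.i.d. standard Gaussian points in $\mathbb{R}^n$, let $\mathcal V_{n,n}$ be the $n$-dimensional volume of the simplex with these vertices, $\mathcal L_{n,n}=\log(n!\,\mathcal V_{n,n})$, and let $m_n=\frac12\big(n\log n-n+\frac12\log n+\log(2^{3/2}\pi)\big)$. Then, as $n\to\infty$, $\mathcal L_{n,n}-m_n$ converges in the mod-Gaussian sense (meaning mod-$\phi$ convergence with $\eta(t)=\frac12t^2$) with parameters $w_n=\frac12\log\frac n2$, namely $$\lim_{n\to\infty}\frac{\mathbb{E}e^{t(\mathcal L_{n,n}-m_n)}}{e^{\frac14t^2\log\frac n2}}=\frac{G\left(\frac12\right)}{G\left(\frac12+\frac t2\right)G\left(1+\frac t2\right)}.$$ The convergence is uniform as long as $t$ stays in any compact subset of $\mathbb{C}\setminus\{-1,-2,\ldots\}$.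
   Context: $G$ is the Barnes $G$-function, the entire function $G(z+1)=(2\pi)^{z/2}e^{-\frac12(z+(1+\gamma)z^2)}\prod_{k=1}^\infty(1+\frac zk)^ke^{\frac{z^2}{2k}-z}$ ($\gamma$ the Euler constant), satisfying $G(z+1)=\Gamma(z)G(z)$ and $G(1)=1$. Mod-$\phi$ convergence: real random variables $Y_n$ converge in the mod-$\phi$ sense with $\eta$ and parameters $w_n\to+\infty$ if $\phi$ is an infinitely divisible distribution with $\int e^{tx}\phi(dx)=e^{\eta(t)}$ on an open strip $S=\{c_-<\operatorname{Re}t<c_+\}$ of the complex plane, and $\mathbb{E}e^{tY_n}/e^{w_n\eta(t)}$ converges, locally uniformly on $S$, to an analytic limit function. For complex $t$ at which the expectation does not converge absolutely, $\mathbb{E}e^{tY_n}$ is understood as the meromorphic continuation in $t$ of the moment generating function. *)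

theory Defs
  imports "HOL-Probability.Probability" "HOL-Complex_Analysis.Complex_Analysis"
begin

text \<open>The product formula is usually written for \<open>G(z + 1)\<close>; here \<open>k\<close> is shifted so that
  the product starts at \<open>k = 0\<close>. \<^const>\<open>prodinf\<close> is \<open>0\<close> if a factor vanishes and the remaining product converges.\<close>

definition Barnes_G :: "complex \<Rightarrow> complex" where
  "Barnes_G s = (let z = s - 1 in
     complex_of_real (2 * pi) powr (z / 2)
     * exp (- (z + (1 + complex_of_real euler_mascheroni) * z\<^sup>2) / 2)
     * (\<Prod>k. (1 + z / of_nat (Suc k)) ^ Suc k * exp (z\<^sup>2 / (2 * of_nat (Suc k)) - z)))"

definition infinitely_divisible :: "real measure \<Rightarrow> bool" where
  "infinitely_divisible \<phi> \<longleftrightarrow> real_distribution \<phi> \<and>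
     (\<forall>n\<ge>1::nat. \<exists>\<nu>. real_distribution \<nu> \<and>
        \<phi> = distr (\<Pi>\<^sub>M i\<in>{..<n}. \<nu>) borel (\<lambda>x. \<Sum>i<n. x i))"

text \<open>By \<^const>\<open>nicely_meromorphic_on\<close>, removable singularities are removed and the value at
  a pole is \<open>0\<close>, which makes the continuation unique as a function (see
  \<open>mgf_continuation_unique\<close>).\<close>

definition mgf_continuation :: "'a measure \<Rightarrow> ('a \<Rightarrow> real) \<Rightarrow> (complex \<Rightarrow> complex) \<Rightarrow> bool" where
  "mgf_continuation M Y F \<longleftrightarrow> F nicely_meromorphic_on UNIV \<and>
     (\<forall>t. integrable M (\<lambda>\<omega>. exp (t * of_real (Y \<omega>))) \<longrightarrow>
        F t = (LINT \<omega>|M. exp (t * of_real (Y \<omega>))))"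

definition mgf :: "'a measure \<Rightarrow> ('a \<Rightarrow> real) \<Rightarrow> complex \<Rightarrow> complex" where
  "mgf M Y t =
     (if integrable M (\<lambda>\<omega>. exp (t * of_real (Y \<omega>)))
      then LINT \<omega>|M. exp (t * of_real (Y \<omega>))
      else (THE F. mgf_continuation M Y F) t)"

definition vertical_strip :: "ereal \<Rightarrow> ereal \<Rightarrow> complex set" where
  "vertical_strip c d = {t. c < ereal (Re t) \<and> ereal (Re t) < d}"

text \<open>Sequences start at \<open>n = 1\<close>, and each \<open>Y n\<close> may live on its own probability space
  \<open>M n\<close>. The disjunction says that \<open>mgf (M n) (Y n)\<close> is well defined on the strip.\<close>

definition mod_phi_convergent ::
  "real measure \<Rightarrow> (complex \<Rightarrow> complex) \<Rightarrow> ereal \<Rightarrow> ereal \<Rightarrow>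
   (nat \<Rightarrow> 'a measure) \<Rightarrow> (nat \<Rightarrow> 'a \<Rightarrow> real) \<Rightarrow> (nat \<Rightarrow> real) \<Rightarrow> (complex \<Rightarrow> complex) \<Rightarrow> bool" where
  "mod_phi_convergent \<phi> \<eta> c d M Y w \<psi> \<longleftrightarrow>
     infinitely_divisible \<phi> \<and> c < d \<and>
     (\<forall>t\<in>vertical_strip c d. integrable \<phi> (\<lambda>x. exp (t * of_real x)) \<and>
        (LINT x|\<phi>. exp (t * of_real x)) = exp (\<eta> t)) \<and>
     (\<forall>n\<ge>1. prob_space (M n) \<and> Y n \<in> borel_measurable (M n) \<and>
        ((\<exists>F. mgf_continuation (M n) (Y n) F) \<or>
         (\<forall>t\<in>vertical_strip c d. integrable (M n) (\<lambda>\<omega>. exp (t * of_real (Y n \<omega>)))))) \<and>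
     filterlim w at_top sequentially \<and>
     \<psi> analytic_on vertical_strip c d \<and>
     (\<forall>z\<in>vertical_strip c d. \<exists>\<epsilon>>0. cball z \<epsilon> \<subseteq> vertical_strip c d \<and>
        uniform_limit (cball z \<epsilon>) (\<lambda>n t. mgf (M n) (Y n) t / exp (of_real (w n) * \<eta> t)) \<psi>
          sequentially)"

abbreviation mod_Gaussian_convergent ::
  "ereal \<Rightarrow> ereal \<Rightarrow> (nat \<Rightarrow> 'a measure) \<Rightarrow> (nat \<Rightarrow> 'a \<Rightarrow> real) \<Rightarrow> (nat \<Rightarrow> real) \<Rightarrow>
   (complex \<Rightarrow> complex) \<Rightarrow> bool" where
  "mod_Gaussian_convergent \<equiv> mod_phi_convergent std_normal_distribution (\<lambda>t. t\<^sup>2 / 2)"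

lemma mgf_continuation_unique:
  assumes "prob_space M" "Y \<in> borel_measurable M"
    and F: "mgf_continuation M Y F" and G: "mgf_continuation M Y G"
  shows "F = G"
proof
  fix s
  interpret prob_space M by fact
  have "F (\<i> * of_real a) - G (\<i> * of_real a) = 0" for a
  proof -
    have "integrable M (\<lambda>\<omega>. exp (\<i> * of_real a * of_real (Y \<omega>)))"
      using assms(2) by (intro integrable_const_bound[where B = 1]) (auto simp: norm_exp_eq_Re)
    with F G show ?thesis by (auto simp: mgf_continuation_def)
  qed
  note eq = this
  define H where "H = remove_sings (\<lambda>t. F t - G t)"
  have mero: "F meromorphic_on UNIV" "G meromorphic_on UNIV"
    using F G by (auto simp: mgf_continuation_def nicely_meromorphic_on_def)
  then have meroD: "(\<lambda>t. F t - G t) meromorphic_on UNIV"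
    by (intro meromorphic_intros)
  have "0 islimpt {t. F t - G t = 0}"
    unfolding islimpt_approachable
  proof (intro allI impI)
    fix e :: real assume "e > 0"
    then show "\<exists>x'\<in>{t. F t - G t = 0}. x' \<noteq> 0 \<and> dist x' 0 < e"
      using eq[of "e / 2"] by (intro bexI[of _ "\<i> * of_real (e / 2)"]) (auto simp: norm_mult)
  qed
  then have line: "frequently (\<lambda>t. F t - G t = 0) (at 0)"
    by (simp add: islimpt_conv_frequently_at)
  have ev: "eventually (\<lambda>t. H t = F t - G t) (at z)" for z
    unfolding H_def using meroD
    by (intro eventually_remove_sings_eq_at) (auto intro: meromorphic_on_isolated_singularity meromorphic_on_subset)
  have "frequently (\<lambda>t. H t = 0) (at 0)"
    using frequently_eventually_frequently[OF line ev] by (rule frequently_elim1) auto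
  then have "H z = 0" for z
    unfolding H_def
    by (rule frequently_eq_meromorphic_imp_constant[OF _ remove_sings_nicely_meromorphic[OF meroD]]) auto
  with ev have near: "eventually (\<lambda>t. F t = G t) (at s)"
    by (auto elim: eventually_mono)
  have "remove_sings f z = f z" if "f nicely_meromorphic_on UNIV" for f z
    using that unfolding nicely_meromorphic_on_def by (metis UNIV_I remove_sings_at_pole remove_sings_eqI)
  with F G have "remove_sings F s = F s" "remove_sings G s = G s"
    by (auto simp: mgf_continuation_def)
  moreover have "remove_sings F s = remove_sings G s"
    using near by (intro remove_sings_cong) auto
  ultimately show "F s = G s" by simp
qed

text \<open>Since the dimension \<open>n\<close> varies, \<open>\<real>\<^sup>n\<close> is the extensional function space
  \<open>{..<n} \<rightarrow>\<^sub>E UNIV\<close> with the product \<open>\<sigma>\<close>-algebra. The \<open>n + 1\<close> points are \<open>X 0, \<dots>, X n\<close>.\<close>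

definition iid_std_Gaussian_points :: "nat \<Rightarrow> 'a measure \<Rightarrow> (nat \<Rightarrow> 'a \<Rightarrow> nat \<Rightarrow> real) \<Rightarrow> bool" where
  "iid_std_Gaussian_points n M X \<longleftrightarrow>
     prob_space M \<and>
     prob_space.indep_vars M (\<lambda>_. \<Pi>\<^sub>M k\<in>{..<n}. borel) X {..n} \<and>
     (\<forall>i\<le>n. distr M (\<Pi>\<^sub>M k\<in>{..<n}. borel) (X i) = (\<Pi>\<^sub>M k\<in>{..<n}. std_normal_distribution))"

definition simplex_hull :: "nat \<Rightarrow> (nat \<Rightarrow> nat \<Rightarrow> real) \<Rightarrow> (nat \<Rightarrow> real) set" where
  "simplex_hull n p =
     {\<lambda>k\<in>{..<n}. \<Sum>i\<le>n. u i * p i k | u. (\<forall>i\<le>n. 0 \<le> u i) \<and> (\<Sum>i\<le>n. u i) = 1}"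

definition simplex_volume :: "nat \<Rightarrow> (nat \<Rightarrow> nat \<Rightarrow> real) \<Rightarrow> real" where
  "simplex_volume n p = measure (\<Pi>\<^sub>M k\<in>{..<n}. lborel) (simplex_hull n p)"

text \<open>On the null event of a degenerate simplex the logarithm takes HOL's default value
  \<open>ln 0 = 0\<close>.\<close>

definition log_volume :: "nat \<Rightarrow> (nat \<Rightarrow> 'a \<Rightarrow> nat \<Rightarrow> real) \<Rightarrow> 'a \<Rightarrow> real" where
  "log_volume n X \<omega> = ln (fact n * simplex_volume n (\<lambda>i. X i \<omega>))"

definition centering :: "nat \<Rightarrow> real" where
  "centering n =
     (real n * ln (real n) - real n + ln (real n) / 2 + ln (2 powr (3 / 2) * pi)) / 2"

definition centered_log_volume :: "nat \<Rightarrow> (nat \<Rightarrow> 'a \<Rightarrow> nat \<Rightarrow> real) \<Rightarrow> 'a \<Rightarrow> real" where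
  "centered_log_volume n X \<omega> = log_volume n X \<omega> - centering n"

definition limit_function :: "complex \<Rightarrow> complex" where
  "limit_function t = Barnes_G (1 / 2) / (Barnes_G (1 / 2 + t / 2) * Barnes_G (1 + t / 2))"

end

theory Submission
  imports Defs "HOL-Real_Asymp.Real_Asymp" "Jordan_Normal_Form.Determinant"
begin

text \<open>The content \<open>n! V\<close> of the simplex is the modulus of the determinant of the matrix whose rows are
  the \<open>n\<close> coordinate vectors of the points, which are independent Gaussian vectors in \<open>\<real>\<^sup>n\<^sup>+\<^sup>1\<close>, bordered
  by a row of ones. A Householder reflection that sends a fixed row \<open>v\<close> to \<open>|v| e\<^sub>m\<close> leaves the law of the
  Gaussian rows invariant, so such a determinant is distributed as \<open>|v|\<close> times a smaller Gaussian
  determinant. Iterating, \<open>n! V\<close> is distributed as \<open>sqrt (n + 1)\<close> times a product of independent \<open>\<chi>\<^sub>j\<close>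
  variables for \<open>j = 1, \<dots>, n\<close>, and the moments are products of Gamma values.

  Up to factors with elementary asymptotics, \<open>\<Prod>i\<le>N. \<Gamma>(i + z) / \<Gamma>(i)\<close> is the reciprocal of the \<open>N\<close>-th partial product
  of \<open>G(1 + z)\<close>, because \<open>(\<Prod>i\<le>N. \<Gamma>(i + z)) (\<Prod>k\<le>N. (z + k)\<^sup>k) = \<Gamma>(z + N + 1)\<^sup>N\<close> telescopes. Even and odd
  \<open>j\<close> contribute the factors at \<open>z = t / 2\<close> and \<open>z = t / 2 - 1 / 2\<close>.\<close>

section \<open>Affine change of variables\<close>

text \<open>Three obstacles shape the proof. The dimension is a variable, so vectors and matrices
  are functions of natural indices and Lebesgue measure lives on a product space; how it scales
  under affine maps is derived by induction on the dimension through Schur complements. The moments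
  converge only for Re t > -1, whereas the limit is asserted off the negative integers. There the
  expectation means the meromorphic continuation, which must agree with the integral wherever that
  converges; hence divergence for Re t \<le> -1 has to be proved as well, from the pole at -1
  contributed by the \<chi> variable with one degree of freedom. Finally, the telescoped product is
  the N-th power of Gamma(z + N + 1) / N!, so it is too weak that Gamma(z + N + 1) / (N! N^z) tends
  to 1: the ratio has to be known up to o(1/N), uniformly on compact sets. The expansion 1 + (z^2 +
  z) / (2 N) + O(N^-2) supplies this. The odd degrees of freedom are normalised by Gamma(i - 1/2),
  that is by the product at z = -1/2, which is the origin of the constant G(1/2).\<close>

abbreviation fmat :: "nat \<Rightarrow> (nat \<Rightarrow> nat \<Rightarrow> real) \<Rightarrow> real mat" where
  "fmat n A \<equiv> mat n n (\<lambda>(i, j). A i j)"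

abbreviation fdet :: "nat \<Rightarrow> (nat \<Rightarrow> nat \<Rightarrow> real) \<Rightarrow> real" where
  "fdet n A \<equiv> Determinant.det (fmat n A)"

section \<open>Determinants of matrices given by functions\<close>

lemma fdet_cong:
  assumes "\<And>i j. i < n \<Longrightarrow> j < n \<Longrightarrow> A i j = B i j"
  shows "fdet n A = fdet n B"
  by (rule arg_cong[where f = Determinant.det]) (use assms in \<open>auto intro!: eq_matI\<close>)

lemma fdet_transpose: "fdet n (\<lambda>i j. A j i) = fdet n A"
proof -
  have "fmat n (\<lambda>i j. A j i) = transpose_mat (fmat n A)"
    by (auto intro!: eq_matI)
  then show ?thesis
    using Determinant.det_transpose[of "fmat n A" n] by (simp only: mat_carrier)
qed

lemma fdet_mult: "fdet n (\<lambda>i j. \<Sum>k<n. A i k * B k j) = fdet n A * fdet n B"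
proof -
  have "fmat n (\<lambda>i j. \<Sum>k<n. A i k * B k j) = fmat n A * fmat n B"
    by (rule eq_matI) (auto simp: scalar_prod_def lessThan_atLeast0)
  then show ?thesis
    using Determinant.det_mult[of "fmat n A" n "fmat n B"] by (simp only: mat_carrier)
qed

lemma fdet_last_row:
  assumes "\<And>j. j < n \<Longrightarrow> A n j = 0"
  shows "fdet (Suc n) A = A n n * fdet n A"
proof -
  have "fdet (Suc n) A = (\<Sum>j<Suc n. fmat (Suc n) A $$ (n, j) * cofactor (fmat (Suc n) A) n j)"
    by (rule laplace_expansion_row) auto
  also have "\<dots> = A n n * cofactor (fmat (Suc n) A) n n"
    using assms by simp
  also have "mat_delete (fmat (Suc n) A) n n = fmat n A"
    by (rule eq_matI) (auto simp: mat_delete_def)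
  then have "cofactor (fmat (Suc n) A) n n = fdet n A"
    by (simp add: cofactor_def)
  finally show ?thesis .
qed

lemma fdet_last_column:
  assumes "\<And>i. i < n \<Longrightarrow> A i n = 0"
  shows "fdet (Suc n) A = A n n * fdet n A"
  using fdet_last_row[of n "\<lambda>i j. A j i"] assms
  by (simp only: fdet_transpose[of "Suc n" A] fdet_transpose[of n A])

lemma fdet_id [simp]: "fdet n (\<lambda>i j. if i = j then 1 else 0) = 1"
proof -
  have "fmat n (\<lambda>i j. if i = j then 1 else 0) = 1\<^sub>m n"
    by (rule eq_matI) auto
  then show ?thesis by simp
qed

text \<open>Gaussian elimination with the pivot \<open>A n n\<close>: the unit triangular matrix
  \<open>U\<close> subtracts multiples of row \<open>n\<close> from the rows above it, which clears
  the last column above the pivot without changing the determinant. The surviving block is the Schur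
  complement of the pivot.\<close>

lemma fdet_Schur:
  assumes "A n n \<noteq> 0"
  shows "fdet (Suc n) A = A n n * fdet n (\<lambda>i j. A i j - A i n * A n j / A n n)"
proof -
  define U :: "nat \<Rightarrow> nat \<Rightarrow> real" where
    "U = (\<lambda>i k. (if k = i then 1 else 0) - (if k = n then (if i < n then A i n / A n n else 0) else 0))"
  have UA: "(\<Sum>k<Suc n. U i k * A k j) = A i j - (if i < n then A i n / A n n else 0) * A n j"
    if "i < Suc n" for i j
  proof -
    have "(\<Sum>k<Suc n. U i k * A k j) = (\<Sum>k<Suc n. (if k = i then A k j else 0) -
        (if k = n then (if i < n then A i n / A n n else 0) * A k j else 0))"
      by (intro sum.cong) (auto simp: U_def)
    with that show ?thesis
      by (simp add: sum_subtractf del: sum.lessThan_Suc)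
  qed
  have "fdet (Suc n) U = 1"
  proof -
    have "fdet n U = fdet n (\<lambda>i j. if i = j then 1 else 0)"
      by (rule fdet_cong) (simp add: U_def)
    moreover have "U n n = 1" "\<And>j. j < n \<Longrightarrow> U n j = 0" by (simp_all add: U_def)
    ultimately show ?thesis
      by (simp add: fdet_last_row)
  qed
  then have "fdet (Suc n) A = fdet (Suc n) (\<lambda>i j. \<Sum>k<Suc n. U i k * A k j)"
    by (subst fdet_mult) simp
  also have "\<dots> = fdet (Suc n) (\<lambda>i j. A i j - (if i < n then A i n / A n n else 0) * A n j)"
    using UA by (intro fdet_cong) auto
  also have "\<dots> = A n n * fdet n (\<lambda>i j. A i j - (if i < n then A i n / A n n else 0) * A n j)"
    using assms by (subst fdet_last_column) auto
  also have "fdet n (\<lambda>i j. A i j - (if i < n then A i n / A n n else 0) * A n j) =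
    fdet n (\<lambda>i j. A i j - A i n * A n j / A n n)"
    by (rule fdet_cong) auto
  finally show ?thesis .
qed

section \<open>Lebesgue measure under affine maps\<close>

abbreviation Leb :: "nat \<Rightarrow> (nat \<Rightarrow> real) measure" where
  "Leb n \<equiv> \<Pi>\<^sub>M k\<in>{..<n}. lborel"

definition affine_map :: "nat \<Rightarrow> (nat \<Rightarrow> nat \<Rightarrow> real) \<Rightarrow> (nat \<Rightarrow> real) \<Rightarrow> (nat \<Rightarrow> real) \<Rightarrow> nat \<Rightarrow> real" where
  "affine_map n A b x = (\<lambda>i\<in>{..<n}. b i + (\<Sum>j<n. A i j * x j))"

lemma measurable_affine_map [measurable]: "affine_map n A b \<in> Leb n \<rightarrow>\<^sub>M Leb n"
  unfolding affine_map_def by measurable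

text \<open>The translation \<open>b\<close> is quantified inside because, in the induction over the
  dimension, the last coordinate is absorbed into the translation; a statement for a fixed
  \<open>b\<close> would not carry over.\<close>

definition lebesgue_scaling :: "nat \<Rightarrow> (nat \<Rightarrow> nat \<Rightarrow> real) \<Rightarrow> bool" where
  "lebesgue_scaling n A \<longleftrightarrow> (\<forall>f\<in>borel_measurable (Leb n). \<forall>b.
     (\<integral>\<^sup>+x. f (affine_map n A b x) \<partial>Leb n) = ennreal (1 / \<bar>fdet n A\<bar>) * (\<integral>\<^sup>+x. f x \<partial>Leb n))"

text \<open>Fubini twice. For fixed \<open>x\<close>, a substitution in the last variable makes the
  last coordinate of the image equal to \<open>y\<close> and costs 1 / |A n n|. For fixed
  \<open>y\<close>, the other coordinates are then an affine function of \<open>x\<close> whose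
  linear part is the Schur complement, to which the hypothesis applies. The two factors multiply to
  1 / |det A|.\<close>

lemma lebesgue_scaling_pivot:
  assumes d: "A n n \<noteq> 0" and IH: "lebesgue_scaling n (\<lambda>i j. A i j - A i n * A n j / A n n)"
  shows "lebesgue_scaling (Suc n) A"
  unfolding lebesgue_scaling_def
proof (intro ballI allI)
  fix f :: "(nat \<Rightarrow> real) \<Rightarrow> ennreal" and b :: "nat \<Rightarrow> real"
  assume f[measurable]: "f \<in> borel_measurable (Leb (Suc n))"
  interpret product_sigma_finite "\<lambda>_::nat. lborel::real measure" by standard
  interpret pair_sigma_finite "Leb n" lborel
    by (intro pair_sigma_finite.intro sigma_finite sigma_finite_lborel) auto
  define A' where "A' = (\<lambda>i j. A i j - A i n * A n j / A n n)"
  \<comment> \<open>Row \<open>n\<close> of the affine map takes the value \<open>y\<close> where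
    the last variable is \<open>t x + 1 / A n n * y\<close>; \<open>b' y\<close> is the shift left
    in the other rows after that variable is eliminated.\<close>
  define t where "t = (\<lambda>x. - (b n + (\<Sum>j<n. A n j * x j)) / A n n)"
  define b' where "b' = (\<lambda>y i. b i + A i n * (y - b n) / A n n)"
  have upd [measurable]: "(\<lambda>(x, y). x(n := y)) \<in> Leb n \<Otimes>\<^sub>M lborel \<rightarrow>\<^sub>M Leb (Suc n)"
    using measurable_add_dim[of n "{..<n}" "\<lambda>_. lborel::real measure"] by (simp add: lessThan_Suc)
  have t[measurable]: "t \<in> borel_measurable (Leb n)"
    unfolding t_def by measurable
  have joint: "(\<lambda>(x, y). affine_map (Suc n) A b (x(n := t x + 1 / A n n * y)))
      \<in> Leb n \<Otimes>\<^sub>M lborel \<rightarrow>\<^sub>M Leb (Suc n)"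
  proof -
    have 1: "(\<lambda>p. (fst p, t (fst p) + 1 / A n n * snd p)) \<in> Leb n \<Otimes>\<^sub>M lborel \<rightarrow>\<^sub>M Leb n \<Otimes>\<^sub>M lborel"
      by measurable
    have "(\<lambda>p. affine_map (Suc n) A b ((\<lambda>(x, y). x(n := y)) (fst p, t (fst p) + 1 / A n n * snd p)))
      \<in> Leb n \<Otimes>\<^sub>M lborel \<rightarrow>\<^sub>M Leb (Suc n)"
      by (rule measurable_compose[OF measurable_compose[OF 1 upd] measurable_affine_map])
    then show ?thesis by (simp add: case_prod_beta')
  qed
  have eq: "affine_map (Suc n) A b (x(n := t x + 1 / A n n * y)) = (affine_map n A' (b' y) x)(n := y)" for x y
  proof
    fix i
    consider "i < n" | "i = n" | "i > n" by linarith
    then show "affine_map (Suc n) A b (x(n := t x + 1 / A n n * y)) i = ((affine_map n A' (b' y) x)(n := y)) i"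
    proof cases
      case 1
      have "(\<Sum>j<n. A' i j * x j) = (\<Sum>j<n. A i j * x j) - A i n / A n n * (\<Sum>j<n. A n j * x j)"
        by (simp add: A'_def left_diff_distrib sum_subtractf sum_distrib_left sum_divide_distrib mult.assoc)
      with 1 d show ?thesis
        by (simp add: affine_map_def t_def b'_def field_simps)
    next
      case 2
      with d show ?thesis by (simp add: affine_map_def t_def field_simps)
    qed (auto simp: affine_map_def)
  qed
  have "(\<integral>\<^sup>+x. f (affine_map (Suc n) A b x) \<partial>Leb (Suc n)) =
    (\<integral>\<^sup>+x. \<integral>\<^sup>+y. f (affine_map (Suc n) A b (x(n := y))) \<partial>lborel \<partial>Leb n)"
    unfolding lessThan_Suc using measurable_affine_map[of "Suc n" A b]
    by (subst product_nn_integral_insert) (auto simp: lessThan_Suc[symmetric])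
  also have "\<dots> = (\<integral>\<^sup>+x. ennreal (1 / \<bar>A n n\<bar>) *
      (\<integral>\<^sup>+y. f (affine_map (Suc n) A b (x(n := t x + 1 / A n n * y))) \<partial>lborel) \<partial>Leb n)"
  proof (rule nn_integral_cong)
    fix x assume x: "x \<in> space (Leb n)"
    have "(\<lambda>y. x(n := y)) \<in> lborel \<rightarrow>\<^sub>M Leb (Suc n)"
      using measurable_compose[OF measurable_Pair1'[OF x] upd] by simp
    then have "(\<lambda>y. f (affine_map (Suc n) A b (x(n := y)))) \<in> borel_measurable borel"
      by measurable
    then show "(\<integral>\<^sup>+y. f (affine_map (Suc n) A b (x(n := y))) \<partial>lborel) = ennreal (1 / \<bar>A n n\<bar>) *
      (\<integral>\<^sup>+y. f (affine_map (Suc n) A b (x(n := t x + 1 / A n n * y))) \<partial>lborel)"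
      using nn_integral_real_affine[of "\<lambda>y. f (affine_map (Suc n) A b (x(n := y)))" "1 / A n n" "t x"] d
      by simp
  qed
  also have "\<dots> = ennreal (1 / \<bar>A n n\<bar>) *
      (\<integral>\<^sup>+x. \<integral>\<^sup>+y. f (affine_map (Suc n) A b (x(n := t x + 1 / A n n * y))) \<partial>lborel \<partial>Leb n)"
    using measurable_compose[OF joint f]
    by (intro nn_integral_cmult lborel.borel_measurable_nn_integral) (auto simp: case_prod_beta')
  also have "(\<integral>\<^sup>+x. \<integral>\<^sup>+y. f (affine_map (Suc n) A b (x(n := t x + 1 / A n n * y))) \<partial>lborel \<partial>Leb n) =
      (\<integral>\<^sup>+y. \<integral>\<^sup>+x. f (affine_map (Suc n) A b (x(n := t x + 1 / A n n * y))) \<partial>Leb n \<partial>lborel)"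
    using measurable_compose[OF joint f] by (intro Fubini'[symmetric]) (simp add: case_prod_beta')
  also have "\<dots> = (\<integral>\<^sup>+y. \<integral>\<^sup>+x. f ((affine_map n A' (b' y) x)(n := y)) \<partial>Leb n \<partial>lborel)"
    by (simp only: eq)
  also have "\<dots> = (\<integral>\<^sup>+y. ennreal (1 / \<bar>fdet n A'\<bar>) * (\<integral>\<^sup>+x. f (x(n := y)) \<partial>Leb n) \<partial>lborel)"
  proof (rule nn_integral_cong)
    fix y :: real
    have "(\<lambda>x. f (x(n := y))) \<in> borel_measurable (Leb n)"
      using measurable_compose[OF measurable_compose[OF measurable_Pair2' upd] f, of y] by simp
    then show "(\<integral>\<^sup>+x. f ((affine_map n A' (b' y) x)(n := y)) \<partial>Leb n) =
      ennreal (1 / \<bar>fdet n A'\<bar>) * (\<integral>\<^sup>+x. f (x(n := y)) \<partial>Leb n)"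
      using IH[unfolded lebesgue_scaling_def A'_def[symmetric], rule_format, of "\<lambda>x. f (x(n := y))" "b' y"]
      by simp
  qed
  also have "\<dots> = ennreal (1 / \<bar>fdet n A'\<bar>) * (\<integral>\<^sup>+y. \<integral>\<^sup>+x. f (x(n := y)) \<partial>Leb n \<partial>lborel)"
    using measurable_compose[OF measurable_compose[OF measurable_pair_swap' upd] f]
    by (intro nn_integral_cmult M1.borel_measurable_nn_integral) (simp add: case_prod_beta')
  also have "(\<integral>\<^sup>+y. \<integral>\<^sup>+x. f (x(n := y)) \<partial>Leb n \<partial>lborel) = (\<integral>\<^sup>+x. f x \<partial>Leb (Suc n))"
    unfolding lessThan_Suc using f
    by (subst product_nn_integral_insert_rev) (auto simp: lessThan_Suc[symmetric])
  finally show "(\<integral>\<^sup>+x. f (affine_map (Suc n) A b x) \<partial>Leb (Suc n)) =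
      ennreal (1 / \<bar>fdet (Suc n) A\<bar>) * (\<integral>\<^sup>+x. f x \<partial>Leb (Suc n))"
    using fdet_Schur[of A n] d
    by (simp add: A'_def mult.assoc[symmetric] ennreal_mult'[symmetric] abs_mult)
qed

text \<open>A zero pivot is repaired by row operations: adding a row \<open>i\<close> with
  \<open>A i n\<close> nonzero to row \<open>n\<close> gives \<open>C\<close> with a nonzero pivot
  and the same determinant, and \<open>D\<close> undoes the addition. Both factors of A = D C fall
  under the pivot case.\<close>

lemma lebesgue_scaling_det:
  assumes "fdet n A \<noteq> 0"
  shows "lebesgue_scaling n A"
  using assms
proof (induction n arbitrary: A)
  case 0
  then show ?case
    by (auto simp: lebesgue_scaling_def PiM_empty nn_integral_count_space_finite affine_map_def restrict_def)
next
  case (Suc n)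
  have pivot: "lebesgue_scaling (Suc n) A" if "A n n \<noteq> 0" "fdet (Suc n) A \<noteq> 0" for A
    using that fdet_Schur[of A n] by (intro lebesgue_scaling_pivot Suc.IH) auto
  show ?case
  proof (cases "A n n = 0")
    case False
    with Suc.prems show ?thesis by (intro pivot)
  next
    case True
    obtain i where i: "i < n" "A i n \<noteq> 0"
      using fdet_last_column[of n A] Suc.prems True by auto
    define C where "C = (\<lambda>k j. if k = n then A i j + A n j else A k j)"
    define D :: "nat \<Rightarrow> nat \<Rightarrow> real" where
      "D = (\<lambda>k j. if k = j then 1 else if k = n \<and> j = i then -1 else 0)"
    have "fmat (Suc n) C = addrow 1 n i (fmat (Suc n) A)"
      using i by (intro eq_matI) (auto simp: C_def)
    then have detC: "fdet (Suc n) C = fdet (Suc n) A"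
      using i by (simp add: det_addrow[where n = "Suc n"])
    have detD: "fdet (Suc n) D = 1"
      using fdet_last_column[of n D] i fdet_cong[of n D "\<lambda>i j. if i = j then 1 else 0"]
      by (auto simp: D_def)
    have sC: "lebesgue_scaling (Suc n) C"
    proof (rule pivot)
      show "C n n \<noteq> 0" using i True by (simp add: C_def)
      show "fdet (Suc n) C \<noteq> 0" using Suc.prems detC by metis
    qed
    have sD: "lebesgue_scaling (Suc n) D"
      by (intro pivot) (simp_all add: detD, simp add: D_def)
    show ?thesis
      unfolding lebesgue_scaling_def
    proof (intro ballI allI)
      fix f :: "(nat \<Rightarrow> real) \<Rightarrow> ennreal" and b :: "nat \<Rightarrow> real"
      assume f[measurable]: "f \<in> borel_measurable (Leb (Suc n))"
      \<comment> \<open>The translation undergoes the same row addition as the matrix, so that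
        \<open>D\<close> without translation restores \<open>b\<close>.\<close>
      define c where "c = (\<lambda>k. if k = n then b i + b n else b k)"
      have D: "(\<Sum>j<Suc n. D k j * y j) = (if k = n then y n - y i else y k)" if "k < Suc n" for k y
      proof -
        have "(\<Sum>j<Suc n. D k j * y j) = (\<Sum>j<Suc n. (if j = k then y j else 0) - (if j = i then if k = n then y j else 0 else 0))"
          using i by (intro sum.cong) (auto simp: D_def)
        also have "\<dots> = (if k = n then y n - y i else y k)"
          using that i by (simp add: sum_subtractf del: sum.lessThan_Suc)
        finally show ?thesis .
      qed
      have eq: "affine_map (Suc n) A b x = affine_map (Suc n) D (\<lambda>_. 0) (affine_map (Suc n) C c x)" for x
      proof
        fix k
        show "affine_map (Suc n) A b x k = affine_map (Suc n) D (\<lambda>_. 0) (affine_map (Suc n) C c x) k"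
        proof (cases "k < Suc n")
          case True
          then have "affine_map (Suc n) D (\<lambda>_. 0) (affine_map (Suc n) C c x) k =
              (if k = n then affine_map (Suc n) C c x n - affine_map (Suc n) C c x i else affine_map (Suc n) C c x k)"
            by (subst affine_map_def) (simp add: D del: sum.lessThan_Suc)
          with True i show ?thesis
            by (auto simp: affine_map_def C_def c_def distrib_right sum.distrib simp del: sum.lessThan_Suc)
        qed (auto simp: affine_map_def)
      qed
      have "(\<integral>\<^sup>+x. f (affine_map (Suc n) A b x) \<partial>Leb (Suc n)) =
          ennreal (1 / \<bar>fdet (Suc n) C\<bar>) * (\<integral>\<^sup>+x. f (affine_map (Suc n) D (\<lambda>_. 0) x) \<partial>Leb (Suc n))"
        unfolding eq using sC[unfolded lebesgue_scaling_def, rule_format, of "\<lambda>x. f (affine_map (Suc n) D (\<lambda>_. 0) x)" c]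
        by simp
      also have "\<dots> = ennreal (1 / \<bar>fdet (Suc n) A\<bar>) * (\<integral>\<^sup>+x. f x \<partial>Leb (Suc n))"
        using sD[unfolded lebesgue_scaling_def, rule_format, OF f] by (simp add: detC detD)
      finally show "(\<integral>\<^sup>+x. f (affine_map (Suc n) A b x) \<partial>Leb (Suc n)) =
          ennreal (1 / \<bar>fdet (Suc n) A\<bar>) * (\<integral>\<^sup>+x. f x \<partial>Leb (Suc n))" .
    qed
  qed
qed

section \<open>Volume of a simplex\<close>

text \<open>A line in direction \<open>j\<close> meets the hyperplane in one point, which is null
  for \<open>lborel\<close>; Fubini does the rest.\<close>

lemma emeasure_hyperplane_eq_0:
  assumes "j < n" "w j \<noteq> 0"
  shows "emeasure (Leb n) {x \<in> space (Leb n). (\<Sum>k<n. w k * x k) = c} = 0"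
proof -
  let ?H = "{x \<in> space (Leb n). (\<Sum>k<n. w k * x k) = c}" and ?J = "{..<n} - {j}"
  interpret product_sigma_finite "\<lambda>_::nat. lborel::real measure" by standard
  have n: "{..<n} = insert j ?J" using assms by auto
  have H: "?H \<in> sets (Leb n)" by measurable
  have "emeasure (Leb n) ?H = (\<integral>\<^sup>+x. indicator ?H x \<partial>Leb n)"
    using H by simp
  also have "\<dots> = (\<integral>\<^sup>+x. \<integral>\<^sup>+y. indicator ?H (x(j := y)) \<partial>lborel \<partial>(\<Pi>\<^sub>M k\<in>?J. lborel))"
    using H by (subst n, subst product_nn_integral_insert) (auto simp: assms insert_absorb)
  also have "\<dots> \<le> (\<integral>\<^sup>+x. 0 \<partial>(\<Pi>\<^sub>M k\<in>?J. lborel :: real measure))"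
  proof (rule nn_integral_mono)
    fix x :: "nat \<Rightarrow> real"
    have "(\<integral>\<^sup>+y. indicator ?H (x(j := y)) \<partial>lborel)
        \<le> (\<integral>\<^sup>+y. indicator {(c - (\<Sum>k\<in>?J. w k * x k)) / w j} y \<partial>(lborel :: real measure))"
    proof (intro nn_integral_mono)
      fix y
      have "(\<Sum>k<n. w k * (x(j := y)) k) = w j * y + (\<Sum>k\<in>?J. w k * x k)"
        by (subst n, subst sum.insert) (auto intro!: sum.cong)
      then show "indicator ?H (x(j := y)) \<le> (indicator {(c - (\<Sum>k\<in>?J. w k * x k)) / w j} y :: ennreal)"
        using assms by (auto simp: indicator_def field_simps)
    qed
    then show "(\<integral>\<^sup>+y. indicator ?H (x(j := y)) \<partial>lborel) \<le> 0"
      by simp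
  qed
  finally show ?thesis by simp
qed

section \<open>The standard simplex and its affine images\<close>

definition std_simplex :: "nat \<Rightarrow> (nat \<Rightarrow> real) set" where
  "std_simplex n = {x \<in> space (Leb n). (\<forall>i<n. 0 \<le> x i) \<and> (\<Sum>i<n. x i) \<le> 1}"

lemma sets_std_simplex [measurable]: "std_simplex n \<in> sets (Leb n)"
  unfolding std_simplex_def by measurable

lemma emeasure_std_simplex_PiM: "emeasure (Leb n) (std_simplex n) = ennreal (1 / fact n)"
proof -
  have "std_simplex n = {x. (\<forall>i\<in>{..<n}. 0 \<le> x i) \<and> sum x {..<n} \<le> 1} \<inter> space (Leb n)"
    by (auto simp: std_simplex_def)
  then show ?thesis
    using emeasure_std_simplex_aux[of "{..<n}" 1] by simp
qed

text \<open>Barycentric coordinates with the weight of vertex \<open>n\<close> eliminated: it is 1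
  minus the sum of the others, and its nonnegativity is the bound on the sum in the standard
  simplex.\<close>

lemma simplex_hull_eq_image:
  "simplex_hull n p = affine_map n (\<lambda>k i. p i k - p n k) (p n) ` std_simplex n"
proof -
  have aff: "(\<lambda>k\<in>{..<n}. \<Sum>i\<le>n. u i * p i k) = affine_map n (\<lambda>k i. p i k - p n k) (p n) (restrict u {..<n})"
    if "(\<Sum>i\<le>n. u i) = 1" for u
  proof -
    from that have "u n = 1 - (\<Sum>i<n. u i)" by (simp flip: lessThan_Suc_atMost)
    moreover have "(\<Sum>i<n. (p i k - p n k) * u i) = (\<Sum>i<n. u i * p i k) - (\<Sum>i<n. u i) * p n k" for k
      by (simp add: left_diff_distrib sum_subtractf sum_distrib_right mult.commute[of "u _"])
    ultimately show ?thesis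
      by (auto simp: affine_map_def left_diff_distrib simp flip: lessThan_Suc_atMost intro!: restrict_ext)
  qed
  show ?thesis
  proof (intro equalityI subsetI)
    fix y assume "y \<in> simplex_hull n p"
    then obtain u where u: "y = (\<lambda>k\<in>{..<n}. \<Sum>i\<le>n. u i * p i k)" "\<forall>i\<le>n. 0 \<le> u i" "(\<Sum>i\<le>n. u i) = 1"
      by (auto simp: simplex_hull_def)
    then have "restrict u {..<n} \<in> std_simplex n"
      by (auto simp: std_simplex_def space_PiM simp flip: lessThan_Suc_atMost)
    with u aff show "y \<in> affine_map n (\<lambda>k i. p i k - p n k) (p n) ` std_simplex n"
      by blast
  next
    fix y assume "y \<in> affine_map n (\<lambda>k i. p i k - p n k) (p n) ` std_simplex n"
    then obtain x where x: "x \<in> std_simplex n" "y = affine_map n (\<lambda>k i. p i k - p n k) (p n) x"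
      by auto
    define u where "u = x(n := 1 - (\<Sum>i<n. x i))"
    have "restrict u {..<n} = x"
      using x by (auto simp: u_def std_simplex_def space_PiM PiE_def extensional_def)
    moreover have "(\<Sum>i\<le>n. u i) = 1"
      by (simp add: u_def flip: lessThan_Suc_atMost)
    moreover have "\<forall>i\<le>n. 0 \<le> u i"
      using x by (auto simp: u_def std_simplex_def)
    ultimately show "y \<in> simplex_hull n p"
      using x aff[of u] unfolding simplex_hull_def by (intro CollectI exI[of _ u]) auto
  qed
qed

text \<open>The adjugate divided by the determinant, with both inverse laws spelled out as
  sums.\<close>

lemma fdet_inverse:
  assumes "fdet n A \<noteq> 0"
  obtains C where "\<And>i j. i < n \<Longrightarrow> j < n \<Longrightarrow> (\<Sum>k<n. A i k * C k j) = (if i = j then 1 else 0)"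
    and "\<And>i j. i < n \<Longrightarrow> j < n \<Longrightarrow> (\<Sum>k<n. C i k * A k j) = (if i = j then 1 else 0)"
proof -
  define d where "d = fdet n A"
  define B where "B = adj_mat (fmat n A)"
  have B: "B \<in> carrier_mat n n" "fmat n A * B = d \<cdot>\<^sub>m 1\<^sub>m n" "B * fmat n A = d \<cdot>\<^sub>m 1\<^sub>m n"
    unfolding B_def d_def using adj_mat[of "fmat n A" n] by auto
  have "(\<Sum>k<n. A i k * (B $$ (k, j) / d)) = (if i = j then 1 else 0)" if "i < n" "j < n" for i j
  proof -
    have "(fmat n A * B) $$ (i, j) = (\<Sum>k<n. A i k * B $$ (k, j))"
      using that B(1) by (auto simp: scalar_prod_def lessThan_atLeast0)
    then show ?thesis
      using that assms by (auto simp: B(2) sum_divide_distrib[symmetric] d_def)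
  qed
  moreover have "(\<Sum>k<n. B $$ (i, k) / d * A k j) = (if i = j then 1 else 0)" if "i < n" "j < n" for i j
  proof -
    have "(B * fmat n A) $$ (i, j) = (\<Sum>k<n. B $$ (i, k) * A k j)"
      using that B(1) by (auto simp: scalar_prod_def lessThan_atLeast0)
    then show ?thesis
      using that assms by (auto simp: B(3) sum_divide_distrib[symmetric] d_def)
  qed
  ultimately show thesis by (rule that)
qed

lemma affine_map_inverse:
  assumes "\<And>i j. i < n \<Longrightarrow> j < n \<Longrightarrow> (\<Sum>k<n. C i k * A k j) = (if i = j then 1 else 0)"
    and "x \<in> space (Leb n)"
  shows "affine_map n C (\<lambda>i. c i - (\<Sum>k<n. C i k * b k)) (affine_map n A b x) = (\<lambda>i\<in>{..<n}. c i + x i)"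
proof -
  have "(\<Sum>j<n. C i j * (\<Sum>k<n. A j k * x k)) = x i" if "i < n" for i
  proof -
    have "(\<Sum>j<n. C i j * (\<Sum>k<n. A j k * x k)) = (\<Sum>k<n. (\<Sum>j<n. C i j * A j k) * x k)"
      unfolding sum_distrib_left sum_distrib_right by (subst sum.swap) (simp add: mult.assoc)
    also have "\<dots> = (\<Sum>k<n. if k = i then x k else 0)"
      using that assms(1) by (intro sum.cong) auto
    finally show ?thesis using that by simp
  qed
  then show ?thesis
    by (auto simp: affine_map_def distrib_left sum.distrib intro!: restrict_ext)
qed

text \<open>If the edge vectors are independent, the hull is the affine image of the standard
  simplex, of volume 1 / n!, and at the same time its preimage under the inverse map, which shows
  measurability. Otherwise the hull lies in a hyperplane and both sides vanish.\<close>

lemma simplex_volume_eq_det: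
  "simplex_volume n p = \<bar>fdet n (\<lambda>k i. p i k - p n k)\<bar> / fact n"
proof -
  define A where "A = (\<lambda>k i. p i k - p n k)"
  have hull: "simplex_hull n p = affine_map n A (p n) ` std_simplex n"
    by (simp add: simplex_hull_eq_image A_def)
  show ?thesis
  proof (cases "fdet n A = 0")
    case False
    obtain C where C: "\<And>i j. i < n \<Longrightarrow> j < n \<Longrightarrow> (\<Sum>k<n. A i k * C k j) = (if i = j then 1 else 0)"
      "\<And>i j. i < n \<Longrightarrow> j < n \<Longrightarrow> (\<Sum>k<n. C i k * A k j) = (if i = j then 1 else 0)"
      using fdet_inverse[OF False] by blast
    define h where "h = affine_map n C (\<lambda>i. 0 - (\<Sum>k<n. C i k * p n k))"
    have [measurable]: "h \<in> Leb n \<rightarrow>\<^sub>M Leb n" by (simp add: h_def)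
    have hg: "h (affine_map n A (p n) x) = x" if "x \<in> space (Leb n)" for x
      using affine_map_inverse[OF C(2) that, of "\<lambda>_. 0" "p n"] that
      by (auto simp: h_def space_PiM PiE_def extensional_restrict)
    have gh: "affine_map n A (p n) (h y) = y" if "y \<in> space (Leb n)" for y
    proof -
      have "(\<Sum>k<n. A i k * (0 - (\<Sum>l<n. C k l * p n l))) = - p n i" if "i < n" for i
      proof -
        have "(\<Sum>k<n. A i k * (\<Sum>l<n. C k l * p n l)) = (\<Sum>l<n. (\<Sum>k<n. A i k * C k l) * p n l)"
          unfolding sum_distrib_left sum_distrib_right by (subst sum.swap) (simp add: mult.assoc)
        also have "\<dots> = (\<Sum>k<n. if k = i then p n k else 0)"
          using that C(1) by (intro sum.cong) auto
        finally show ?thesis using that by (simp add: sum_negf)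
      qed
      then have "affine_map n A (p n) (h y) =
          affine_map n A (\<lambda>i. 0 - (\<Sum>k<n. A i k * (0 - (\<Sum>l<n. C k l * p n l)))) (h y)"
        by (auto simp: affine_map_def intro!: restrict_ext)
      also have "\<dots> = y"
        unfolding h_def using affine_map_inverse[OF C(1) that, of "\<lambda>_. 0" "\<lambda>i. 0 - (\<Sum>k<n. C i k * p n k)"] that
        by (auto simp: space_PiM PiE_def extensional_restrict)
      finally show ?thesis .
    qed
    have sp: "affine_map n A (p n) x \<in> space (Leb n)" for x
      by (simp add: affine_map_def space_PiM)
    have hull': "simplex_hull n p = h -` std_simplex n \<inter> space (Leb n)"
    proof -
      have "\<And>x. x \<in> std_simplex n \<Longrightarrow> x \<in> space (Leb n)" by (simp add: std_simplex_def)
      then show ?thesis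
        unfolding hull using hg gh sp by (auto simp: image_iff) metis
    qed
    then have meas: "simplex_hull n p \<in> sets (Leb n)" by simp
    have "ennreal (1 / fact n) = (\<integral>\<^sup>+x. indicator (std_simplex n) x \<partial>Leb n)"
      by (simp add: emeasure_std_simplex_PiM)
    also have "\<dots> = (\<integral>\<^sup>+x. indicator (simplex_hull n p) (affine_map n A (p n) x) \<partial>Leb n)"
      by (intro nn_integral_cong) (auto simp: hull' hg sp indicator_def)
    also have "\<dots> = ennreal (1 / \<bar>fdet n A\<bar>) * emeasure (Leb n) (simplex_hull n p)"
      using lebesgue_scaling_det[OF False] meas
      by (simp add: lebesgue_scaling_def)
    finally have eq: "ennreal (1 / fact n) = ennreal (1 / \<bar>fdet n A\<bar>) * emeasure (Leb n) (simplex_hull n p)" .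
    have "emeasure (Leb n) (simplex_hull n p) =
        ennreal \<bar>fdet n A\<bar> * (ennreal (1 / \<bar>fdet n A\<bar>) * emeasure (Leb n) (simplex_hull n p))"
      using False by (simp add: mult.assoc[symmetric] ennreal_mult'[symmetric])
    also have "\<dots> = ennreal (\<bar>fdet n A\<bar> / fact n)"
      by (simp add: eq[symmetric] ennreal_mult'[symmetric])
    finally show ?thesis
      by (simp add: simplex_volume_def measure_def A_def)
  next
    case True
    \<comment> \<open>A singular \<open>A\<close> has a nonzero vector \<open>w\<close> orthogonal
      to all its columns; the linear form with coefficients \<open>w\<close> is constant on the
      hull.\<close>
    have "Determinant.det (fmat n (\<lambda>i k. A k i)) = 0"
      using True fdet_transpose[of n A] by metis
    then obtain v where v: "v \<in> carrier_vec n" "v \<noteq> 0\<^sub>v n" "fmat n (\<lambda>i k. A k i) *\<^sub>v v = 0\<^sub>v n"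
      using det_0_iff_vec_prod_zero_field[of "fmat n (\<lambda>i k. A k i)" n] by auto
    define w where "w = (\<lambda>k. v $ k)"
    obtain j where j: "j < n" "w j \<noteq> 0"
      using v by (auto simp: w_def vec_eq_iff)
    have wA: "(\<Sum>k<n. w k * A k i) = 0" if "i < n" for i
    proof -
      have "(fmat n (\<lambda>i k. A k i) *\<^sub>v v) $ i = (\<Sum>k<n. w k * A k i)"
        using that v(1) by (auto simp: scalar_prod_def w_def lessThan_atLeast0 mult.commute)
      with that v(3) show ?thesis by simp
    qed
    let ?H = "{y \<in> space (Leb n). (\<Sum>k<n. w k * y k) = (\<Sum>k<n. w k * p n k)}"
    have "simplex_hull n p \<subseteq> ?H"
    proof
      fix y assume "y \<in> simplex_hull n p"
      then obtain x where y: "y = affine_map n A (p n) x" unfolding hull by auto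
      have "(\<Sum>k<n. w k * (\<Sum>i<n. A k i * x i)) = (\<Sum>i<n. (\<Sum>k<n. w k * A k i) * x i)"
        unfolding sum_distrib_left sum_distrib_right by (subst sum.swap) (simp add: mult.assoc)
      then show "y \<in> ?H"
        using wA by (auto simp: y affine_map_def space_PiM distrib_left sum.distrib)
    qed
    then have "emeasure (Leb n) (simplex_hull n p) \<le> emeasure (Leb n) ?H"
      by (intro emeasure_mono) measurable
    then have "simplex_volume n p = 0"
      using emeasure_hyperplane_eq_0[of j n w] j by (simp add: simplex_volume_def measure_def)
    then show ?thesis using True by (simp add: A_def)
  qed
qed

text \<open>Eliminating with the corner entry 1 subtracts the last column from the others, which
  recovers the edge vectors. The bordered form is preferred because the edge vectors of a random
  simplex are dependent, whereas the rows of coordinates are independent.\<close>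

lemma simplex_volume_eq_bordered_det:
  "fact n * simplex_volume n p = \<bar>fdet (Suc n) ((\<lambda>k i. p i k)(n := \<lambda>_. 1))\<bar>"
proof -
  have "fdet (Suc n) ((\<lambda>k i. p i k)(n := \<lambda>_. 1)) =
    fdet n (\<lambda>i j. ((\<lambda>k i. p i k)(n := \<lambda>_. 1)) i j -
      ((\<lambda>k i. p i k)(n := \<lambda>_. 1)) i n * ((\<lambda>k i. p i k)(n := \<lambda>_. 1)) n j / ((\<lambda>k i. p i k)(n := \<lambda>_. 1)) n n)"
    by (subst fdet_Schur) simp_all
  also have "\<dots> = fdet n (\<lambda>k i. p i k - p n k)"
    by (rule fdet_cong) auto
  finally show ?thesis by (simp add: simplex_volume_eq_det)
qed

section \<open>Determinants of Gaussian matrices\<close>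

abbreviation std_Gaussian :: "nat \<Rightarrow> (nat \<Rightarrow> real) measure" where
  "std_Gaussian n \<equiv> \<Pi>\<^sub>M k\<in>{..<n}. std_normal_distribution"

abbreviation Gaussian_rows :: "nat \<Rightarrow> nat \<Rightarrow> (nat \<Rightarrow> nat \<Rightarrow> real) measure" where
  "Gaussian_rows m n \<equiv> \<Pi>\<^sub>M i\<in>{..<m}. std_Gaussian n"

lemma prob_space_std_normal: "prob_space std_normal_distribution"
  using real_dist_normal_dist by (simp add: real_distribution_def)

lemma prob_space_std_Gaussian: "prob_space (std_Gaussian n)"
  by (intro prob_space_PiM prob_space_std_normal)

lemma prob_space_Gaussian_rows: "prob_space (Gaussian_rows m n)"
  by (intro prob_space_PiM prob_space_std_Gaussian)

lemma sets_std_Gaussian [measurable_cong]: "sets (std_Gaussian n) = sets (Leb n)"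
  by (intro sets_PiM_cong) auto

lemma space_std_Gaussian: "space (std_Gaussian n) = space (Leb n)"
  by (simp add: space_PiM)

text \<open>The density depends on the squared norm alone, which serves both for the invariance
  under isometries and for the integration of radial functions.\<close>

lemma std_Gaussian_eq_density:
  "std_Gaussian n = density (Leb n) (\<lambda>x. ennreal ((1 / sqrt (2 * pi)) ^ n * exp (- (\<Sum>i<n. (x i)\<^sup>2) / 2)))"
proof (rule sym)
  interpret L: product_sigma_finite "\<lambda>_::nat. lborel::real measure" by standard
  interpret N: product_sigma_finite "\<lambda>_::nat. std_normal_distribution"
    using prob_space_std_normal by (simp add: product_sigma_finite_def prob_space_imp_sigma_finite)
  have dens: "(1 / sqrt (2 * pi)) ^ n * exp (- (\<Sum>i<n. (x i)\<^sup>2) / 2) = (\<Prod>i<n. std_normal_density (x i))" for x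
    by (simp add: normal_density_def prod_dividef power_one_over sum_negf sum_divide_distrib flip: exp_sum)
  let ?D = "density (Leb n) (\<lambda>x. ennreal ((1 / sqrt (2 * pi)) ^ n * exp (- (\<Sum>i<n. (x i)\<^sup>2) / 2)))"
  show "?D = std_Gaussian n"
  proof (rule N.PiM_eqI)
    show "sets ?D = sets (std_Gaussian n)" by (simp add: sets_std_Gaussian)
  next
    fix A assume A: "\<And>i. i \<in> {..<n} \<Longrightarrow> A i \<in> sets std_normal_distribution"
    then have A': "i < n \<Longrightarrow> A i \<in> sets borel" for i by auto
    have [measurable]: "Pi\<^sub>E {..<n} A \<in> sets (Leb n)"
      using A' by (intro sets_PiM_I_finite) auto
    have "emeasure ?D (Pi\<^sub>E {..<n} A) =
        (\<integral>\<^sup>+x. ennreal (\<Prod>i<n. std_normal_density (x i)) * indicator (Pi\<^sub>E {..<n} A) x \<partial>Leb n)"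
      unfolding dens by (subst emeasure_density) simp_all
    also have "\<dots> = (\<integral>\<^sup>+x. (\<Prod>i<n. ennreal (std_normal_density (x i)) * indicator (A i) (x i)) \<partial>Leb n)"
    proof (intro nn_integral_cong)
      fix x assume x: "x \<in> space (Leb n)"
      have "(indicator (Pi\<^sub>E {..<n} A) x :: ennreal) = (\<Prod>i<n. indicator (A i) (x i))"
        using x by (auto simp: indicator_def space_PiM PiE_def Pi_def)
      then show "ennreal (\<Prod>i<n. std_normal_density (x i)) * indicator (Pi\<^sub>E {..<n} A) x =
          (\<Prod>i<n. ennreal (std_normal_density (x i)) * indicator (A i) (x i))"
        by (simp add: prod.distrib prod_ennreal normal_density_nonneg)
    qed
    also have "\<dots> = (\<Prod>i<n. \<integral>\<^sup>+y. ennreal (std_normal_density y) * indicator (A i) y \<partial>lborel)"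
      using A' by (intro L.product_nn_integral_prod) auto
    also have "\<dots> = (\<Prod>i<n. emeasure std_normal_distribution (A i))"
      using A' by (intro prod.cong) (simp_all add: emeasure_density)
    finally show "emeasure ?D (Pi\<^sub>E {..<n} A) = (\<Prod>i<n. emeasure std_normal_distribution (A i))" .
  qed simp
qed

text \<open>The density is unchanged by an isometry, and Lebesgue measure by a map whose determinant
  has modulus 1.\<close>

lemma std_Gaussian_linear_invariant:
  assumes det: "\<bar>fdet n Q\<bar> = 1"
    and iso: "\<And>x. (\<Sum>i<n. (\<Sum>j<n. Q i j * x j)\<^sup>2) = (\<Sum>i<n. (x i)\<^sup>2)"
  shows "distr (std_Gaussian n) (std_Gaussian n) (affine_map n Q (\<lambda>_. 0)) = std_Gaussian n"
proof (rule measure_eqI)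
  let ?T = "affine_map n Q (\<lambda>_. 0)"
  let ?d = "\<lambda>x. ennreal ((1 / sqrt (2 * pi)) ^ n * exp (- (\<Sum>i<n. (x i)\<^sup>2) / 2))"
  fix S assume "S \<in> sets (distr (std_Gaussian n) (std_Gaussian n) ?T)"
  then have S[measurable]: "S \<in> sets (Leb n)" by (simp add: sets_std_Gaussian)
  have T[measurable]: "?T \<in> std_Gaussian n \<rightarrow>\<^sub>M std_Gaussian n"
    using measurable_affine_map by (simp cong: measurable_cong_sets add: sets_std_Gaussian)
  have dT: "?d (?T x) = ?d x" for x
    using iso[of x] by (simp add: affine_map_def)
  have pre: "?T -` S \<inter> space (Leb n) \<in> sets (Leb n)" by simp
  have "emeasure (distr (std_Gaussian n) (std_Gaussian n) ?T) S =
      emeasure (std_Gaussian n) (?T -` S \<inter> space (Leb n))"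
    using T S by (subst emeasure_distr) (auto simp: sets_std_Gaussian space_std_Gaussian)
  also have "\<dots> = (\<integral>\<^sup>+x. ?d x * indicator (?T -` S \<inter> space (Leb n)) x \<partial>Leb n)"
    unfolding std_Gaussian_eq_density using pre by (subst emeasure_density) simp_all
  also have "\<dots> = (\<integral>\<^sup>+x. ?d (?T x) * indicator S (?T x) \<partial>Leb n)"
    unfolding dT by (intro nn_integral_cong) (auto simp: indicator_def)
  also have "\<dots> = (\<integral>\<^sup>+x. ?d x * indicator S x \<partial>Leb n)"
  proof -
    have "fdet n Q \<noteq> 0" using det by auto
    from lebesgue_scaling_det[OF this, unfolded lebesgue_scaling_def, rule_format,
        of "\<lambda>x. ?d x * indicator S x" "\<lambda>_. 0"]
    show ?thesis by (simp add: det)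
  qed
  also have "\<dots> = emeasure (std_Gaussian n) S"
    unfolding std_Gaussian_eq_density by (subst emeasure_density) simp_all
  finally show "emeasure (distr (std_Gaussian n) (std_Gaussian n) ?T) S = emeasure (std_Gaussian n) S" .
qed simp

section \<open>Householder reflections\<close>

definition vnorm :: "nat \<Rightarrow> (nat \<Rightarrow> real) \<Rightarrow> real" where
  "vnorm n v = sqrt (\<Sum>i<n. (v i)\<^sup>2)"

lemma vnorm_nonneg [simp]: "0 \<le> vnorm n v"
  by (simp add: vnorm_def sum_nonneg)

lemma vnorm_power2: "(vnorm n v)\<^sup>2 = (\<Sum>i<n. (v i)\<^sup>2)"
  by (simp add: vnorm_def sum_nonneg)

text \<open>\<open>Q\<close> is the reflection I - 2 u u^T / |u|^2 with u = v - |v| e_m, which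
  interchanges \<open>v\<close> and |v| e_m. It is an involution, so its determinant squares to
  1.\<close>

lemma Householder:
  fixes v :: "nat \<Rightarrow> real"
  obtains Q where "\<bar>fdet (Suc m) Q\<bar> = 1"
    "\<And>x. (\<Sum>i<Suc m. (\<Sum>j<Suc m. Q i j * x j)\<^sup>2) = (\<Sum>i<Suc m. (x i)\<^sup>2)"
    "\<And>i. i < m \<Longrightarrow> (\<Sum>j<Suc m. Q i j * v j) = 0"
    "(\<Sum>j<Suc m. Q m j * v j) = vnorm (Suc m) v"
proof -
  define r where "r = vnorm (Suc m) v"
  define u where "u = (\<lambda>i. v i - (if i = m then r else 0))"
  define s where "s = (\<Sum>i<Suc m. (u i)\<^sup>2)"
  \<comment> \<open>If \<open>v\<close> already equals |v| e_m, then \<open>s\<close> is 0 and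
    division by zero gives c = 0, so that \<open>Q\<close> is the identity; the relation
    \<open>cs\<close> holds in this case too.\<close>
  define c where "c = 2 / s"
  define Q where "Q = (\<lambda>i j. (if i = j then 1 else 0) - c * u i * u j)"
  have cs: "c * c * s = 2 * c" by (simp add: c_def)
  have Qx: "(\<Sum>j<Suc m. Q i j * x j) = x i - c * u i * (\<Sum>j<Suc m. u j * x j)" if "i < Suc m" for i x
  proof -
    have "(\<Sum>j<Suc m. Q i j * x j) = (\<Sum>j<Suc m. (if j = i then x j else 0) - c * u i * (u j * x j))"
      by (intro sum.cong) (auto simp: Q_def left_diff_distrib)
    with that show ?thesis
      by (simp add: sum_subtractf sum_distrib_left del: sum.lessThan_Suc)
  qed
  have r2: "r\<^sup>2 = (\<Sum>i<Suc m. (v i)\<^sup>2)" by (simp add: r_def vnorm_power2)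
  have iso: "(\<Sum>i<Suc m. (\<Sum>j<Suc m. Q i j * x j)\<^sup>2) = (\<Sum>i<Suc m. (x i)\<^sup>2)" for x
  proof -
    define a where "a = (\<Sum>j<Suc m. u j * x j)"
    have "(\<Sum>i<Suc m. (\<Sum>j<Suc m. Q i j * x j)\<^sup>2) = (\<Sum>i<Suc m. (x i - c * u i * a)\<^sup>2)"
      using Qx by (intro sum.cong) (auto simp: a_def simp del: sum.lessThan_Suc)
    also have "\<dots> = (\<Sum>i<Suc m. (x i)\<^sup>2 - 2 * c * a * (u i * x i) + c * c * a\<^sup>2 * (u i)\<^sup>2)"
      by (intro sum.cong) (auto simp: power2_eq_square algebra_simps)
    also have "\<dots> = (\<Sum>i<Suc m. (x i)\<^sup>2) - 2 * c * a * a + (c * c * s) * a\<^sup>2"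
      by (simp only: sum.distrib sum_subtractf sum_distrib_left[symmetric] a_def[symmetric] s_def[symmetric])
        (simp add: mult_ac)
    finally show ?thesis by (simp add: cs power2_eq_square)
  qed
  have "(\<Sum>k<Suc m. Q i k * Q k j) = (if i = j then 1 else 0)" if "i < Suc m" "j < Suc m" for i j
  proof -
    have "(\<Sum>k<Suc m. u k * Q k j) = u j - c * s * u j"
    proof -
      have "(\<Sum>k<Suc m. u k * Q k j) = (\<Sum>k<Suc m. (if k = j then u k else 0) - c * u j * (u k)\<^sup>2)"
        by (intro sum.cong) (auto simp: Q_def power2_eq_square algebra_simps)
      with that show ?thesis
        by (simp add: sum_subtractf sum_distrib_left[symmetric] s_def[symmetric] del: sum.lessThan_Suc)
    qed
    with that have "(\<Sum>k<Suc m. Q i k * Q k j) = Q i j - c * u i * (u j - c * s * u j)"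
      by (simp only: Qx)
    also have "\<dots> = (if i = j then 1 else 0) - 2 * c * u i * u j + (c * c * s) * u i * u j"
      by (simp add: Q_def algebra_simps)
    finally show ?thesis by (simp add: cs)
  qed
  then have "fdet (Suc m) (\<lambda>i j. \<Sum>k<Suc m. Q i k * Q k j) = fdet (Suc m) (\<lambda>i j. if i = j then 1 else 0)"
    by (rule fdet_cong)
  then have "fdet (Suc m) Q * fdet (Suc m) Q = 1"
    by (simp only: fdet_mult fdet_id)
  then have det: "\<bar>fdet (Suc m) Q\<bar> = 1"
    by (metis abs_mult_self_eq abs_1 abs_mult power2_eq_1_iff power2_eq_square abs_minus_cancel)
  have uv: "(\<Sum>j<Suc m. u j * v j) = r\<^sup>2 - r * v m"
  proof -
    have "(\<Sum>j<m. v j * v j) = r * r - v m * v m"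
      using r2 by (simp add: power2_eq_square)
    then show ?thesis by (simp add: u_def power2_eq_square algebra_simps)
  qed
  have s: "s = 2 * (r\<^sup>2 - r * v m)"
  proof -
    have "s = (\<Sum>i<m. (v i)\<^sup>2) + (v m - r)\<^sup>2" by (simp add: s_def u_def)
    also have "(\<Sum>i<m. (v i)\<^sup>2) = r\<^sup>2 - (v m)\<^sup>2" by (simp add: r2)
    finally show ?thesis by (simp add: power2_eq_square algebra_simps)
  qed
  have Qv: "(\<Sum>j<Suc m. Q i j * v j) = (if i = m then r else 0)" if "i < Suc m" for i
  proof (cases "s = 0")
    case True
    then have "u i = 0" "c = 0"
      using that unfolding s_def c_def by (simp_all add: sum_nonneg_eq_0_iff del: sum.lessThan_Suc)
    with that show ?thesis
      by (simp add: Qx del: sum.lessThan_Suc) (simp add: u_def split: if_splits)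
  next
    case False
    then have "c * (r\<^sup>2 - r * v m) = 1" unfolding c_def s by (simp add: field_simps)
    then have "(\<Sum>j<Suc m. Q i j * v j) = v i - u i"
      using Qx[OF that, of v] unfolding uv by (simp add: mult_ac)
    then show ?thesis by (simp add: u_def)
  qed
  show thesis
    by (rule that[OF det iso]) (use Qv in \<open>auto simp: r_def[symmetric] simp del: sum.lessThan_Suc\<close>)
qed

section \<open>The law of a Gaussian determinant\<close>

lemma measurable_fdet [measurable]:
  "fdet n \<in> borel_measurable (\<Pi>\<^sub>M i\<in>{..<n}. \<Pi>\<^sub>M k\<in>{..<n}. borel)"
proof -
  have "fdet n = (\<lambda>g. \<Sum>p\<in>{p. p permutes {0..<n}}. signof p * (\<Prod>i = 0..<n. g i (p i)))"
    by (auto simp: fun_eq_iff Determinant.det_def intro!: sum.cong prod.cong)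
  moreover have "(\<lambda>g. \<Sum>p\<in>{p. p permutes {0..<n}}. signof p * (\<Prod>i = 0..<n. g i (p i)) :: real)
     \<in> borel_measurable (\<Pi>\<^sub>M i\<in>{..<n}. \<Pi>\<^sub>M k\<in>{..<n}. borel)"
  proof (intro borel_measurable_sum borel_measurable_times borel_measurable_const borel_measurable_prod)
    fix p i assume "p \<in> {p. p permutes {0..<n}}" "i \<in> {0..<n}"
    then have "i < n" "p i < n" using permutes_in_image[of p "{0..<n}" i] by auto
    then show "(\<lambda>g. g i (p i)) \<in> borel_measurable (\<Pi>\<^sub>M i\<in>{..<n}. \<Pi>\<^sub>M k\<in>{..<n}. borel)"
      by (intro measurable_compose[OF measurable_component_singleton[of i] measurable_component_singleton[of "p i"]]) auto
  qed
  ultimately show ?thesis by simp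
qed

lemma sets_Gaussian_rows [measurable_cong]:
  "sets (Gaussian_rows m n) = sets (\<Pi>\<^sub>M i\<in>{..<m}. \<Pi>\<^sub>M k\<in>{..<n}. borel)"
  by (intro sets_PiM_cong) auto

lemma distr_restrict_linear_std_Gaussian:
  assumes "\<bar>fdet (Suc m) Q\<bar> = 1"
    and "\<And>x. (\<Sum>i<Suc m. (\<Sum>j<Suc m. Q i j * x j)\<^sup>2) = (\<Sum>i<Suc m. (x i)\<^sup>2)"
  shows "distr (std_Gaussian (Suc m)) (std_Gaussian m)
      (\<lambda>x. restrict (affine_map (Suc m) Q (\<lambda>_. 0) x) {..<m}) = std_Gaussian m"
proof -
  interpret product_prob_space "\<lambda>_::nat. std_normal_distribution" "{..<Suc m}"
    by (intro product_prob_spaceI prob_space_std_normal)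
  have T: "affine_map (Suc m) Q (\<lambda>_. 0) \<in> std_Gaussian (Suc m) \<rightarrow>\<^sub>M std_Gaussian (Suc m)"
    using measurable_affine_map by (simp cong: measurable_cong_sets add: sets_std_Gaussian)
  have R: "(\<lambda>x. restrict x {..<m}) \<in> std_Gaussian (Suc m) \<rightarrow>\<^sub>M std_Gaussian m"
    by (intro measurable_restrict_subset) auto
  have "distr (std_Gaussian (Suc m)) (std_Gaussian m)
      (\<lambda>x. restrict (affine_map (Suc m) Q (\<lambda>_. 0) x) {..<m}) =
    distr (distr (std_Gaussian (Suc m)) (std_Gaussian (Suc m)) (affine_map (Suc m) Q (\<lambda>_. 0)))
      (std_Gaussian m) (\<lambda>x. restrict x {..<m})"
    by (subst distr_distr[OF R T]) (simp add: comp_def)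
  also have "\<dots> = std_Gaussian m"
    unfolding std_Gaussian_linear_invariant[OF assms]
    by (intro distr_PiM_restrict_finite) auto
  finally show ?thesis .
qed

text \<open>Multiplication on the right by the transpose of \<open>Q\<close> applies the reflection
  to every row. The fixed last row becomes |v| e_m, so the determinant is |v| times that of the
  remaining rows cut to \<open>m\<close> coordinates, up to sign; these rows are again independent
  standard Gaussian vectors.\<close>

lemma bordered_det_law:
  "distr (Gaussian_rows m (Suc m)) borel (\<lambda>g. \<bar>fdet (Suc m) (g(m := v))\<bar>) =
   distr (Gaussian_rows m m) borel (\<lambda>g. vnorm (Suc m) v * \<bar>fdet m g\<bar>)"
proof -
  obtain Q where Q: "\<bar>fdet (Suc m) Q\<bar> = 1"
    "\<And>x. (\<Sum>i<Suc m. (\<Sum>j<Suc m. Q i j * x j)\<^sup>2) = (\<Sum>i<Suc m. (x i)\<^sup>2)"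
    "\<And>i. i < m \<Longrightarrow> (\<Sum>j<Suc m. Q i j * v j) = 0"
    "(\<Sum>j<Suc m. Q m j * v j) = vnorm (Suc m) v"
    using Householder[of m v] by blast
  define T where "T = (\<lambda>x. restrict (affine_map (Suc m) Q (\<lambda>_. 0) x) {..<m})"
  have T: "T \<in> std_Gaussian (Suc m) \<rightarrow>\<^sub>M std_Gaussian m"
  proof -
    have 1: "affine_map (Suc m) Q (\<lambda>_. 0) \<in> std_Gaussian (Suc m) \<rightarrow>\<^sub>M std_Gaussian (Suc m)"
      using measurable_affine_map by (simp cong: measurable_cong_sets add: sets_std_Gaussian)
    have 2: "(\<lambda>x. restrict x {..<m}) \<in> std_Gaussian (Suc m) \<rightarrow>\<^sub>M std_Gaussian m"
      by (intro measurable_restrict_subset) auto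
    show ?thesis unfolding T_def by (rule measurable_compose[OF 1 2])
  qed
  have law: "distr (Gaussian_rows m (Suc m)) (Gaussian_rows m m) (compose {..<m} T) = Gaussian_rows m m"
    using distr_PiM_finite_prob_space'[of "{..<m}" "\<lambda>_. std_Gaussian (Suc m)" "\<lambda>_. std_Gaussian m" T] T
      distr_restrict_linear_std_Gaussian[OF Q(1,2)]
    by (simp add: prob_space_std_Gaussian T_def[symmetric])
  have cT: "compose {..<m} T \<in> Gaussian_rows m (Suc m) \<rightarrow>\<^sub>M Gaussian_rows m m"
    unfolding compose_def using T by measurable
  have det: "\<bar>fdet (Suc m) (g(m := v))\<bar> = vnorm (Suc m) v * \<bar>fdet m (compose {..<m} T g)\<bar>" for g
  proof -
    let ?B = "\<lambda>i l. \<Sum>j<Suc m. (g(m := v)) i j * Q l j"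
    have "\<bar>fdet (Suc m) ?B\<bar> = \<bar>fdet (Suc m) (g(m := v))\<bar> * \<bar>fdet (Suc m) Q\<bar>"
      using fdet_mult[of "Suc m" "g(m := v)" "\<lambda>j l. Q l j"] by (simp only: fdet_transpose[of "Suc m" Q] abs_mult)
    moreover have "\<bar>fdet (Suc m) ?B\<bar> = vnorm (Suc m) v * \<bar>fdet m ?B\<bar>"
    proof -
      have "?B m j = (\<Sum>k<Suc m. Q j k * v k)" for j
        by (intro sum.cong) auto
      then have "?B m j = 0" if "j < m" for j
        using Q(3)[OF that] by (simp only:)
      moreover have "?B m m = vnorm (Suc m) v"
        using Q(4) \<open>\<And>j. ?B m j = _\<close> by (simp only:)
      ultimately show ?thesis
        using fdet_last_row[of m ?B] by (simp only: abs_mult abs_of_nonneg vnorm_nonneg)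
    qed
    moreover have "fdet m ?B = fdet m (compose {..<m} T g)"
    proof (rule fdet_cong)
      fix i l assume il: "i < m" "l < m"
      then have "compose {..<m} T g i l = (\<Sum>j<Suc m. Q l j * g i j)"
        by (simp add: compose_def T_def affine_map_def del: sum.lessThan_Suc)
      also have "\<dots> = ?B i l"
        using il by (intro sum.cong) auto
      finally show "?B i l = compose {..<m} T g i l" by (rule sym)
    qed
    ultimately show ?thesis
      using Q(1) by (simp only: mult_1_right)
  qed
  have [measurable]: "fdet m \<in> borel_measurable (Gaussian_rows m m)"
    using measurable_fdet by (simp cong: measurable_cong_sets add: sets_Gaussian_rows)
  have "distr (Gaussian_rows m (Suc m)) borel (\<lambda>g. \<bar>fdet (Suc m) (g(m := v))\<bar>) =
     distr (distr (Gaussian_rows m (Suc m)) (Gaussian_rows m m) (compose {..<m} T)) borel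
       (\<lambda>g. vnorm (Suc m) v * \<bar>fdet m g\<bar>)"
    by (subst distr_distr[OF _ cT]) (simp_all add: det comp_def)
  then show ?thesis by (simp only: law)
qed

lemma measurable_vnorm [measurable]: "vnorm n \<in> borel_measurable (\<Pi>\<^sub>M k\<in>{..<n}. borel)"
  unfolding vnorm_def by measurable

text \<open>Conditioning on the first component: an identity of laws that holds for each fixed
  \<open>x\<close> can be integrated over a random \<open>x\<close>.\<close>

lemma emeasure_distr_pair:
  assumes "sigma_finite_measure N" and f: "(\<lambda>(x, y). f x y) \<in> M \<Otimes>\<^sub>M N \<rightarrow>\<^sub>M L" and S: "S \<in> sets L"
  shows "emeasure (distr (M \<Otimes>\<^sub>M N) L (\<lambda>(x, y). f x y)) S = (\<integral>\<^sup>+x. emeasure (distr N L (f x)) S \<partial>M)"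
proof -
  interpret sigma_finite_measure N by fact
  let ?P = "(\<lambda>(x, y). f x y) -` S \<inter> space (M \<Otimes>\<^sub>M N)"
  have "emeasure (distr (M \<Otimes>\<^sub>M N) L (\<lambda>(x, y). f x y)) S = emeasure (M \<Otimes>\<^sub>M N) ?P"
    by (rule emeasure_distr[OF f S])
  also have "\<dots> = (\<integral>\<^sup>+x. emeasure N (Pair x -` ?P) \<partial>M)"
    by (rule emeasure_pair_measure_alt[OF measurable_sets[OF f S]])
  also have "\<dots> = (\<integral>\<^sup>+x. emeasure (distr N L (f x)) S \<partial>M)"
  proof (intro nn_integral_cong)
    fix x assume x: "x \<in> space M"
    have "f x \<in> N \<rightarrow>\<^sub>M L"
      using measurable_compose[OF measurable_Pair1'[OF x] f] by simp
    then show "emeasure N (Pair x -` ?P) = emeasure (distr N L (f x)) S"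
      using x S by (subst emeasure_distr) (auto simp: space_pair_measure intro!: arg_cong2[where f = emeasure])
  qed
  finally show ?thesis .
qed

text \<open>Condition on the last row: given its value \<open>v\<close>, the other rows still form
  an independent Gaussian family, and the conditional law of the absolute determinant depends on |v|
  only.\<close>

lemma det_law_Suc:
  "distr (Gaussian_rows (Suc m) (Suc m)) borel (\<lambda>g. \<bar>fdet (Suc m) g\<bar>) =
   distr (std_Gaussian (Suc m) \<Otimes>\<^sub>M Gaussian_rows m m) borel (\<lambda>(v, g). vnorm (Suc m) v * \<bar>fdet m g\<bar>)"
proof (rule measure_eqI)
  interpret R: prob_space "Gaussian_rows m m" by (rule prob_space_Gaussian_rows)
  interpret R': prob_space "Gaussian_rows m (Suc m)" by (rule prob_space_Gaussian_rows)
  have fm [measurable]: "fdet m \<in> borel_measurable (Gaussian_rows m m)" for m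
    using measurable_fdet by (simp cong: measurable_cong_sets add: sets_Gaussian_rows)
  have [measurable]: "vnorm (Suc m) \<in> borel_measurable (std_Gaussian (Suc m))"
    using measurable_vnorm by (simp cong: measurable_cong_sets)
  have ins: "distr (std_Gaussian (Suc m) \<Otimes>\<^sub>M Gaussian_rows m (Suc m)) (Gaussian_rows (Suc m) (Suc m))
      (\<lambda>(v, g). g(m := v)) = Gaussian_rows (Suc m) (Suc m)"
    unfolding lessThan_Suc
    using distr_pair_PiM_eq_PiM[of "{..<m}" "\<lambda>_. std_Gaussian (Suc m)" m] prob_space_std_Gaussian
    by (simp add: lessThan_Suc[symmetric])
  have upd [measurable]: "(\<lambda>(v, g). g(m := v)) \<in> std_Gaussian (Suc m) \<Otimes>\<^sub>M Gaussian_rows m (Suc m)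
      \<rightarrow>\<^sub>M Gaussian_rows (Suc m) (Suc m)"
    using measurable_compose[OF measurable_pair_swap' measurable_add_dim[of m "{..<m}" "\<lambda>_. std_Gaussian (Suc m)"]]
    by (simp add: lessThan_Suc[symmetric] case_prod_beta')
  fix S assume "S \<in> sets (distr (Gaussian_rows (Suc m) (Suc m)) borel (\<lambda>g. \<bar>fdet (Suc m) g\<bar>))"
  then have S [measurable]: "S \<in> sets borel" by simp
  have m1: "(\<lambda>(v, g). \<bar>fdet (Suc m) (g(m := v))\<bar>) \<in> borel_measurable (std_Gaussian (Suc m) \<Otimes>\<^sub>M Gaussian_rows m (Suc m))"
  proof -
    have "(\<lambda>(v, g). \<bar>fdet (Suc m) (g(m := v))\<bar>) = (\<lambda>p. \<bar>fdet (Suc m) (case p of (v, g) \<Rightarrow> g(m := v))\<bar>)"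
      by (rule ext) (simp only: split_beta)
    then show ?thesis using measurable_compose[OF upd fm[of "Suc m"]] by (simp only: borel_measurable_abs)
  qed
  have "emeasure (distr (Gaussian_rows (Suc m) (Suc m)) borel (\<lambda>g. \<bar>fdet (Suc m) g\<bar>)) S =
      emeasure (distr (std_Gaussian (Suc m) \<Otimes>\<^sub>M Gaussian_rows m (Suc m)) borel
        (\<lambda>(v, g). \<bar>fdet (Suc m) (g(m := v))\<bar>)) S"
  proof -
    have e: "(\<lambda>(v, g). \<bar>fdet (Suc m) (g(m := v))\<bar>) = (\<lambda>g. \<bar>fdet (Suc m) g\<bar>) \<circ> (\<lambda>(v, g). g(m := v))"
      by (rule ext) (simp only: split_beta comp_def)
    have f: "(\<lambda>g. \<bar>fdet (Suc m) g\<bar>) \<in> borel_measurable (Gaussian_rows (Suc m) (Suc m))"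
      by (rule borel_measurable_abs[OF fm])
    show ?thesis
      unfolding e by (subst distr_distr[OF f upd, symmetric]) (simp only: ins)
  qed
  also have "\<dots> = (\<integral>\<^sup>+v. emeasure (distr (Gaussian_rows m (Suc m)) borel (\<lambda>g. \<bar>fdet (Suc m) (g(m := v))\<bar>)) S
      \<partial>std_Gaussian (Suc m))"
    by (rule emeasure_distr_pair[OF R'.sigma_finite_measure_axioms m1 S])
  also have "\<dots> = (\<integral>\<^sup>+v. emeasure (distr (Gaussian_rows m m) borel (\<lambda>g. vnorm (Suc m) v * \<bar>fdet m g\<bar>)) S
      \<partial>std_Gaussian (Suc m))"
    by (simp only: bordered_det_law)
  also have "\<dots> = emeasure (distr (std_Gaussian (Suc m) \<Otimes>\<^sub>M Gaussian_rows m m) borel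
      (\<lambda>(v, g). vnorm (Suc m) v * \<bar>fdet m g\<bar>)) S"
    by (rule emeasure_distr_pair[symmetric, OF R.sigma_finite_measure_axioms _ S]) measurable
  finally show "emeasure (distr (Gaussian_rows (Suc m) (Suc m)) borel (\<lambda>g. \<bar>fdet (Suc m) g\<bar>)) S =
      emeasure (distr (std_Gaussian (Suc m) \<Otimes>\<^sub>M Gaussian_rows m m) borel
      (\<lambda>(v, g). vnorm (Suc m) v * \<bar>fdet m g\<bar>)) S" .
qed simp

section \<open>Radial integration and moments\<close>

lemma emeasure_density_powr_atMost:
  assumes "C \<ge> 0" "a > (0::real)"
  shows "emeasure (density lborel (\<lambda>u. ennreal (indicator {0<..} u * (C * u powr (a - 1))))) {..c}
    = (if c \<le> 0 then 0 else ennreal (C * c powr a / a))"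
proof -
  have "emeasure (density lborel (\<lambda>u. ennreal (indicator {0<..} u * (C * u powr (a - 1))))) {..c} =
      (\<integral>\<^sup>+u. ennreal (indicator {0<..} u * (C * u powr (a - 1))) * indicator {..c} u \<partial>lborel)"
    by (subst emeasure_density) auto
  also have "\<dots> = (if c \<le> 0 then 0 else ennreal (C * c powr a / a))"
  proof (cases "c \<le> 0")
    case True
    then have "(\<lambda>u. ennreal (indicator {0<..} u * (C * u powr (a - 1))) * indicator {..c} u) = (\<lambda>u. 0)"
      by (auto simp: fun_eq_iff indicator_def)
    then show ?thesis using True by simp
  next
    case False
    have "((\<lambda>u. C * u powr (a - 1)) has_integral C * (c powr (a - 1 + 1) / (a - 1 + 1))) {0..c}"
      using assms False by (intro has_integral_mult_right has_integral_powr_from_0) auto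
    then have "(\<integral>\<^sup>+u. ennreal (indicator {0..c} u * (C * u powr (a - 1))) \<partial>lborel) = ennreal (C * (c powr (a - 1 + 1) / (a - 1 + 1)))"
      using assms by (intro nn_integral_has_integral_lebesgue) auto
    moreover have "(\<integral>\<^sup>+u. ennreal (indicator {0<..} u * (C * u powr (a - 1))) * indicator {..c} u \<partial>lborel) =
      (\<integral>\<^sup>+u. ennreal (indicator {0..c} u * (C * u powr (a - 1))) \<partial>lborel)"
      by (intro nn_integral_cong) (auto simp: indicator_def)
    ultimately show ?thesis using False by simp
  qed
  finally show ?thesis .
qed

text \<open>The sublevel set at c > 0 is a ball of radius sqrt (2 c), whose volume is a multiple of
  c^(d/2), and for c \<le> 0 it is null; the two measures agree on half-lines and therefore
  coincide. The constant stays anonymous because it is recovered later from the total mass of the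
  Gaussian law.\<close>

lemma distr_half_square_Leb:
  assumes "d \<ge> 1"
  obtains C where "C \<ge> 0" "distr (Leb d) borel (\<lambda>x. (\<Sum>i<d. (x i)\<^sup>2) / 2) =
    density lborel (\<lambda>u. ennreal (indicator {0<..} u * (C * u powr (real d / 2 - 1))))"
proof -
  define C where "C = unit_ball_vol d * 2 powr (real d / 2) * (real d / 2)"
  have C: "C \<ge> 0" by (simp add: C_def)
  let ?q = "\<lambda>x. (\<Sum>i<d. (x i)\<^sup>2) / 2"
  let ?D = "density lborel (\<lambda>u. ennreal (indicator {0<..} u * (C * u powr (real d / 2 - 1))))"
  have q [measurable]: "?q \<in> borel_measurable (Leb d)" by measurable
  have D: "emeasure ?D {..c} = (if c \<le> 0 then 0 else ennreal (unit_ball_vol d * (2 * c) powr (real d / 2)))" for c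
    using emeasure_density_powr_atMost[OF C, of "real d / 2" c] assms
    by (simp add: C_def powr_mult)
  have L: "emeasure (distr (Leb d) borel ?q) {..c} = emeasure ?D {..c}" for c
  proof -
    have "emeasure (distr (Leb d) borel ?q) {..c} = emeasure (Leb d) {x \<in> space (Leb d). ?q x \<le> c}"
      by (subst emeasure_distr[OF q]) (auto intro!: arg_cong2[where f = emeasure])
    also have "\<dots> = emeasure ?D {..c}"
    proof (cases "c \<le> 0")
      case True
      have "{x \<in> space (Leb d). ?q x \<le> c} \<subseteq>
          {x \<in> space (Leb d). (\<Sum>k<d. (if k = 0 then 1 else 0) * x k) = 0}"
      proof safe
        fix x assume "?q x \<le> c"
        then have "(\<Sum>i<d. (x i)\<^sup>2) = 0"
          using True sum_nonneg[of "{..<d}" "\<lambda>i. (x i)\<^sup>2"] by auto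
        then have "x 0 = 0"
          using assms by (simp add: sum_nonneg_eq_0_iff)
        then have "(if k = 0 then 1 else 0) * x k = 0" for k by simp
        then show "(\<Sum>k<d. (if k = 0 then 1 else 0) * x k) = 0" by (simp only: sum.neutral_const)
      qed
      then have "emeasure (Leb d) {x \<in> space (Leb d). ?q x \<le> c} \<le>
          emeasure (Leb d) {x \<in> space (Leb d). (\<Sum>k<d. (if k = 0 then 1 else 0) * x k) = 0}"
        by (intro emeasure_mono) measurable
      also have "\<dots> = 0"
        using assms by (intro emeasure_hyperplane_eq_0[of 0]) auto
      finally show ?thesis using True by (simp add: D)
    next
      case False
      have "{x \<in> space (Leb d). ?q x \<le> c} =
          {f. sqrt (\<Sum>i<d. (f i)\<^sup>2) \<le> sqrt (2 * c)} \<inter> space (Leb d)"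
        by (auto simp: field_simps)
      then have "emeasure (Leb d) {x \<in> space (Leb d). ?q x \<le> c} = ennreal (unit_ball_vol d * sqrt (2 * c) ^ d)"
        using emeasure_cball_aux[of "{..<d}" "sqrt (2 * c)"] False by simp
      also have "sqrt (2 * c) ^ d = (2 * c) powr (real d / 2)"
        using False by (simp add: powr_half_sqrt[symmetric] powr_realpow[symmetric] powr_powr)
      finally show ?thesis using False by (simp add: D)
    qed
    finally show ?thesis .
  qed
  have "distr (Leb d) borel ?q = ?D"
  proof (rule measure_eqI_generator_eq[where \<Omega> = UNIV and E = "range atMost" and A = "\<lambda>n. {..real n}"])
    show "Int_stable (range atMost :: real set set)"
      by (auto simp: Int_stable_def)
    show "\<And>X. X \<in> range atMost \<Longrightarrow> emeasure (distr (Leb d) borel ?q) X = emeasure ?D X"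
      using L by auto
    show "sets (distr (Leb d) borel ?q) = sigma_sets UNIV (range atMost)"
      by (subst sets_distr, subst borel_eq_atMost) simp
    show "sets ?D = sigma_sets UNIV (range atMost)"
      by (subst sets_density, subst sets_lborel, subst borel_eq_atMost) simp
    show "(\<Union>n. {..real n}) = UNIV"
      by (auto intro: real_arch_simple)
    show "emeasure (distr (Leb d) borel ?q) {..real i} \<noteq> \<infinity>" for i
      by (simp add: L D)
  qed auto
  with C show thesis by (rule that)
qed

text \<open>Unlike \<^const>\<open>powr\<close> on the complex numbers, this is evidently measurable in \<open>x\<close>; the value
  \<open>0\<close> at \<open>x = 0\<close> makes it multiplicative on all nonnegative reals.\<close>

definition rpow :: "complex \<Rightarrow> real \<Rightarrow> complex" where
  "rpow t x = (if x = 0 then 0 else exp (t * of_real (ln x)))"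

lemma measurable_rpow [measurable]: "rpow t \<in> borel_measurable borel"
  unfolding rpow_def by measurable

lemma rpow_mult:
  assumes "x \<ge> 0" "y \<ge> 0"
  shows "rpow t (x * y) = rpow t x * rpow t y"
  using assms by (auto simp: rpow_def ln_mult exp_add[symmetric] algebra_simps)

lemma rpow_eq_powr: "x > 0 \<Longrightarrow> rpow t x = of_real x powr t"
  by (simp add: rpow_def powr_def Ln_of_real)

text \<open>The \<open>t\<close>-th absolute moment of a standard Gaussian vector in dimension
  \<open>d\<close>, that is of a \<chi> variable with \<open>d\<close> degrees of freedom. The
  closed form also makes sense where the moment diverges, and there serves as its
  continuation.\<close>

definition chi_moment :: "nat \<Rightarrow> complex \<Rightarrow> complex" where
  "chi_moment d t = rpow (t / 2) 2 * Gamma ((of_nat d + t) / 2) / Gamma (of_nat d / 2)"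

text \<open>Euler's integral moved from completed Lebesgue measure to \<open>lborel\<close>. Borel
  measurability of the integrand comes from replacing \<open>powr\<close> by \<open>rpow\<close>,
  which agrees with it on the positive half-line.\<close>

lemma Gamma_lborel_integral:
  assumes "Re z > 0"
  shows "integrable lborel (\<lambda>u. indicator {0<..} u *\<^sub>R (complex_of_real u powr (z - 1) / of_real (exp u)))" (is ?A)
    and "(LBINT u. indicator {0<..} u *\<^sub>R (complex_of_real u powr (z - 1) / of_real (exp u))) = Gamma z" (is ?B)
proof -
  let ?f = "\<lambda>u. indicator {0<..} u *\<^sub>R (complex_of_real u powr (z - 1) / of_real (exp u))"
  have eq: "?f = (\<lambda>u. indicator {0<..} u *\<^sub>R (rpow (z - 1) u / of_real (exp u)))"
    by (auto simp: fun_eq_iff indicator_def rpow_eq_powr)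
  have m: "?f \<in> borel_measurable lborel" unfolding eq by measurable
  have "set_integrable lebesgue {0<..} (\<lambda>u. complex_of_real u powr (z - 1) / of_real (exp u))"
    by (rule absolutely_integrable_Gamma_integral'[OF assms])
  then show ?A
    using integrable_completion[OF m] by (simp add: set_integrable_def)
  have "((\<lambda>u. complex_of_real u powr (z - 1) / of_real (exp u)) has_integral
      (LINT u:{0<..}|lebesgue. complex_of_real u powr (z - 1) / of_real (exp u))) {0<..}"
    by (rule has_integral_set_lebesgue[OF absolutely_integrable_Gamma_integral'[OF assms]])
  then have "(LINT u:{0<..}|lebesgue. complex_of_real u powr (z - 1) / of_real (exp u)) = Gamma z"
    using Gamma_integral_complex'[OF assms] by (rule has_integral_unique)
  then show ?B
    using integral_completion[OF m] by (simp add: set_lebesgue_integral_def)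
qed

text \<open>In the variable u = |x|^2 / 2 the Gaussian weight is a multiple of exp (- u) and
  Lebesgue measure becomes a multiple of u^(d/2 - 1) du, so the moment is Euler's integral for
  Gamma((d + t) / 2).\<close>

lemma chi_moment_integral:
  assumes "d \<ge> 1" "Re t > - 1"
  shows "integrable (std_Gaussian d) (\<lambda>v. rpow t (vnorm d v))" (is ?A)
    and "(LINT v|std_Gaussian d. rpow t (vnorm d v)) = chi_moment d t" (is ?B)
proof -
  let ?q = "\<lambda>x. (\<Sum>i<d. (x i)\<^sup>2) / 2"
  obtain C where C: "C \<ge> 0" "distr (Leb d) borel ?q =
    density lborel (\<lambda>u. ennreal (indicator {0<..} u * (C * u powr (real d / 2 - 1))))"
    using distr_half_square_Leb[OF assms(1)] by blast
  define K where "K = (1 / sqrt (2 * pi)) ^ d"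
  have K: "K \<ge> 0" by (simp add: K_def)
  define \<kappa> where "\<kappa> = K * C"
  let ?w = "\<lambda>u. indicator {0<..} u * (C * u powr (real d / 2 - 1))"
  have q [measurable]: "?q \<in> borel_measurable (Leb d)" by measurable
  have G: "std_Gaussian d = density (Leb d) (\<lambda>x. ennreal (K * exp (- ?q x)))"
    by (simp add: std_Gaussian_eq_density K_def sum_negf)
  have int: "integrable (std_Gaussian d) (\<lambda>x. h (?q x)) \<longleftrightarrow>
      integrable lborel (\<lambda>u. ?w u *\<^sub>R (K * exp (- u)) *\<^sub>R h u)"
    and intg: "(LINT x|std_Gaussian d. h (?q x)) = (LBINT u. ?w u *\<^sub>R (K * exp (- u)) *\<^sub>R h u)"
    if [measurable]: "h \<in> borel_measurable borel" for h :: "real \<Rightarrow> complex"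
  proof -
    have m: "(\<lambda>u. (K * exp (- u)) *\<^sub>R h u) \<in> borel_measurable borel" by measurable
    have hq: "(\<lambda>x. h (?q x)) \<in> borel_measurable (Leb d)" by measurable
    have w: "?w \<in> borel_measurable lborel" by measurable
    have "integrable (std_Gaussian d) (\<lambda>x. h (?q x)) \<longleftrightarrow> integrable (Leb d) (\<lambda>x. (K * exp (- ?q x)) *\<^sub>R h (?q x))"
      unfolding G using hq K by (subst integrable_density) (auto intro!: measurable_compose[OF q])
    also have "\<dots> \<longleftrightarrow> integrable (distr (Leb d) borel ?q) (\<lambda>u. (K * exp (- u)) *\<^sub>R h u)"
      by (subst integrable_distr_eq[OF q m]) simp
    also have "\<dots> \<longleftrightarrow> integrable lborel (\<lambda>u. ?w u *\<^sub>R (K * exp (- u)) *\<^sub>R h u)"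
      unfolding C(2) using m w C(1) by (subst integrable_density) (auto simp: indicator_def)
    finally show "integrable (std_Gaussian d) (\<lambda>x. h (?q x)) \<longleftrightarrow>
      integrable lborel (\<lambda>u. ?w u *\<^sub>R (K * exp (- u)) *\<^sub>R h u)" .
    have "(LINT x|std_Gaussian d. h (?q x)) = (LINT x|Leb d. (K * exp (- ?q x)) *\<^sub>R h (?q x))"
      unfolding G using hq K by (subst integral_density) (auto intro!: measurable_compose[OF q])
    also have "\<dots> = (LINT u|distr (Leb d) borel ?q. (K * exp (- u)) *\<^sub>R h u)"
      by (subst integral_distr[OF q m]) simp
    also have "\<dots> = (LBINT u. ?w u *\<^sub>R (K * exp (- u)) *\<^sub>R h u)"
      unfolding C(2) using m w C(1) by (subst integral_density) (auto simp: indicator_def)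
    finally show "(LINT x|std_Gaussian d. h (?q x)) = (LBINT u. ?w u *\<^sub>R (K * exp (- u)) *\<^sub>R h u)" .
  qed
  have gam: "?w u *\<^sub>R (K * exp (- u)) *\<^sub>R rpow (s / 2) u =
      of_real \<kappa> * (indicator {0<..} u *\<^sub>R (complex_of_real u powr ((of_nat d + s) / 2 - 1) / of_real (exp u)))" for s u
  proof (cases "u > 0")
    case True
    have "complex_of_real u powr (of_nat d / 2 - 1) * of_real u powr (s / 2) = of_real u powr ((of_nat d + s) / 2 - 1)"
      by (simp add: powr_add[symmetric] add_divide_distrib algebra_simps)
    then have "of_real (u powr (real d / 2 - 1)) * rpow (s / 2) u = complex_of_real u powr ((of_nat d + s) / 2 - 1)"
      using True powr_of_real[of u "real d / 2 - 1"] by (simp add: rpow_eq_powr)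
    then show ?thesis
      using True by (simp add: \<kappa>_def scaleR_conv_of_real exp_minus field_simps)
  qed (simp add: indicator_def)
  have main: "integrable (std_Gaussian d) (\<lambda>x. rpow (s / 2) (?q x))"
    "(LINT x|std_Gaussian d. rpow (s / 2) (?q x)) = of_real \<kappa> * Gamma ((of_nat d + s) / 2)" if "Re s > -1" for s
  proof -
    have pos: "Re ((of_nat d + s) / 2) > 0" using that assms(1) by simp
    show "integrable (std_Gaussian d) (\<lambda>x. rpow (s / 2) (?q x))"
      unfolding int[OF measurable_rpow] gam by (intro integrable_mult_right Gamma_lborel_integral(1) pos)
    show "(LINT x|std_Gaussian d. rpow (s / 2) (?q x)) = of_real \<kappa> * Gamma ((of_nat d + s) / 2)"
      unfolding intg[OF measurable_rpow] gam by (simp only: integral_mult_right_zero Gamma_lborel_integral(2)[OF pos])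
  qed
  \<comment> \<open>The normalising constant is found from the moment of order 0, which is the total
    mass 1; \<open>rpow 0\<close> differs from 1 only at 0, where the weight vanishes.\<close>
  have \<kappa>: "of_real \<kappa> * Gamma (of_nat d / 2 :: complex) = 1"
  proof -
    have "(LBINT u. ?w u *\<^sub>R (K * exp (- u)) *\<^sub>R (1 :: complex)) = (LBINT u. ?w u *\<^sub>R (K * exp (- u)) *\<^sub>R rpow (0 / 2) u)"
      by (intro Bochner_Integration.integral_cong) (auto simp: indicator_def rpow_def)
    then have "(LINT x|std_Gaussian d. 1 :: complex) = (LINT x|std_Gaussian d. rpow (0 / 2) (?q x))"
      using intg[of "\<lambda>_. 1"] intg[OF measurable_rpow, of "0 / 2"] by simp
    then show ?thesis
      using main(2)[of 0] prob_space.prob_space[OF prob_space_std_Gaussian[of d]] by simp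
  qed
  have rq: "rpow t (vnorm d v) = rpow (t / 2) 2 * rpow (t / 2) (?q v)" for v
  proof -
    have "rpow t (vnorm d v) = rpow (t / 2) (2 * ?q v)"
      by (auto simp: rpow_def vnorm_def ln_sqrt sum_nonneg)
    also have "\<dots> = rpow (t / 2) 2 * rpow (t / 2) (?q v)"
      by (intro rpow_mult) (auto intro!: divide_nonneg_nonneg sum_nonneg)
    finally show ?thesis .
  qed
  show ?A unfolding rq using main(1)[OF assms(2)] by simp
  have "Gamma (of_nat d / 2 :: complex) \<noteq> 0" using \<kappa> by auto
  then have "of_real \<kappa> = 1 / Gamma (of_nat d / 2 :: complex)" using \<kappa> by (simp add: field_simps)
  then show ?B unfolding rq using main(2)[OF assms(2)] by (simp add: chi_moment_def)
qed

lemma integral_pair_prod: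
  fixes f :: "'a \<Rightarrow> complex" and g :: "'b \<Rightarrow> complex"
  assumes "sigma_finite_measure M" "sigma_finite_measure N" and f: "integrable M f" and g: "integrable N g"
  shows "integrable (M \<Otimes>\<^sub>M N) (\<lambda>(x, y). f x * g y)" (is ?A)
    and "(LINT p|(M \<Otimes>\<^sub>M N). f (fst p) * g (snd p)) = (LINT x|M. f x) * (LINT y|N. g y)" (is ?B)
proof -
  interpret M: sigma_finite_measure M by fact
  interpret N: sigma_finite_measure N by fact
  interpret pair_sigma_finite M N ..
  have [measurable]: "f \<in> borel_measurable M" "g \<in> borel_measurable N" using f g by auto
  show ?A
  proof (rule Fubini_integrable)
    show "integrable M (\<lambda>x. LINT y|N. norm (case (x, y) of (x, y) \<Rightarrow> f x * g y))"
      using f g by (simp add: norm_mult integrable_norm)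
    show "AE x in M. integrable N (\<lambda>y. case (x, y) of (x, y) \<Rightarrow> f x * g y)"
      using g by simp
  qed measurable
  then show ?B
    using integral_fst'[of "\<lambda>(x, y). f x * g y"] f g by (simp add: case_prod_beta')
qed

text \<open>Each step of the recursion contributes an independent \<chi> factor, and Fubini
  multiplies the moments. The bound on Re t is that of the factor with one degree of freedom.
  Integrability is carried through the induction because the product formula for expectations uses
  it.\<close>

lemma det_moment:
  assumes t: "Re t > - 1"
  shows "integrable (Gaussian_rows m m) (\<lambda>g. rpow t \<bar>fdet m g\<bar>) \<and>
    (LINT g|Gaussian_rows m m. rpow t \<bar>fdet m g\<bar>) = (\<Prod>j=1..m. chi_moment j t)"
proof (induction m)
  case 0
  interpret prob_space "Gaussian_rows 0 0" by (rule prob_space_Gaussian_rows)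
  have "rpow t \<bar>fdet 0 g\<bar> = 1" for g by (simp add: rpow_def)
  then show ?case using prob_space integrable_const[of "1 :: complex"] by simp
next
  case (Suc m)
  have fm: "(\<lambda>g. \<bar>fdet m g\<bar>) \<in> borel_measurable (Gaussian_rows m m)" for m
    using borel_measurable_abs[OF measurable_fdet] by (simp cong: measurable_cong_sets add: sets_Gaussian_rows)
  have vn: "vnorm (Suc m) \<in> borel_measurable (std_Gaussian (Suc m))"
    using measurable_vnorm by (simp cong: measurable_cong_sets)
  let ?P = "std_Gaussian (Suc m) \<Otimes>\<^sub>M Gaussian_rows m m"
  let ?f = "\<lambda>(v, g). vnorm (Suc m) v * \<bar>fdet m g\<bar>"
  have m2: "?f \<in> borel_measurable ?P"
  proof -
    have "(\<lambda>p. vnorm (Suc m) (fst p) * \<bar>fdet m (snd p)\<bar>) \<in> borel_measurable ?P"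
      by (intro borel_measurable_times measurable_compose[OF measurable_fst vn] measurable_compose[OF measurable_snd fm])
    moreover have "?f = (\<lambda>p. vnorm (Suc m) (fst p) * \<bar>fdet m (snd p)\<bar>)"
      by (rule ext) (simp only: split_beta)
    ultimately show ?thesis by (simp only:)
  qed
  have rf: "(\<lambda>p. rpow t (?f p)) = (\<lambda>(v, g). rpow t (vnorm (Suc m) v) * rpow t \<bar>fdet m g\<bar>)"
    by (rule ext) (simp only: split_beta rpow_mult vnorm_nonneg abs_ge_zero)
  note sf = prob_space_imp_sigma_finite[OF prob_space_std_Gaussian[of "Suc m"]]
    prob_space_imp_sigma_finite[OF prob_space_Gaussian_rows[of m m]]
  note pr = integral_pair_prod[OF sf chi_moment_integral(1)[OF _ t] conjunct1[OF Suc.IH]]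
  have "integrable (Gaussian_rows (Suc m) (Suc m)) (\<lambda>g. rpow t \<bar>fdet (Suc m) g\<bar>) \<longleftrightarrow>
      integrable (distr (Gaussian_rows (Suc m) (Suc m)) borel (\<lambda>g. \<bar>fdet (Suc m) g\<bar>)) (rpow t)"
    by (rule integrable_distr_eq[OF fm measurable_rpow, symmetric])
  also have "\<dots> \<longleftrightarrow> integrable ?P (\<lambda>p. rpow t (?f p))"
    unfolding det_law_Suc by (rule integrable_distr_eq[OF m2 measurable_rpow])
  finally have int: "integrable (Gaussian_rows (Suc m) (Suc m)) (\<lambda>g. rpow t \<bar>fdet (Suc m) g\<bar>)"
    unfolding rf using pr(1) by simp
  have "(LINT g|Gaussian_rows (Suc m) (Suc m). rpow t \<bar>fdet (Suc m) g\<bar>) =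
      (LINT x|distr (Gaussian_rows (Suc m) (Suc m)) borel (\<lambda>g. \<bar>fdet (Suc m) g\<bar>). rpow t x)"
    by (rule integral_distr[OF fm measurable_rpow, symmetric])
  also have "\<dots> = (LINT p|(?P). rpow t (?f p))"
    unfolding det_law_Suc by (rule integral_distr[OF m2 measurable_rpow])
  also have "\<dots> = chi_moment (Suc m) t * (\<Prod>j=1..m. chi_moment j t)"
  proof -
    have rf: "rpow t (?f p) = rpow t (vnorm (Suc m) (fst p)) * rpow t \<bar>fdet m (snd p)\<bar>" for p
      by (simp only: split_beta rpow_mult vnorm_nonneg abs_ge_zero)
    show ?thesis
      unfolding rf using pr(2) Suc.IH chi_moment_integral(2)[OF _ t, of "Suc m"] by (simp only:)
  qed
  finally show ?case using int by (simp only: prod.nat_ivl_Suc' mult.commute)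
qed

section \<open>The moment generating function of the log-volume\<close>

locale iid_Gaussian =
  fixes n :: nat and M :: "'a measure" and X :: "nat \<Rightarrow> 'a \<Rightarrow> nat \<Rightarrow> real"
  assumes iid: "iid_std_Gaussian_points n M X" and n: "n \<ge> 1"
begin

sublocale prob_space M
  using iid by (simp add: iid_std_Gaussian_points_def)

lemma indep_X: "indep_vars (\<lambda>_. \<Pi>\<^sub>M k\<in>{..<n}. borel) X {..n}"
  using iid by (simp add: iid_std_Gaussian_points_def)

lemma distr_X: "i \<le> n \<Longrightarrow> distr M (\<Pi>\<^sub>M k\<in>{..<n}. borel) (X i) = std_Gaussian n"
  using iid by (simp add: iid_std_Gaussian_points_def)

lemma measurable_X: "i \<le> n \<Longrightarrow> X i \<in> M \<rightarrow>\<^sub>M (\<Pi>\<^sub>M k\<in>{..<n}. borel)"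
  using indep_X by (auto simp: indep_vars_def2)

lemma measurable_coord: "i \<le> n \<Longrightarrow> k < n \<Longrightarrow> (\<lambda>\<omega>. X i \<omega> k) \<in> borel_measurable M"
  using measurable_compose[OF measurable_X measurable_component_singleton[of k "{..<n}"]] by auto

lemma distr_coord:
  assumes "i \<le> n" "k < n"
  shows "distr M borel (\<lambda>\<omega>. X i \<omega> k) = std_normal_distribution"
proof -
  have "distr M borel (\<lambda>\<omega>. X i \<omega> k) = distr (distr M (\<Pi>\<^sub>M k\<in>{..<n}. borel) (X i)) borel (\<lambda>x. x k)"
    using assms by (subst distr_distr) (auto simp: comp_def intro!: measurable_X)
  also have "\<dots> = distr (std_Gaussian n) std_normal_distribution (\<lambda>x. x k)"
    using assms by (simp add: distr_X cong: distr_cong)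
  also have "\<dots> = std_normal_distribution"
    using assms by (intro distr_PiM_component prob_space_std_normal) auto
  finally show ?thesis .
qed

lemma distr_points:
  "distr M (\<Pi>\<^sub>M i\<in>{..n}. \<Pi>\<^sub>M k\<in>{..<n}. borel) (\<lambda>\<omega>. \<lambda>i\<in>{..n}. X i \<omega>) = (\<Pi>\<^sub>M i\<in>{..n}. std_Gaussian n)"
proof -
  have "distr M (\<Pi>\<^sub>M i\<in>{..n}. \<Pi>\<^sub>M k\<in>{..<n}. borel) (\<lambda>\<omega>. \<lambda>i\<in>{..n}. X i \<omega>) =
      (\<Pi>\<^sub>M i\<in>{..n}. distr M (\<Pi>\<^sub>M k\<in>{..<n}. borel) (X i))"
    using indep_X by (subst (asm) indep_vars_iff_distr_eq_PiM') (auto intro: measurable_X)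
  also have "\<dots> = (\<Pi>\<^sub>M i\<in>{..n}. std_Gaussian n)"
    by (intro PiM_cong) (auto simp: distr_X)
  finally show ?thesis .
qed

text \<open>The points are independent and each has a product law; the joint law of all coordinates
  is then a product over the set of index pairs, which permits regrouping them by \<open>k\<close>
  instead of by \<open>i\<close>.\<close>

lemma indep_coords: "indep_vars (\<lambda>_. borel) (\<lambda>(i, k) \<omega>. X i \<omega> k) ({..n} \<times> {..<n})"
proof -
  let ?J = "{..n} \<times> {..<n}" and ?W = "\<lambda>(i, k) \<omega>. X i \<omega> k"
  interpret N: product_sigma_finite "\<lambda>_::nat \<times> nat. std_normal_distribution"
    using prob_space_std_normal by (simp add: product_sigma_finite_def prob_space_imp_sigma_finite)
  interpret N1: product_sigma_finite "\<lambda>_::nat. std_normal_distribution"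
    using prob_space_std_normal by (simp add: product_sigma_finite_def prob_space_imp_sigma_finite)
  interpret G: product_sigma_finite "\<lambda>_::nat. std_Gaussian n"
    using prob_space_std_Gaussian by (simp add: product_sigma_finite_def prob_space_imp_sigma_finite)
  have W: "?W p \<in> borel_measurable M" if "p \<in> ?J" for p
    using that measurable_coord by (cases p) auto
  have rW: "(\<lambda>\<omega>. \<lambda>p\<in>?J. ?W p \<omega>) \<in> M \<rightarrow>\<^sub>M (\<Pi>\<^sub>M p\<in>?J. borel)"
    using W by (intro measurable_restrict) auto
  have "distr M (\<Pi>\<^sub>M p\<in>?J. borel) (\<lambda>\<omega>. \<lambda>p\<in>?J. ?W p \<omega>) = (\<Pi>\<^sub>M p\<in>?J. std_normal_distribution)"
  proof (rule N.PiM_eqI)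
    show "sets (distr M (\<Pi>\<^sub>M p\<in>?J. borel) (\<lambda>\<omega>. \<lambda>p\<in>?J. ?W p \<omega>)) = sets (\<Pi>\<^sub>M p\<in>?J. std_normal_distribution)"
      by (subst sets_distr) (intro sets_PiM_cong, auto)
    fix A :: "nat \<times> nat \<Rightarrow> real set"
    assume A: "\<And>p. p \<in> ?J \<Longrightarrow> A p \<in> sets std_normal_distribution"
    then have A': "i \<le> n \<Longrightarrow> k < n \<Longrightarrow> A (i, k) \<in> sets borel" for i k by auto
    let ?B = "\<lambda>i. \<Pi>\<^sub>E k\<in>{..<n}. A (i, k)"
    have B: "?B i \<in> sets (\<Pi>\<^sub>M k\<in>{..<n}. borel)" if "i \<le> n" for i
      using that A' by (intro sets_PiM_I_finite) auto
    \<comment> \<open>Values in the product space are extensional, so membership of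
      \<open>X i \<omega>\<close> in the box \<open>?B i\<close> is decided by the coordinates below
      \<open>n\<close>.\<close>
    have X_ext: "X i \<omega> \<in> extensional {..<n}" if "i \<le> n" "\<omega> \<in> space M" for i \<omega>
      using measurable_space[OF measurable_X[OF that(1)] that(2)] by (auto simp: space_PiM PiE_def)
    have "emeasure (distr M (\<Pi>\<^sub>M p\<in>?J. borel) (\<lambda>\<omega>. \<lambda>p\<in>?J. ?W p \<omega>)) (Pi\<^sub>E ?J A) =
        emeasure M ((\<lambda>\<omega>. \<lambda>p\<in>?J. ?W p \<omega>) -` (Pi\<^sub>E ?J A) \<inter> space M)"
      using rW A by (intro emeasure_distr sets_PiM_I_finite) auto
    also have "(\<lambda>\<omega>. \<lambda>p\<in>?J. ?W p \<omega>) -` (Pi\<^sub>E ?J A) \<inter> space M =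
        (\<lambda>\<omega>. \<lambda>i\<in>{..n}. X i \<omega>) -` (\<Pi>\<^sub>E i\<in>{..n}. ?B i) \<inter> space M"
      using X_ext by (auto simp: PiE_def Pi_def)
    also have "emeasure M \<dots> = emeasure (distr M (\<Pi>\<^sub>M i\<in>{..n}. \<Pi>\<^sub>M k\<in>{..<n}. borel) (\<lambda>\<omega>. \<lambda>i\<in>{..n}. X i \<omega>))
        (\<Pi>\<^sub>E i\<in>{..n}. ?B i)"
      using B A' measurable_X by (intro emeasure_distr[symmetric] sets_PiM_I_finite measurable_restrict) auto
    also have "\<dots> = (\<Prod>i\<in>{..n}. emeasure (std_Gaussian n) (?B i))"
    proof -
      have "?B i \<in> sets (std_Gaussian n)" if "i \<in> {..n}" for i
        using that A' by (intro sets_PiM_I_finite) auto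
      then show ?thesis unfolding distr_points by (intro G.emeasure_PiM) auto
    qed
    also have "\<dots> = (\<Prod>i\<in>{..n}. \<Prod>k\<in>{..<n}. emeasure std_normal_distribution (A (i, k)))"
      using A' by (intro prod.cong refl N1.emeasure_PiM) auto
    also have "\<dots> = (\<Prod>p\<in>?J. emeasure std_normal_distribution (A p))"
      by (simp add: prod.cartesian_product case_prod_beta')
    finally show "emeasure (distr M (\<Pi>\<^sub>M p\<in>?J. borel) (\<lambda>\<omega>. \<lambda>p\<in>?J. ?W p \<omega>)) (Pi\<^sub>E ?J A) =
      (\<Prod>p\<in>?J. emeasure std_normal_distribution (A p))" .
  qed simp
  also have "\<dots> = (\<Pi>\<^sub>M p\<in>?J. distr M borel (?W p))"
    by (intro PiM_cong) (auto simp: distr_coord)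
  finally show ?thesis
    using W n by (subst indep_vars_iff_distr_eq_PiM') (auto simp: lessThan_empty_iff)
qed

text \<open>Blocks of an independent family are independent, here the blocks with fixed
  \<open>k\<close>; this transposes the array of points into an array of rows.\<close>

lemma distr_coordinate_rows:
  "distr M (\<Pi>\<^sub>M k\<in>{..<n}. \<Pi>\<^sub>M i\<in>{..<Suc n}. borel) (\<lambda>\<omega>. \<lambda>k\<in>{..<n}. \<lambda>i\<in>{..<Suc n}. X i \<omega> k) =
   Gaussian_rows n (Suc n)"
proof -
  have "indep_vars (\<lambda>k. \<Pi>\<^sub>M p\<in>{..n} \<times> {k}. borel)
      (\<lambda>k \<omega>. \<lambda>p\<in>{..n} \<times> {k}. (case p of (i, k) \<Rightarrow> \<lambda>\<omega>. X i \<omega> k) \<omega>) {..<n}"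
    using indep_vars_restrict[OF indep_coords, of "{..<n}" "\<lambda>k. {..n} \<times> {k}"]
    by (auto simp: disjoint_family_on_def)
  then have "indep_vars (\<lambda>_. \<Pi>\<^sub>M i\<in>{..<Suc n}. borel)
      (\<lambda>k \<omega>. (\<lambda>f. \<lambda>i\<in>{..<Suc n}. f (i, k)) (\<lambda>p\<in>{..n} \<times> {k}. (case p of (i, k) \<Rightarrow> \<lambda>\<omega>. X i \<omega> k) \<omega>)) {..<n}"
    by (rule indep_vars_compose2) (intro measurable_restrict measurable_component_singleton, auto)
  also have "(\<lambda>k \<omega>. (\<lambda>f. \<lambda>i\<in>{..<Suc n}. f (i, k)) (\<lambda>p\<in>{..n} \<times> {k}. (case p of (i, k) \<Rightarrow> \<lambda>\<omega>. X i \<omega> k) \<omega>)) =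
      (\<lambda>k \<omega>. \<lambda>i\<in>{..<Suc n}. X i \<omega> k)"
    by (auto simp: fun_eq_iff restrict_def)
  finally have ind: "indep_vars (\<lambda>_. \<Pi>\<^sub>M i\<in>{..<Suc n}. borel) (\<lambda>k \<omega>. \<lambda>i\<in>{..<Suc n}. X i \<omega> k) {..<n}" .
  have row: "distr M (\<Pi>\<^sub>M i\<in>{..<Suc n}. borel) (\<lambda>\<omega>. \<lambda>i\<in>{..<Suc n}. X i \<omega> k) = std_Gaussian (Suc n)" if "k < n" for k
  proof -
    have "indep_vars (\<lambda>_. borel) (\<lambda>i \<omega>. X i \<omega> k) {..n}"
      by (rule indep_vars_compose2[OF indep_X]) (use that in auto)
    then have "indep_vars (\<lambda>_. borel) (\<lambda>i \<omega>. X i \<omega> k) {..<Suc n}"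
      by (simp only: lessThan_Suc_atMost)
    then have "distr M (\<Pi>\<^sub>M i\<in>{..<Suc n}. borel) (\<lambda>\<omega>. \<lambda>i\<in>{..<Suc n}. X i \<omega> k) =
        (\<Pi>\<^sub>M i\<in>{..<Suc n}. distr M borel (\<lambda>\<omega>. X i \<omega> k))"
      using that by (subst (asm) indep_vars_iff_distr_eq_PiM') (auto intro: measurable_coord simp: lessThan_empty_iff)
    also have "\<dots> = std_Gaussian (Suc n)"
      using that by (intro PiM_cong) (auto simp: distr_coord)
    finally show ?thesis .
  qed
  have "distr M (\<Pi>\<^sub>M k\<in>{..<n}. \<Pi>\<^sub>M i\<in>{..<Suc n}. borel) (\<lambda>\<omega>. \<lambda>k\<in>{..<n}. \<lambda>i\<in>{..<Suc n}. X i \<omega> k) =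
      (\<Pi>\<^sub>M k\<in>{..<n}. distr M (\<Pi>\<^sub>M i\<in>{..<Suc n}. borel) (\<lambda>\<omega>. \<lambda>i\<in>{..<Suc n}. X i \<omega> k))"
    using ind n by (subst (asm) indep_vars_iff_distr_eq_PiM')
      (auto simp: lessThan_empty_iff intro!: measurable_restrict measurable_coord)
  also have "\<dots> = Gaussian_rows n (Suc n)"
    by (intro PiM_cong) (auto simp: row)
  finally show ?thesis .
qed

section \<open>The content of the random simplex\<close>

definition content :: "'a \<Rightarrow> real" where
  "content \<omega> = fact n * simplex_volume n (\<lambda>i. X i \<omega>)"

lemma content_nonneg: "content \<omega> \<ge> 0"
  by (simp add: content_def simplex_volume_def)

lemma
  shows measurable_content: "content \<in> borel_measurable M"
    and distr_content: "distr M borel content =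
      distr (Gaussian_rows n n) borel (\<lambda>g. sqrt (real n + 1) * \<bar>fdet n g\<bar>)"
proof -
  let ?Z = "\<lambda>\<omega>. \<lambda>k\<in>{..<n}. \<lambda>i\<in>{..<Suc n}. X i \<omega> k"
  let ?f = "\<lambda>g. \<bar>fdet (Suc n) (g(n := \<lambda>_. 1))\<bar>"
  have c: "content = (\<lambda>\<omega>. ?f (?Z \<omega>))"
  proof
    fix \<omega>
    have "fdet (Suc n) ((\<lambda>k i. X i \<omega> k)(n := \<lambda>_. 1)) = fdet (Suc n) ((?Z \<omega>)(n := \<lambda>_. 1))"
      by (rule fdet_cong) auto
    then show "content \<omega> = ?f (?Z \<omega>)"
      using simplex_volume_eq_bordered_det[of n "\<lambda>i. X i \<omega>"] by (simp only: content_def)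
  qed
  have Z: "?Z \<in> M \<rightarrow>\<^sub>M Gaussian_rows n (Suc n)"
  proof -
    have "?Z \<in> M \<rightarrow>\<^sub>M (\<Pi>\<^sub>M k\<in>{..<n}. \<Pi>\<^sub>M i\<in>{..<Suc n}. borel)"
      by (auto intro!: measurable_restrict measurable_coord)
    then show ?thesis by (simp cong: measurable_cong_sets add: sets_Gaussian_rows)
  qed
  have f: "?f \<in> borel_measurable (Gaussian_rows n (Suc n))"
  proof -
    \<comment> \<open>The row of ones is cut off at \<open>Suc n\<close> to lie in the extensional
      space of rows; the determinant does not see the difference.\<close>
    have "(\<lambda>g. g(n := restrict (\<lambda>_. 1) {..<Suc n})) \<in> Gaussian_rows n (Suc n) \<rightarrow>\<^sub>M Gaussian_rows (Suc n) (Suc n)"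
      using measurable_compose[OF measurable_Pair2' measurable_add_dim[of n "{..<n}" "\<lambda>_. std_Gaussian (Suc n)"],
          of "restrict (\<lambda>_. 1) {..<Suc n}"]
      by (simp add: lessThan_Suc[symmetric] space_PiM)
    moreover have "(\<lambda>g. \<bar>fdet (Suc n) g\<bar>) \<in> borel_measurable (Gaussian_rows (Suc n) (Suc n))"
      using borel_measurable_abs[OF measurable_fdet] by (simp cong: measurable_cong_sets add: sets_Gaussian_rows)
    ultimately have "(\<lambda>g. \<bar>fdet (Suc n) (g(n := restrict (\<lambda>_. 1) {..<Suc n}))\<bar>) \<in> borel_measurable (Gaussian_rows n (Suc n))"
      by (rule measurable_compose)
    moreover have "\<bar>fdet (Suc n) (g(n := restrict (\<lambda>_. 1) {..<Suc n}))\<bar> = ?f g" for g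
      by (rule arg_cong[where f = abs], rule fdet_cong) auto
    ultimately show ?thesis by (simp only:)
  qed
  show "content \<in> borel_measurable M"
    unfolding c by (rule measurable_compose[OF Z f])
  have "distr M borel content = distr (distr M (Gaussian_rows n (Suc n)) ?Z) borel ?f"
    unfolding c by (subst distr_distr[OF f Z]) (simp only: comp_def)
  also have "distr M (Gaussian_rows n (Suc n)) ?Z =
      distr M (\<Pi>\<^sub>M k\<in>{..<n}. \<Pi>\<^sub>M i\<in>{..<Suc n}. borel) ?Z"
    by (rule distr_cong) (simp_all add: sets_Gaussian_rows)
  also have "\<dots> = Gaussian_rows n (Suc n)" by (rule distr_coordinate_rows)
  also have "distr \<dots> borel ?f = distr (Gaussian_rows n n) borel (\<lambda>g. vnorm (Suc n) (\<lambda>_. 1) * \<bar>fdet n g\<bar>)"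
    by (rule bordered_det_law)
  finally show "distr M borel content = distr (Gaussian_rows n n) borel (\<lambda>g. sqrt (real n + 1) * \<bar>fdet n g\<bar>)"
    by (simp add: vnorm_def add.commute)
qed

definition content_moment :: "complex \<Rightarrow> complex" where
  "content_moment t = rpow t (sqrt (real n + 1)) * (\<Prod>j=1..n. chi_moment j t)"

lemma
  assumes t: "Re t > - 1"
  shows integrable_content: "integrable M (\<lambda>\<omega>. rpow t (content \<omega>))"
    and integral_content: "(LINT \<omega>|M. rpow t (content \<omega>)) = content_moment t"
proof -
  let ?f = "\<lambda>g. sqrt (real n + 1) * \<bar>fdet n g\<bar>"
  have f: "?f \<in> borel_measurable (Gaussian_rows n n)"
    using borel_measurable_times[OF borel_measurable_const borel_measurable_abs[OF measurable_fdet]]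
    by (simp cong: measurable_cong_sets add: sets_Gaussian_rows)
  have r: "rpow t (?f g) = rpow t (sqrt (real n + 1)) * rpow t \<bar>fdet n g\<bar>" for g
    by (rule rpow_mult) auto
  have "integrable M (\<lambda>\<omega>. rpow t (content \<omega>)) \<longleftrightarrow> integrable (distr M borel content) (rpow t)"
    by (rule integrable_distr_eq[OF measurable_content measurable_rpow, symmetric])
  also have "\<dots> \<longleftrightarrow> integrable (Gaussian_rows n n) (\<lambda>g. rpow t (?f g))"
    unfolding distr_content by (rule integrable_distr_eq[OF f measurable_rpow])
  finally show "integrable M (\<lambda>\<omega>. rpow t (content \<omega>))"
    unfolding r using det_moment[OF t, of n] by simp
  have "(LINT \<omega>|M. rpow t (content \<omega>)) = (LINT x|distr M borel content. rpow t x)"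
    by (rule integral_distr[OF measurable_content measurable_rpow, symmetric])
  also have "\<dots> = (LINT g|Gaussian_rows n n. rpow t (?f g))"
    unfolding distr_content by (rule integral_distr[OF f measurable_rpow])
  finally show "(LINT \<omega>|M. rpow t (content \<omega>)) = content_moment t"
    unfolding r content_moment_def using det_moment[OF t, of n] by simp
qed

end

section \<open>Regularity of the moment formulas\<close>

lemma Re_pos_not_nonpos_Ints: "Re z > 0 \<Longrightarrow> z \<notin> \<int>\<^sub>\<le>\<^sub>0"
  by (auto elim!: nonpos_Ints_cases')

lemma Gamma_half_nonzero: "j \<ge> 1 \<Longrightarrow> Gamma (of_nat j / 2 :: complex) \<noteq> 0"
  using Re_pos_not_nonpos_Ints[of "of_nat j / 2"] by (simp add: Gamma_eq_zero_iff)

lemma half_shift_not_nonpos_Ints: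
  assumes "j \<ge> 1" "\<forall>k\<ge>1. t \<noteq> - of_nat k"
  shows "(of_nat j + t) / 2 \<notin> (\<int>\<^sub>\<le>\<^sub>0 :: complex set)"
proof
  assume "(of_nat j + t) / 2 \<in> \<int>\<^sub>\<le>\<^sub>0"
  then obtain m where "(of_nat j + t) / 2 = - of_nat m" by (auto elim!: nonpos_Ints_cases')
  then have "of_nat j + t = - (of_nat m * 2)" by (simp only: divide_eq_eq) simp
  then have "(of_nat j + t) - of_nat j = - of_nat (2 * m + j)" by simp
  then have "t = - of_nat (2 * m + j)" by simp
  with assms show False by (metis le_add2 order_trans)
qed

lemma rpow_pos: "x > 0 \<Longrightarrow> rpow t x = exp (t * of_real (ln x))"
  by (simp add: rpow_def)

lemma chi_moment_analytic:
  assumes "j \<ge> 1"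
  shows "chi_moment j analytic_on - {- of_nat k | k. k \<ge> 1}"
  unfolding chi_moment_def rpow_pos[OF zero_less_numeral]
  using Gamma_half_nonzero[OF assms] half_shift_not_nonpos_Ints[OF assms]
  by (intro analytic_intros) auto

text \<open>Writing Gamma as the inverse of the entire function \<open>rGamma\<close> covers the
  whole plane, poles included.\<close>

lemma chi_moment_meromorphic: "chi_moment j meromorphic_on UNIV"
proof -
  have "(\<lambda>t. rGamma ((of_nat j + t) / 2)) analytic_on UNIV"
    by (intro analytic_intros) auto
  then have "(\<lambda>t. rpow (t / 2) 2 * inverse (rGamma ((of_nat j + t) / 2)) / Gamma (of_nat j / 2)) meromorphic_on UNIV"
    unfolding rpow_pos[OF zero_less_numeral]
    by (intro meromorphic_intros analytic_on_imp_meromorphic_on) (auto intro!: analytic_intros)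
  then show ?thesis
    by (simp add: chi_moment_def[abs_def] Gamma_def)
qed

lemma chi_moment_0: "j \<ge> 1 \<Longrightarrow> chi_moment j 0 = 1"
  using Gamma_half_nonzero[of j] by (simp add: chi_moment_def rpow_def)

context iid_Gaussian
begin

lemma content_moment_analytic: "content_moment analytic_on - {- of_nat k | k. k \<ge> 1}"
proof -
  have "0 < sqrt (real n + 1)" by (simp add: add_nonneg_pos)
  then show ?thesis
    unfolding content_moment_def[abs_def]
    by (simp only: rpow_pos) (intro analytic_intros chi_moment_analytic; simp)
qed

lemma content_moment_meromorphic: "content_moment meromorphic_on UNIV"
proof -
  have "0 < sqrt (real n + 1)" by (simp add: add_nonneg_pos)
  then show ?thesis
    unfolding content_moment_def[abs_def]
    by (simp only: rpow_pos) (intro meromorphic_on_mult meromorphic_on_prod chi_moment_meromorphic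
      analytic_on_imp_meromorphic_on analytic_intros)
qed

text \<open>Since \<open>rpow\<close> vanishes at 0, the moment of order 0 is the probability that
  the content is nonzero, and the moment formula gives 1 for it.\<close>

lemma AE_content_pos: "AE \<omega> in M. content \<omega> > 0"
proof -
  have "(LINT \<omega>|M. rpow 0 (content \<omega>)) = 1"
    by (subst integral_content) (simp_all add: content_moment_def chi_moment_0 rpow_def add_nonneg_eq_0_iff)
  moreover have "rpow 0 (content \<omega>) = of_real (indicator {x. x \<noteq> 0} (content \<omega>))" for \<omega>
    by (simp add: rpow_def)
  ultimately have "complex_of_real (LINT \<omega>|M. indicator {x. x \<noteq> 0} (content \<omega>)) = 1"
    by (simp only: integral_complex_of_real)
  then have "(LINT \<omega>|M. indicator {x. x \<noteq> 0} (content \<omega>)) = (1 :: real)"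
    by (simp only: of_real_eq_1_iff)
  moreover have "(LINT \<omega>|M. indicator {x. x \<noteq> 0} (content \<omega>)) =
      (LINT \<omega>|M. indicator {\<omega> \<in> space M. content \<omega> \<noteq> 0} \<omega> :: real)"
    by (intro Bochner_Integration.integral_cong) (auto simp: indicator_def)
  moreover have ev: "{\<omega> \<in> space M. content \<omega> \<noteq> 0} \<in> events"
    using measurable_content by measurable
  ultimately have "prob {\<omega> \<in> space M. content \<omega> \<noteq> 0} = 1"
    by simp
  then have "AE \<omega> in M. content \<omega> \<noteq> 0"
    using prob_eq_1[OF ev] by auto
  then show ?thesis
    using content_nonneg by (auto simp: order.strict_iff_order)
qed

section \<open>The moment generating function and its continuation\<close>

abbreviation Y :: "'a \<Rightarrow> real" where
  "Y \<equiv> centered_log_volume n X"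

lemma Y_eq: "Y \<omega> = ln (content \<omega>) - centering n"
  by (simp add: centered_log_volume_def log_volume_def content_def)

lemma measurable_Y: "Y \<in> borel_measurable M"
  unfolding Y_eq[abs_def] using measurable_content by measurable

definition mgf_formula :: "complex \<Rightarrow> complex" where
  "mgf_formula t = exp (- t * of_real (centering n)) * content_moment t"

lemma AE_exp_Y: "AE \<omega> in M. exp (t * of_real (Y \<omega>)) = exp (- t * of_real (centering n)) * rpow t (content \<omega>)"
  using AE_content_pos
  by eventually_elim (simp add: Y_eq rpow_pos exp_add[symmetric] algebra_simps)

lemma
  assumes "Re t > - 1"
  shows integrable_exp_Y: "integrable M (\<lambda>\<omega>. exp (t * of_real (Y \<omega>)))"
    and integral_exp_Y: "(LINT \<omega>|M. exp (t * of_real (Y \<omega>))) = mgf_formula t"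
proof -
  note [measurable] = measurable_Y measurable_content
  show "integrable M (\<lambda>\<omega>. exp (t * of_real (Y \<omega>)))"
    using integrable_content[OF assms] by (subst integrable_cong_AE[OF _ _ AE_exp_Y]) simp_all
  show "(LINT \<omega>|M. exp (t * of_real (Y \<omega>))) = mgf_formula t"
    using integral_content[OF assms] by (subst integral_cong_AE[OF _ _ AE_exp_Y]) (simp_all add: mgf_formula_def)
qed

text \<open>A continuation must agree with every convergent integral, so convergence for Re t \<le>
  -1 has to be excluded. It would bound \<open>mgf_formula\<close> on (-1, 0), and multiplication by
  \<open>rGamma ((1 + t) / 2)\<close>, which vanishes at -1, would then give the limit 0 there. But
  that product extends continuously to -1 with a nonzero value.\<close>

lemma not_integrable_exp_Y:
  assumes "Re t \<le> - 1"
  shows "\<not> integrable M (\<lambda>\<omega>. exp (t * of_real (Y \<omega>)))"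
proof
  assume "integrable M (\<lambda>\<omega>. exp (t * of_real (Y \<omega>)))"
  then have "integrable M (\<lambda>\<omega>. norm (exp (t * of_real (Y \<omega>))))"
    by (rule integrable_norm)
  then have int: "integrable M (\<lambda>\<omega>. exp (Re t * Y \<omega>))"
    by (simp add: norm_exp_eq_Re)
  define B where "B = (LINT \<omega>|M. exp (Re t * Y \<omega>) + 1)"
  have bound: "norm (mgf_formula (of_real x)) \<le> B" if x: "x \<in> {-1<..<0}" for x
  proof -
    have i: "integrable M (\<lambda>\<omega>. exp (complex_of_real x * of_real (Y \<omega>)))"
      by (rule integrable_exp_Y) (use x in auto)
    have "norm (mgf_formula (of_real x)) \<le> (LINT \<omega>|M. norm (exp (complex_of_real x * of_real (Y \<omega>))))"
      using x integral_norm_bound[of M "\<lambda>\<omega>. exp (complex_of_real x * of_real (Y \<omega>))"]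
      by (simp add: integral_exp_Y)
    also have "\<dots> \<le> B"
      unfolding B_def
    proof (rule integral_mono)
      show "integrable M (\<lambda>\<omega>. norm (exp (complex_of_real x * of_real (Y \<omega>))))"
        using i by (rule integrable_norm)
      show "integrable M (\<lambda>\<omega>. exp (Re t * Y \<omega>) + 1)"
        using int by simp
      fix \<omega>
      \<comment> \<open>Because Re t \<le> -1 < x < 0, the first alternative holds for
        \<open>Y \<omega> \<le> 0\<close> and the second one otherwise.\<close>
      have "x * Y \<omega> \<le> Re t * Y \<omega> \<or> x * Y \<omega> \<le> 0"
        using x assms by (cases "Y \<omega> \<le> 0") (auto intro: mult_right_mono_neg simp: mult_nonpos_nonneg)
      then have "exp (x * Y \<omega>) \<le> exp (Re t * Y \<omega>) \<or> exp (x * Y \<omega>) \<le> 1" by auto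
      then show "norm (exp (complex_of_real x * of_real (Y \<omega>))) \<le> exp (Re t * Y \<omega>) + 1"
        by (auto simp: norm_exp_eq_Re intro: order_trans add_increasing add_increasing2)
    qed
    finally show ?thesis .
  qed
  \<comment> \<open>The formula without its factor Gamma ((1 + t) / 2), which comes from j = 1 and
    is the only one with a pole at -1.\<close>
  define \<psi> where "\<psi> = (\<lambda>t. exp (- t * of_real (centering n)) * rpow t (sqrt (real n + 1)) *
      (rpow (t / 2) 2 / Gamma (1 / 2)) * (\<Prod>j=2..n. chi_moment j t))"
  have split: "{1..n} = insert 1 {2..n}" using n by auto
  have \<psi>_eq: "mgf_formula t * rGamma ((1 + t) / 2) = \<psi> t" if "Re t > - 1" for t
  proof -
    have "rGamma ((1 + t) / 2) \<noteq> 0"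
      using that Re_pos_not_nonpos_Ints[of "(1 + t) / 2"] by (simp add: rGamma_eq_zero_iff)
    moreover have "(\<Prod>j=1..n. chi_moment j t) = chi_moment 1 t * (\<Prod>j=2..n. chi_moment j t)"
      unfolding split by simp
    ultimately show ?thesis
      by (simp add: mgf_formula_def content_moment_def \<psi>_def chi_moment_def[of "Suc 0"] Gamma_def[of "(1 + t) / 2"])
  qed
  have pos: "Re ((of_nat j + (-1 :: complex)) / 2) > 0" if "j \<in> {2..n}" for j
    using that by simp
  have npos: "(of_nat j + (-1 :: complex)) / 2 \<notin> \<int>\<^sub>\<le>\<^sub>0" if "j \<in> {2..n}" for j
    using Re_pos_not_nonpos_Ints[OF pos[OF that]] .
  have sq: "0 < sqrt (real n + 1)" by (simp add: add_nonneg_pos)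
  have "isCont \<psi> (-1)"
    unfolding \<psi>_def chi_moment_def rpow_pos[OF zero_less_numeral] rpow_pos[OF sq]
    using npos Gamma_half_nonzero Gamma_half_nonzero[of 1]
    by (intro continuous_intros) auto
  have lim: "((\<lambda>x. complex_of_real x) \<longlongrightarrow> -1) (at_right (-1))"
    by (rule tendsto_eq_intros refl | simp)+
  have 1: "((\<lambda>x. \<psi> (of_real x)) \<longlongrightarrow> \<psi> (-1)) (at_right (-1))"
    by (rule isCont_tendsto_compose[OF \<open>isCont \<psi> (-1)\<close> lim])
  have ev: "eventually (\<lambda>x. x \<in> {-1<..<(0::real)}) (at_right (-1))"
    by (rule eventually_at_right_real) simp
  have "((\<lambda>x. mgf_formula (of_real x) * rGamma ((1 + of_real x) / 2)) \<longlongrightarrow> 0) (at_right (-1))"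
  proof (rule tendsto_0_le)
    have "isCont (\<lambda>x::complex. rGamma ((1 + x) / 2)) (-1)"
      by (intro continuous_intros) auto
    from isCont_tendsto_compose[OF this lim] show "((\<lambda>x. rGamma ((1 + complex_of_real x) / 2)) \<longlongrightarrow> 0) (at_right (-1))"
      by simp
    show "eventually (\<lambda>x. norm (mgf_formula (of_real x) * rGamma ((1 + of_real x) / 2)) \<le>
        norm (rGamma ((1 + complex_of_real x) / 2)) * B) (at_right (-1))"
      using ev by eventually_elim (simp add: norm_mult bound mult.commute[of "norm (rGamma _)"] mult_right_mono)
  qed
  then have "((\<lambda>x. \<psi> (of_real x)) \<longlongrightarrow> 0) (at_right (-1))"
    by (rule Lim_transform_eventually) (use ev in eventually_elim, simp add: \<psi>_eq)
  then have "\<psi> (-1) = 0"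
    using 1 by (intro tendsto_unique[OF _ 1]) auto
  then show False
    using npos sq Gamma_half_nonzero Gamma_half_nonzero[of 1]
    by (auto simp: \<psi>_def rpow_def chi_moment_def Gamma_eq_zero_iff)
qed

lemma mgf_formula_analytic: "mgf_formula analytic_on - {- of_nat k | k. k \<ge> 1}"
  unfolding mgf_formula_def[abs_def] by (intro analytic_intros content_moment_analytic)

text \<open>Where the integral converges, Re t > -1, and \<open>mgf_formula\<close> is analytic
  there, so removing singularities leaves its value alone; at the poles the value becomes 0, as the
  normalisation of a continuation requires.\<close>

lemma mgf_continuation_Y: "mgf_continuation M Y (remove_sings mgf_formula)"
  unfolding mgf_continuation_def
proof (intro conjI allI impI)
  have "mgf_formula meromorphic_on UNIV"
    unfolding mgf_formula_def[abs_def]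
    by (intro meromorphic_intros content_moment_meromorphic analytic_on_imp_meromorphic_on analytic_intros)
  then show "remove_sings mgf_formula nicely_meromorphic_on UNIV"
    by (rule remove_sings_nicely_meromorphic)
  fix t :: complex assume "integrable M (\<lambda>\<omega>. exp (t * of_real (Y \<omega>)))"
  then have t: "Re t > - 1" using not_integrable_exp_Y[of t] by (cases "Re t > - 1") auto
  then have "t \<in> - {- of_nat k | k. k \<ge> 1}" by auto
  then have "mgf_formula analytic_on {t}"
    by (intro analytic_on_subset[OF mgf_formula_analytic]) auto
  then show "remove_sings mgf_formula t = (LINT \<omega>|M. exp (t * of_real (Y \<omega>)))"
    using integral_exp_Y[OF t] by simp
qed

text \<open>The definite description in \<open>mgf\<close> is resolved by uniqueness of the
  continuation; off the negative integers the formula is analytic, hence equal to its version with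
  singularities removed.\<close>

lemma mgf_Y:
  assumes "t \<in> - {- of_nat k | k. k \<ge> 1}"
  shows "mgf M Y t = mgf_formula t"
proof -
  have "mgf_formula analytic_on {t}"
    using assms by (intro analytic_on_subset[OF mgf_formula_analytic]) auto
  moreover have "(THE F. mgf_continuation M Y F) = remove_sings mgf_formula"
    using mgf_continuation_Y mgf_continuation_unique[OF prob_space_axioms measurable_Y] by blast
  moreover have "Re t > - 1" if "integrable M (\<lambda>\<omega>. exp (t * of_real (Y \<omega>)))"
    using that not_integrable_exp_Y[of t] by (cases "Re t > - 1") auto
  ultimately show ?thesis
    by (auto simp: mgf_def integral_exp_Y)
qed

end

section \<open>Asymptotics of Gamma products\<close>

lemma uniform_limit_of_bound:
  fixes f :: "nat \<Rightarrow> 'a \<Rightarrow> 'b::real_normed_vector"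
  assumes "eventually (\<lambda>n. \<forall>x\<in>K. norm (f n x - l x) \<le> e n) sequentially" "e \<longlonglongrightarrow> 0"
  shows "uniform_limit K f l sequentially"
proof (rule uniform_limitI)
  fix \<epsilon> :: real assume "\<epsilon> > 0"
  with assms(2) have "eventually (\<lambda>n. e n < \<epsilon>) sequentially" by (rule order_tendstoD)
  with assms(1) show "eventually (\<lambda>n. \<forall>x\<in>K. dist (f n x) (l x) < \<epsilon>) sequentially"
    by eventually_elim (auto simp: dist_norm intro: le_less_trans)
qed

lemma uniform_limit_sequence_const:
  fixes h :: "nat \<Rightarrow> 'b::real_normed_vector"
  assumes "h \<longlonglongrightarrow> c"
  shows "uniform_limit K (\<lambda>n _. h n) (\<lambda>_. c) sequentially"
proof (rule uniform_limit_of_bound)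
  show "(\<lambda>n. norm (h n - c)) \<longlonglongrightarrow> 0"
    using assms by (simp add: tendsto_norm_zero_iff LIM_zero_iff)
qed auto

text \<open>The exponential is not uniformly continuous on the plane; a bounded limit confines
  eventually all values to one ball, where it is.\<close>

lemma uniform_limit_exp:
  fixes l :: "'a \<Rightarrow> complex"
  assumes f: "uniform_limit K f l F" and l: "bounded (l ` K)"
  shows "uniform_limit K (\<lambda>n x. exp (f n x)) (\<lambda>x. exp (l x)) F"
proof -
  obtain b where b: "\<And>x. x \<in> K \<Longrightarrow> norm (l x) \<le> b" using l by (auto simp: bounded_iff)
  show ?thesis
  proof (rule uniform_limit_compose_uniformly_continuous_on[OF f])
    show "uniformly_continuous_on (cball 0 (b + 1)) (exp :: complex \<Rightarrow> complex)"
      by (intro compact_uniformly_continuous continuous_intros) auto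
    have "eventually (\<lambda>n. \<forall>x\<in>K. dist (f n x) (l x) < 1) F"
      by (rule uniform_limitD[OF f]) simp
    then show "eventually (\<lambda>n. \<forall>x\<in>K. f n x \<in> cball 0 (b + 1)) F"
    proof eventually_elim
      case (elim n)
      have "norm (f n x) \<le> b + 1" if "x \<in> K" for x
        using elim b[OF that] that norm_triangle_ineq[of "f n x - l x" "l x"] by (force simp: dist_norm)
      then show ?case by simp
    qed
  qed auto
qed

lemma norm_exp_minus_1_le: "norm (exp z - 1) \<le> norm z * exp (norm z)" for z :: complex
proof -
  have "norm (exp z - exp 0) \<le> exp (norm z) * norm (z - 0)"
  proof (rule field_differentiable_bound[where S = "cball 0 (norm z)"])
    fix w :: complex assume "w \<in> cball 0 (norm z)"
    then show "norm (exp w) \<le> exp (norm z)"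
      using complex_Re_le_cmod[of w] by (simp add: norm_exp_eq_Re)
  qed (auto intro!: derivative_eq_intros)
  then show ?thesis by (simp add: mult.commute)
qed

text \<open>The expression has derivative z^2 / (1 + z), of modulus at most 2 |w|^2 on the ball of
  radius |w|. The third order is what the exponentials in the Barnes product and the correction of
  the Gamma ratio leave over.\<close>

lemma norm_Ln_cubic_le:
  assumes "norm w \<le> 1 / 2"
  shows "norm (Ln (1 + w) - w + w\<^sup>2 / 2) \<le> 2 * norm w ^ 3"
proof -
  let ?f = "\<lambda>z. Ln (1 + z) - z + z\<^sup>2 / 2"
  have "norm (?f w - ?f 0) \<le> (2 * (norm w)\<^sup>2) * norm (w - 0)"
  proof (rule field_differentiable_bound[where S = "cball 0 (norm w)" and f' = "\<lambda>z. z\<^sup>2 / (1 + z)"])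
    fix z :: complex assume "z \<in> cball 0 (norm w)"
    then have z: "norm z \<le> norm w" by simp
    then have half: "norm z \<le> 1 / 2" using assms by simp
    have re: "Re (1 + z) > 0" using half abs_Re_le_cmod[of z] by simp
    then have nz: "1 + z \<noteq> 0" by (metis less_irrefl zero_complex.sel(1))
    have n: "norm (1 + z) \<ge> 1 / 2"
      using norm_triangle_ineq4[of "1 + z" z] half by simp
    show "(?f has_field_derivative z\<^sup>2 / (1 + z)) (at z within cball 0 (norm w))"
    proof -
      have "z\<^sup>2 / (1 + z) = 1 / (1 + z) - 1 + z"
        using nz by (simp add: field_simps power2_eq_square)
      then show ?thesis
        using re by (auto intro!: derivative_eq_intros simp: complex_nonpos_Reals_iff inverse_eq_divide)
    qed
    have "norm (z\<^sup>2 / (1 + z)) \<le> (norm w)\<^sup>2 / (1 / 2)"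
      unfolding norm_divide norm_power using n z by (intro frac_le power_mono) auto
    then show "norm (z\<^sup>2 / (1 + z)) \<le> 2 * (norm w)\<^sup>2" by simp
  qed auto
  then show ?thesis by (simp add: power2_eq_square power3_eq_cube mult.assoc)
qed

section \<open>Convergence of the Barnes product\<close>

definition Barnes_factor :: "nat \<Rightarrow> complex \<Rightarrow> complex" where
  "Barnes_factor k z = (1 + z / of_nat (Suc k)) ^ Suc k * exp (z\<^sup>2 / (2 * of_nat (Suc k)) - z)"

text \<open>With m = k + 1 and w = z / m, the factor is exp l for l = m (Ln (1 + w) - w + w^2 / 2),
  so that \<open>m\<close> times a cubic remainder leaves O(m^-2).\<close>

lemma norm_Barnes_factor_le:
  assumes "norm z \<le> R" "2 * R \<le> real (Suc k)"
  shows "norm (Barnes_factor k z - 1) \<le> 2 * R ^ 3 * exp (2 * R ^ 3) * (1 / real (Suc k) ^ 2)"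
proof -
  define m where "m = Suc k"
  have m: "real m \<ge> 1" "2 * R \<le> real m" using assms(2) by (auto simp: m_def)
  have R: "R \<ge> 0" using assms(1) norm_ge_zero[of z] by linarith
  define w where "w = z / of_nat m"
  define l where "l = of_nat m * (Ln (1 + w) - w + w\<^sup>2 / 2)"
  have w: "norm w \<le> R / real m" using assms m by (simp add: w_def norm_divide divide_right_mono)
  also have "\<dots> \<le> 1 / 2" using m by (simp add: field_simps)
  finally have half: "norm w \<le> 1 / 2" .
  have nz: "1 + w \<noteq> 0"
  proof
    assume "1 + w = 0"
    then have "w = - 1" by (simp add: eq_neg_iff_add_eq_0 add.commute)
    with half show False by simp
  qed
  have z: "z = of_nat m * w" using m by (simp add: w_def)
  have "l = of_nat m * Ln (1 + w) + (z\<^sup>2 / (2 * of_nat m) - z)"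
    using m by (simp add: l_def z power2_eq_square algebra_simps)
  then have "exp l = exp (of_nat m * Ln (1 + w)) * exp (z\<^sup>2 / (2 * of_nat m) - z)"
    by (simp only: exp_add)
  also have "exp (of_nat m * Ln (1 + w)) = (1 + w) ^ m"
    using nz by (simp add: exp_of_nat_mult)
  finally have e: "Barnes_factor k z = exp l" by (simp add: Barnes_factor_def m_def w_def)
  have "norm l \<le> real m * (2 * norm w ^ 3)"
    unfolding l_def norm_mult using norm_Ln_cubic_le[OF half] by (simp add: mult_left_mono)
  also have "\<dots> \<le> real m * (2 * (R / real m) ^ 3)"
    using w by (intro mult_left_mono power_mono) auto
  also have "\<dots> = 2 * R ^ 3 * (1 / real m ^ 2)"
    using m by (simp add: field_simps power2_eq_square power3_eq_cube)
  finally have l: "norm l \<le> 2 * R ^ 3 * (1 / real m ^ 2)" .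
  also have "\<dots> \<le> 2 * R ^ 3 * 1"
    using R m by (intro mult_left_mono) (auto simp: field_simps)
  finally have l2: "norm l \<le> 2 * R ^ 3" by simp
  have "norm (Barnes_factor k z - 1) \<le> norm l * exp (norm l)"
    unfolding e by (rule norm_exp_minus_1_le)
  also have "\<dots> \<le> (2 * R ^ 3 * (1 / real m ^ 2)) * exp (2 * R ^ 3)"
    using l l2 R by (intro mult_mono) auto
  finally show ?thesis by (simp add: m_def mult_ac)
qed

lemma eventually_norm_Barnes_factor_le:
  assumes "bounded K"
  obtains C where "eventually (\<lambda>k. \<forall>z\<in>K. norm (Barnes_factor k z - 1) \<le> C * (1 / real (Suc k) ^ 2)) sequentially"
proof -
  obtain R where R: "\<And>z. z \<in> K \<Longrightarrow> norm z \<le> R" using assms by (auto simp: bounded_iff)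
  have "eventually (\<lambda>k. 2 * R \<le> real (Suc k)) sequentially"
    using eventually_ge_at_top[of "nat \<lceil>2 * R\<rceil>"] by eventually_elim linarith
  then have "eventually (\<lambda>k. \<forall>z\<in>K. norm (Barnes_factor k z - 1) \<le>
      2 * R ^ 3 * exp (2 * R ^ 3) * (1 / real (Suc k) ^ 2)) sequentially"
    by eventually_elim (intro ballI norm_Barnes_factor_le R)
  then show thesis by (rule that)
qed

lemma summable_inverse_Suc_squares: "summable (\<lambda>k. C * (1 / real (Suc k) ^ 2))"
  using inverse_squares_sums by (intro summable_mult) (auto simp: sums_iff)

lemma Barnes_factor_nonzero:
  assumes "z \<notin> {- of_nat k | k. k \<ge> 1}"
  shows "Barnes_factor k z \<noteq> 0"
proof
  assume "Barnes_factor k z = 0"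
  then have "1 + z / of_nat (Suc k) = 0" by (auto simp: Barnes_factor_def)
  then have "z = - of_nat (Suc k)"
    by (simp add: add_eq_0_iff divide_eq_eq del: of_nat_Suc)
  with assms show False by force
qed

lemma convergent_prod_Barnes_factor: "convergent_prod (\<lambda>k. Barnes_factor k z)"
proof -
  obtain C where "eventually (\<lambda>k. \<forall>z\<in>{z}. norm (Barnes_factor k z - 1) \<le> C * (1 / real (Suc k) ^ 2)) sequentially"
    using eventually_norm_Barnes_factor_le[of "{z}"] by auto
  then have "eventually (\<lambda>k. norm (norm (Barnes_factor k z - 1)) \<le> C * (1 / real (Suc k) ^ 2)) sequentially"
    by eventually_elim simp
  then have "summable (\<lambda>k. norm (Barnes_factor k z - 1))"
    using summable_inverse_Suc_squares by (rule summable_comparison_test_ev)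
  then show ?thesis
    by (intro abs_convergent_prod_imp_convergent_prod summable_imp_abs_convergent_prod)
qed

lemma uniform_limit_Barnes_prod:
  assumes "compact K"
  shows "uniform_limit K (\<lambda>N z. \<Prod>k<N. Barnes_factor k z) (\<lambda>z. \<Prod>k. Barnes_factor k z) sequentially"
proof -
  obtain C where C: "eventually (\<lambda>k. \<forall>z\<in>K. norm (Barnes_factor k z - 1) \<le> C * (1 / real (Suc k) ^ 2)) sequentially"
    using eventually_norm_Barnes_factor_le[OF compact_imp_bounded[OF assms]] by blast
  have "uniformly_convergent_on K (\<lambda>N z. \<Sum>k<N. norm (Barnes_factor k z - 1))"
    by (rule Weierstrass_m_test'_ev[OF _ summable_inverse_Suc_squares[of C]])
      (use C in \<open>eventually_elim, auto\<close>)
  then have "uniformly_convergent_on K (\<lambda>N z. \<Prod>k<N. Barnes_factor k z)"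
    using assms by (intro uniformly_convergent_on_prod') (auto simp: Barnes_factor_def simp del: of_nat_Suc power_Suc intro!: continuous_intros)
  then obtain L where L: "uniform_limit K (\<lambda>N z. \<Prod>k<N. Barnes_factor k z) L sequentially"
    by (auto simp: uniformly_convergent_on_def)
  \<comment> \<open>\<open>prodinf\<close> is reached along the products over k \<le> N, which are
    the present partial products with the index shifted by one.\<close>
  have "L z = (\<Prod>k. Barnes_factor k z)" if "z \<in> K" for z
  proof (rule LIMSEQ_unique)
    have "(\<lambda>N. \<Prod>k\<le>N. Barnes_factor k z) \<longlonglongrightarrow> (\<Prod>k. Barnes_factor k z)"
      by (rule convergent_prod_LIMSEQ[OF convergent_prod_Barnes_factor])
    then show "(\<lambda>N. \<Prod>k<Suc N. Barnes_factor k z) \<longlonglongrightarrow> (\<Prod>k. Barnes_factor k z)"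
      by (simp only: lessThan_Suc_atMost)
    show "(\<lambda>N. \<Prod>k<Suc N. Barnes_factor k z) \<longlonglongrightarrow> L z"
      using tendsto_uniform_limitI[OF L that] by (rule LIMSEQ_Suc)
  qed
  then show ?thesis
    using L by (subst uniform_limit_cong'[where g = "\<lambda>N z. \<Prod>k<N. Barnes_factor k z" and i = L]) auto
qed

lemma Barnes_prod_nonzero:
  assumes "z \<notin> {- of_nat k | k. k \<ge> 1}"
  shows "(\<Prod>k. Barnes_factor k z) \<noteq> 0"
  using convergent_prod_Barnes_factor Barnes_factor_nonzero[OF assms] by (rule prodinf_nonzero)

lemma Barnes_G_1_plus:
  "Barnes_G (1 + z) = of_real (2 * pi) powr (z / 2) *
     exp (- (z + (1 + of_real euler_mascheroni) * z\<^sup>2) / 2) * (\<Prod>k. Barnes_factor k z)"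
  by (simp add: Barnes_G_def Barnes_factor_def)

section \<open>Products and ratios of Gamma values\<close>

definition Gamma_prod :: "nat \<Rightarrow> complex \<Rightarrow> complex" where
  "Gamma_prod N z = (\<Prod>i=1..N. Gamma (of_nat i + z) / Gamma (of_nat i))"

lemma not_neg_int_shift:
  assumes "z \<notin> {- of_nat k | k. k \<ge> (1::nat)}"
  shows "z + 1 \<notin> (\<int>\<^sub>\<le>\<^sub>0 :: complex set)" "\<And>k. z + of_nat (Suc k) \<noteq> 0" "\<And>k. of_nat (Suc k) + z \<notin> (\<int>\<^sub>\<le>\<^sub>0 :: complex set)"
proof -
  have A: "of_nat (Suc k) + z \<notin> (\<int>\<^sub>\<le>\<^sub>0 :: complex set)" for k
  proof
    assume "of_nat (Suc k) + z \<in> \<int>\<^sub>\<le>\<^sub>0"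
    then obtain m where "of_nat (Suc k) + z = - of_nat m" by (auto elim!: nonpos_Ints_cases')
    then have "(of_nat (Suc k) + z) - of_nat (Suc k) = - of_nat (m + Suc k)" by simp
    then have "z = - of_nat (m + Suc k)" by simp
    with assms show False by (metis (mono_tags, lifting) le_add2 le_trans One_nat_def Suc_le_mono le0 mem_Collect_eq)
  qed
  then show "\<And>k. of_nat (Suc k) + z \<notin> (\<int>\<^sub>\<le>\<^sub>0 :: complex set)" .
  from A[of 0] show "z + 1 \<notin> \<int>\<^sub>\<le>\<^sub>0" by (simp add: add.commute)
  from A show "z + of_nat (Suc k) \<noteq> 0" for k by (metis add.commute zero_in_nonpos_Ints)
qed

lemma Gamma_prod_times_prod:
  assumes "z \<notin> {- of_nat k | k. k \<ge> 1}"
  shows "Gamma_prod N z * (\<Prod>k<N. (1 + z / of_nat (Suc k)) ^ Suc k) = (Gamma (z + of_nat N + 1) / fact N) ^ N"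
proof (induction N)
  case (Suc N)
  define g where "g = Gamma (z + of_nat N + 1) / fact N"
  have g: "Gamma (of_nat (Suc N) + z) / Gamma (of_nat (Suc N)) = g"
    using Gamma_fact[of N, where 'a = complex] by (simp add: g_def add_ac)
  have nz: "z + of_nat N + 1 \<noteq> 0" using not_neg_int_shift(2)[OF assms, of N] by (simp add: add_ac)
  have "Gamma (z + of_nat (Suc N) + 1) = (z + of_nat N + 1) * Gamma (z + of_nat N + 1)"
    using Gamma_plus1[OF not_neg_int_shift(3)[OF assms, of N]] by (simp add: add_ac)
  then have g': "Gamma (z + of_nat (Suc N) + 1) / fact (Suc N) = g * (1 + z / of_nat (Suc N))"
    by (simp add: g_def field_simps del: of_nat_Suc) (simp add: algebra_simps)
  have "Gamma_prod (Suc N) z * (\<Prod>k<Suc N. (1 + z / of_nat (Suc k)) ^ Suc k) =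
      (Gamma_prod N z * (\<Prod>k<N. (1 + z / of_nat (Suc k)) ^ Suc k)) * (g * (1 + z / of_nat (Suc N)) ^ Suc N)"
    using g by (simp add: Gamma_prod_def prod.nat_ivl_Suc' mult_ac del: of_nat_Suc power_Suc)
  also have "\<dots> = (g * (1 + z / of_nat (Suc N))) ^ Suc N"
    unfolding Suc.IH g_def[symmetric] by (simp add: power_mult_distrib mult_ac)
  finally show ?case unfolding g' .
qed (simp add: Gamma_prod_def)

definition Gamma_ratio :: "nat \<Rightarrow> complex \<Rightarrow> complex" where
  "Gamma_ratio N z = Gamma (z + of_nat N + 1) / (fact N * exp (z * of_real (ln (real N))))"

text \<open>Euler's limit formula for Gamma (z + 1): \<open>Gamma_series\<close> has a Pochhammer
  symbol with N + 1 factors, one more than Gamma (z + N + 1) / Gamma (z + 1), and a power of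
  \<open>N\<close> one higher than N^z; the quotient N / (z + 1 + N) balances both.\<close>

lemma Gamma_ratio_LIMSEQ:
  assumes "z \<notin> {- of_nat k | k. k \<ge> 1}"
  shows "(\<lambda>N. Gamma_ratio N z) \<longlonglongrightarrow> 1"
proof -
  note nz = not_neg_int_shift[OF assms]
  have G: "Gamma (z + 1) \<noteq> 0" using nz(1) by (simp add: Gamma_eq_zero_iff)
  have "eventually (\<lambda>N. Gamma_ratio N z = Gamma (z + 1) / Gamma_series (z + 1) N * (of_nat N / (z + 1 + of_nat N))) sequentially"
    using eventually_gt_at_top[of 0]
  proof eventually_elim
    case (elim N)
    define p where "p = pochhammer (z + 1) N"
    define E where "E = exp (z * of_real (ln (real N)))"
    define q where "q = z + 1 + of_nat N"
    have "p = Gamma (z + 1 + of_nat N) / Gamma (z + 1)"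
      unfolding p_def using nz(1) by (rule pochhammer_Gamma)
    then have p: "Gamma (z + of_nat N + 1) = Gamma (z + 1) * p"
      using G by (simp add: add_ac)
    have q: "q \<noteq> 0" using nz(2)[of N] by (simp add: q_def add_ac)
    have pn: "p \<noteq> 0"
      using nz(3)[of N] p by (auto simp: Gamma_eq_zero_iff add_ac)
    have "exp ((z + 1) * of_real (ln (real N))) = E * of_nat N"
      using elim by (simp add: E_def distrib_right exp_add exp_of_real)
    then have Gs: "Gamma_series (z + 1) N = fact N * (E * of_nat N) / (p * q)"
      by (simp add: Gamma_series_def pochhammer_Suc p_def q_def)
    have "E \<noteq> 0" by (simp add: E_def)
    then show ?case
      using elim q pn unfolding Gamma_ratio_def E_def[symmetric] q_def[symmetric] p Gs
      by (simp add: field_simps)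
  qed
  moreover have "(\<lambda>N. Gamma (z + 1) / Gamma_series (z + 1) N * (of_nat N / (z + 1 + of_nat N))) \<longlonglongrightarrow>
      Gamma (z + 1) / Gamma (z + 1) * 1"
  proof (intro tendsto_intros Gamma_series_LIMSEQ)
    have "(\<lambda>N. 1 / ((z + 1) / of_nat N + 1)) \<longlonglongrightarrow> 1 / (0 + 1)"
      by (intro tendsto_intros lim_const_over_n) auto
    moreover have "eventually (\<lambda>N. 1 / ((z + 1) / of_nat N + 1) = of_nat N / (z + 1 + of_nat N)) sequentially"
      using eventually_gt_at_top[of 0] by eventually_elim (simp add: field_simps)
    ultimately show "(\<lambda>N. of_nat N / (z + 1 + of_nat N)) \<longlonglongrightarrow> 1"
      using Lim_transform_eventually by fastforce
  qed (use G in auto)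
  ultimately show ?thesis
    using G by (simp add: tendsto_cong)
qed

lemma inverse_of_nat_diff:
  assumes "k > 0"
  shows "1 / of_nat k - 1 / of_nat (Suc k) = 1 / (of_nat k * of_nat (Suc k) :: complex)"
proof -
  have "of_nat k \<noteq> (0 :: complex)" "of_nat (Suc k) \<noteq> (0 :: complex)"
    using assms by (simp_all del: of_nat_Suc)
  from diff_frac_eq[OF this, of 1 1] show ?thesis
    by simp
qed

text \<open>A logarithm of the quotient of \<open>Gamma_ratio_corrected\<close> at \<open>k\<close>
  and at \<open>Suc k\<close>: (1 + 1/k)^z comes from the powers, 1 + z / (k + 1) from the
  functional equation of Gamma, and the last term from the correction, since 1/k - 1/(k + 1) = 1 /
  (k (k + 1)).\<close>

definition log_step :: "nat \<Rightarrow> complex \<Rightarrow> complex" where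
  "log_step k z = z * Ln (1 + 1 / of_nat k) - Ln (1 + z / of_nat (Suc k)) -
     (z\<^sup>2 + z) / 2 / (of_nat k * of_nat (Suc k))"

text \<open>Let x = 1/k and y = 1/(k + 1), so that x - y = x y, and expand both logarithms to second
  order. The linear terms combine to z x y, and (z^2 + z) / 2 is exactly the coefficient that
  cancels what has order 1/k^2. Everything left has order 1/k^3.\<close>

lemma norm_log_step_le:
  assumes "norm z \<le> R" "2 * R \<le> real k" "2 \<le> k"
  shows "norm (log_step k z) \<le> (3 * R + R\<^sup>2 + 2 * R ^ 3) / real k ^ 3"
proof -
  define x :: complex where "x = 1 / of_nat k"
  define y :: complex where "y = 1 / of_nat (Suc k)"
  have R: "R \<ge> 0" using assms(1) norm_ge_zero[of z] by linarith
  have nx: "norm x = 1 / real k" by (simp add: x_def norm_divide)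
  have ny: "norm y \<le> 1 / real k" using assms by (simp add: y_def norm_divide frac_le del: of_nat_Suc)
  have zy1: "norm (z * y) \<le> R * (1 / real k)"
    unfolding norm_mult using assms ny R by (intro mult_mono) auto
  also have "R * (1 / real k) \<le> 1 / 2" using assms by (simp add: field_simps)
  finally have zy2: "norm (z * y) \<le> 1 / 2" .
  define e1 where "e1 = Ln (1 + x) - x + x\<^sup>2 / 2"
  define e2 where "e2 = Ln (1 + z * y) - z * y + (z * y)\<^sup>2 / 2"
  have e1: "norm e1 \<le> 2 * (1 / real k) ^ 3"
    unfolding e1_def using norm_Ln_cubic_le[of x] nx assms by simp
  have e2: "norm e2 \<le> 2 * (R * (1 / real k)) ^ 3"
  proof -
    have "norm e2 \<le> 2 * norm (z * y) ^ 3" unfolding e2_def by (rule norm_Ln_cubic_le[OF zy2])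
    also have "\<dots> \<le> 2 * (R * (1 / real k)) ^ 3" using zy1 by (intro mult_left_mono power_mono) auto
    finally show ?thesis .
  qed
  have xy: "x - y = x * y"
    using inverse_of_nat_diff[of k] assms by (simp add: x_def y_def del: of_nat_Suc)
  \<comment> \<open>Names for z / 2 and z^2 / 2 turn the rearrangement into a polynomial
    identity.\<close>
  define u where "u = z / 2"
  define v where "v = z\<^sup>2 / 2"
  have uv: "(z\<^sup>2 + z) / 2 = v + u" "z * (x\<^sup>2 / 2) = u * (x * x)" "(z * y)\<^sup>2 / 2 = v * (y * y)" "u + u = z"
    by (simp_all add: u_def v_def power2_eq_square add_divide_distrib mult_ac)
  have "log_step k z = z * (e1 + x - x\<^sup>2 / 2) - (e2 + z * y - (z * y)\<^sup>2 / 2) - (z\<^sup>2 + z) / 2 * (x * y)"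
    by (simp add: log_step_def e1_def e2_def x_def y_def)
  also have "\<dots> = z * e1 - e2 + (z * (x - y) - (u + u) * (x * y)) - u * x * (x - y) - v * y * (x - y)"
    unfolding right_diff_distrib[of z] distrib_left[of z] uv(1-3) by (simp add: algebra_simps)
  also have "\<dots> = z * e1 - e2 - z / 2 * x * (x * y) - z\<^sup>2 / 2 * y * (x * y)"
    unfolding xy uv(4) by (simp add: u_def v_def)
  finally have ls: "log_step k z = z * e1 - e2 - z / 2 * x * (x * y) - z\<^sup>2 / 2 * y * (x * y)" .
  have "norm (log_step k z) \<le> norm (z * e1) + norm e2 + norm (z / 2 * x * (x * y)) + norm (z\<^sup>2 / 2 * y * (x * y))"
    unfolding ls using norm_triangle_ineq4[of "z * e1 - e2 - z / 2 * x * (x * y)" "z\<^sup>2 / 2 * y * (x * y)"]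
      norm_triangle_ineq4[of "z * e1 - e2" "z / 2 * x * (x * y)"] norm_triangle_ineq4[of "z * e1" e2]
    by linarith
  also have "\<dots> \<le> R * (2 * (1 / real k) ^ 3) + 2 * (R * (1 / real k)) ^ 3 +
      R / 2 * (1 / real k) * ((1 / real k) * (1 / real k)) + R\<^sup>2 / 2 * (1 / real k) * ((1 / real k) * (1 / real k))"
    unfolding norm_mult norm_divide norm_power using assms R e1 e2 nx ny
    by (intro add_mono mult_mono divide_right_mono power_mono) auto
  also have "\<dots> = (2 * R + R / 2 + R\<^sup>2 / 2 + 2 * R ^ 3) * (1 / real k ^ 3)"
  proof -
    have "R * (2 * i ^ 3) + 2 * (R * i) ^ 3 + R / 2 * i * (i * i) + R\<^sup>2 / 2 * i * (i * i) =
        (2 * R + R / 2 + R\<^sup>2 / 2 + 2 * R ^ 3) * i ^ 3" for i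
      by (simp add: field_simps power2_eq_square power3_eq_cube)
    from this[of "1 / real k"] show ?thesis by (simp only: power_one_over)
  qed
  also have "\<dots> \<le> (3 * R + R\<^sup>2 + 2 * R ^ 3) * (1 / real k ^ 3)"
    using R zero_le_power2[of R] by (intro mult_right_mono) (linarith, simp)
  finally show ?thesis by simp
qed

text \<open>The correction cancels the \<open>1/N\<close> term of \<open>ln (Gamma_ratio N z)\<close>, so that even the \<open>N\<close>-th
  power tends to \<open>1\<close>.\<close>

definition Gamma_ratio_corrected :: "nat \<Rightarrow> complex \<Rightarrow> complex" where
  "Gamma_ratio_corrected N z = Gamma_ratio N z * exp (- ((z\<^sup>2 + z) / 2 / of_nat N))"

text \<open>The functional equation of Gamma, put in terms of exponentials so that no branch of log
  Gamma enters.\<close>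

lemma Gamma_ratio_corrected_step:
  assumes "z \<notin> {- of_nat k | k. k \<ge> 1}" "N > 0"
  shows "Gamma_ratio_corrected N z = Gamma_ratio_corrected (Suc N) z * exp (log_step N z)"
proof -
  note nz = not_neg_int_shift[OF assms(1)]
  have ne: "z + of_nat N + 1 \<noteq> 0" using nz(2)[of N] by (simp add: add_ac)
  have "z + of_nat N + 1 = of_nat (Suc N) + z" by simp
  then have q0: "1 + z / of_nat (Suc N) = (z + of_nat N + 1) / of_nat (Suc N)"
    by (simp only: add_divide_distrib) (simp del: of_nat_Suc)
  have q: "1 + z / of_nat (Suc N) \<noteq> 0"
    unfolding q0 using ne by (simp del: of_nat_Suc)
  have L: "exp (z * Ln (1 + 1 / of_nat N)) = exp (z * of_real (ln (real (Suc N)))) / exp (z * of_real (ln (real N)))"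
  proof -
    have "1 + 1 / complex_of_nat N = of_real (real (Suc N) / real N)"
      using assms(2) by (simp add: field_simps)
    moreover have "Ln (of_real (real (Suc N) / real N)) = of_real (ln (real (Suc N) / real N))"
      using assms(2) by (intro Ln_of_real) simp
    ultimately have "Ln (1 + 1 / complex_of_nat N) = of_real (ln (real (Suc N) / real N))"
      by (simp only:)
    also have "\<dots> = of_real (ln (real (Suc N))) - of_real (ln (real N))"
      using assms(2) by (subst ln_div) auto
    finally have e: "Ln (1 + 1 / complex_of_nat N) = of_real (ln (real (Suc N))) - of_real (ln (real N))" .
    show ?thesis unfolding e right_diff_distrib exp_diff ..
  qed
  define c where "c = (z\<^sup>2 + z) / 2"
  have c: "c / of_nat N = c / of_nat (Suc N) + c / (of_nat N * of_nat (Suc N))"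
    using arg_cong[OF inverse_of_nat_diff[OF assms(2)], of "\<lambda>x. c * x"]
    by (simp add: right_diff_distrib diff_eq_eq add.commute del: of_nat_Suc)
  have G: "Gamma (z + of_nat (Suc N) + 1) = (z + of_nat N + 1) * Gamma (z + of_nat N + 1)"
    using Gamma_plus1[OF nz(3)[of N]] by (simp add: add_ac)
  have "exp (log_step N z) = exp (z * Ln (1 + 1 / of_nat N)) / exp (Ln (1 + z / of_nat (Suc N))) / exp (c / (of_nat N * of_nat (Suc N)))"
    by (simp only: log_step_def c_def exp_diff)
  also have "exp (Ln (1 + z / of_nat (Suc N))) = (z + of_nat N + 1) / of_nat (Suc N)"
    using exp_Ln[OF q] unfolding q0 .
  finally have s: "exp (log_step N z) = exp (z * of_real (ln (real (Suc N)))) / exp (z * of_real (ln (real N))) /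
      ((z + of_nat N + 1) / of_nat (Suc N)) / exp (c / (of_nat N * of_nat (Suc N)))"
    unfolding L .
  have e: "exp (- (c / of_nat N)) = exp (- (c / of_nat (Suc N))) / exp (c / (of_nat N * of_nat (Suc N)))"
    by (subst c) (simp only: minus_add_distrib exp_add exp_minus divide_inverse)
  have r: "Gamma_ratio (Suc N) z * (exp (z * of_real (ln (real (Suc N)))) / exp (z * of_real (ln (real N))) /
      ((z + of_nat N + 1) / of_nat (Suc N))) = Gamma_ratio N z"
  proof -
    have alg: "q * g / (m * f * A) * (A / B / (q / m)) = g / (f * B)"
      if "q \<noteq> 0" "m \<noteq> 0" "f \<noteq> 0" "A \<noteq> 0" "B \<noteq> 0" for q g m f A B :: complex
      using that by (simp add: field_simps)
    have "complex_of_nat (Suc N) \<noteq> 0" by (simp del: of_nat_Suc)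
    with ne show ?thesis
      unfolding Gamma_ratio_def G fact_Suc by (intro alg) (simp_all del: of_nat_Suc)
  qed
  show ?thesis
    unfolding Gamma_ratio_corrected_def c_def[symmetric] e s r[symmetric] by simp
qed

text \<open>Comparison with the telescoping differences 2 / k^2 - 2 / (k + 1)^2. A tail of order
  N^-2 is small enough to tend to 0 even after multiplication by \<open>N\<close>.\<close>

lemma sum_inverse_cubes_le:
  assumes "N > 0" "N \<le> M"
  shows "(\<Sum>k=N..<M. 1 / real k ^ 3) \<le> 2 / real N ^ 2"
proof -
  have "(\<Sum>k=N..<M. 1 / real k ^ 3) \<le> (\<Sum>k=N..<M. 2 / real k ^ 2 - 2 / real (Suc k) ^ 2)"
  proof (rule sum_mono)
    fix k assume "k \<in> {N..<M}"
    then have k: "real k \<ge> 1" using assms by auto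
    define x where "x = real k"
    have x: "x \<ge> 1" using k by (simp add: x_def)
    have "(x + 1)\<^sup>2 \<le> 2 * x * (2 * x + 1)"
      using mult_mono[OF x x] x by (simp add: power2_eq_square algebra_simps)
    then have "1 / x ^ 3 \<le> 2 * (2 * x + 1) / (x\<^sup>2 * (x + 1)\<^sup>2)"
      using x by (simp add: divide_simps power2_eq_square power3_eq_cube) (simp add: algebra_simps)
    also have "\<dots> = 2 / x\<^sup>2 - 2 / (x + 1)\<^sup>2"
      using x by (simp add: divide_simps) (simp add: power2_eq_square algebra_simps)
    finally show "1 / real k ^ 3 \<le> 2 / real k ^ 2 - 2 / real (Suc k) ^ 2"
      by (simp add: x_def add.commute)
  qed
  also have "\<dots> = 2 / real N ^ 2 - 2 / real M ^ 2"
    using sum_Suc_diff'[of N M "\<lambda>k. - (2 / real k ^ 2)"] assms by simp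
  also have "\<dots> \<le> 2 / real N ^ 2" by simp
  finally show ?thesis .
qed

text \<open>Telescoping expresses the ratio at \<open>N\<close> by the one at \<open>M\<close> times
  the exponential of a sum of \<open>log_step\<close> terms; this sum is O(N^-2) with a constant
  depending on \<open>R\<close> alone, and the N-th power multiplies it by \<open>N\<close>. Letting
  \<open>M\<close> tend to infinity takes only the pointwise limit 1, while the resulting bound is
  uniform in \<open>z\<close>.\<close>

lemma norm_Gamma_ratio_corrected_power_le:
  assumes z: "z \<notin> {- of_nat k | k. k \<ge> 1}" "norm z \<le> R" and N: "2 * R \<le> real N" "2 \<le> N"
  defines "C \<equiv> 2 * (3 * R + R\<^sup>2 + 2 * R ^ 3)"
  shows "norm (Gamma_ratio_corrected N z ^ N - 1) \<le> C / real N * exp C"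
proof -
  have R: "R \<ge> 0" using z(2) norm_ge_zero[of z] by linarith
  have C: "C \<ge> 0" using R by (simp add: C_def)
  have tele: "Gamma_ratio_corrected N z = Gamma_ratio_corrected M z * exp (\<Sum>k=N..<M. log_step k z)" if "N \<le> M" for M
    using that
  proof (induction M rule: dec_induct)
    case (step M)
    then show ?case
      using Gamma_ratio_corrected_step[OF z(1), of M] N by (simp add: sum.atLeastLessThan_Suc exp_add mult_ac)
  qed simp
  have bd: "norm (exp (of_nat N * (\<Sum>k=N..<M. log_step k z)) - 1) \<le> C / real N * exp C" if "N \<le> M" for M
  proof -
    have "norm (\<Sum>k=N..<M. log_step k z) \<le> (\<Sum>k=N..<M. (3 * R + R\<^sup>2 + 2 * R ^ 3) * (1 / real k ^ 3))"
      using z(2) N by (intro sum_norm_le) (auto intro!: order_trans[OF norm_log_step_le])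
    also have "\<dots> = (3 * R + R\<^sup>2 + 2 * R ^ 3) * (\<Sum>k=N..<M. 1 / real k ^ 3)"
      by (simp only: sum_distrib_left)
    also have "\<dots> \<le> (3 * R + R\<^sup>2 + 2 * R ^ 3) * (2 / real N ^ 2)"
      using R N that by (intro mult_left_mono sum_inverse_cubes_le) auto
    finally have "norm (of_nat N * (\<Sum>k=N..<M. log_step k z)) \<le> real N * ((3 * R + R\<^sup>2 + 2 * R ^ 3) * (2 / real N ^ 2))"
      unfolding norm_mult norm_of_nat by (intro mult_left_mono) auto
    also have "\<dots> = C / real N"
      using N by (simp add: C_def power2_eq_square)
    finally have 1: "norm (of_nat N * (\<Sum>k=N..<M. log_step k z)) \<le> C / real N" .
    also have "C / real N \<le> C / 1"
      using C N by (intro divide_left_mono) auto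
    finally have 2: "norm (of_nat N * (\<Sum>k=N..<M. log_step k z)) \<le> C" by simp
    show ?thesis
      by (rule order_trans[OF norm_exp_minus_1_le]) (use 1 2 C in \<open>intro mult_mono; simp\<close>)
  qed
  have lim: "(\<lambda>M. Gamma_ratio_corrected M z) \<longlonglongrightarrow> 1"
  proof -
    have "(\<lambda>M. Gamma_ratio M z * exp (- ((z\<^sup>2 + z) / 2 / of_nat M))) \<longlonglongrightarrow> 1 * exp (- 0)"
      by (intro tendsto_intros Gamma_ratio_LIMSEQ[OF z(1)] lim_const_over_n)
    then show ?thesis by (simp add: Gamma_ratio_corrected_def)
  qed
  have "(\<lambda>M. norm (Gamma_ratio_corrected N z ^ N - Gamma_ratio_corrected M z ^ N)) \<longlonglongrightarrow> norm (Gamma_ratio_corrected N z ^ N - 1 ^ N)"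
    by (intro tendsto_intros lim)
  moreover have "(\<lambda>M. norm (Gamma_ratio_corrected M z ^ N) * (C / real N * exp C)) \<longlonglongrightarrow> norm ((1::complex) ^ N) * (C / real N * exp C)"
    by (intro tendsto_intros lim)
  moreover have "eventually (\<lambda>M. norm (Gamma_ratio_corrected N z ^ N - Gamma_ratio_corrected M z ^ N) \<le>
      norm (Gamma_ratio_corrected M z ^ N) * (C / real N * exp C)) sequentially"
    using eventually_ge_at_top[of N]
  proof eventually_elim
    case (elim M)
    have "Gamma_ratio_corrected N z ^ N - Gamma_ratio_corrected M z ^ N =
        Gamma_ratio_corrected M z ^ N * (exp (of_nat N * (\<Sum>k=N..<M. log_step k z)) - 1)"
      by (subst tele[OF elim]) (simp add: power_mult_distrib exp_of_nat_mult right_diff_distrib)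
    then show ?case
      by (simp only: norm_mult) (rule mult_left_mono[OF bd[OF elim]], simp)
  qed
  ultimately show ?thesis
    by (auto dest: tendsto_le[OF sequentially_bot, rotated 2])
qed

text \<open>\<open>Gamma_prod N z\<close> grows like exp (N z ln N + z^2 / 2 ln N - N z): the first
  term comes from the N-th power of N^z, the other two from the exponentials in the Barnes
  product.\<close>

definition Gamma_prod_normalized :: "nat \<Rightarrow> complex \<Rightarrow> complex" where
  "Gamma_prod_normalized N z = Gamma_prod N z *
     exp (of_nat N * z - of_nat N * z * of_real (ln (real N)) - z\<^sup>2 / 2 * of_real (ln (real N)))"

text \<open>The numerator cancels the power of 2 pi contained in \<open>Barnes_G (1 + z)\<close>;
  what remains is an exponential over the infinite product.\<close>

definition Gamma_prod_limit :: "complex \<Rightarrow> complex" where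
  "Gamma_prod_limit z = of_real (2 * pi) powr (z / 2) / Barnes_G (1 + z)"

text \<open>The closed form of \<open>Gamma_prod_times_prod\<close>, rewritten with Barnes factors.
  Undoing the correction in the N-th power gives exp ((z^2 + z) / 2), and the exponents z^2 / (2 k)
  sum to z^2 / 2 times a harmonic number, whose difference from ln N later produces the Euler
  constant.\<close>

lemma Gamma_prod_normalized_eq:
  assumes z: "z \<notin> {- of_nat k | k. k \<ge> 1}" and N: "N > 0"
  shows "Gamma_prod_normalized N z = Gamma_ratio_corrected N z ^ N *
    exp ((z\<^sup>2 + z) / 2 + z\<^sup>2 / 2 * of_real (harm N - ln (real N))) / (\<Prod>k<N. Barnes_factor k z)"
proof -
  define P where "P = (\<Prod>k<N. (1 + z / of_nat (Suc k)) ^ Suc k)"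
  define l where "l = complex_of_real (ln (real N))"
  have "(\<Prod>k<N. Barnes_factor k z) = P * exp (\<Sum>k<N. z\<^sup>2 / (2 * of_nat (Suc k)) - z)"
    by (simp only: Barnes_factor_def P_def prod.distrib exp_sum finite_lessThan)
  also have "(\<Sum>k<N. z\<^sup>2 / (2 * of_nat (Suc k)) - z) = z\<^sup>2 / 2 * of_real (harm N) - of_nat N * z"
  proof -
    have "complex_of_real (harm N) = (\<Sum>k<N. 1 / of_nat (Suc k))"
      by (simp add: harm_def sum.atLeast1_atMost_eq divide_inverse del: of_nat_Suc)
    then show ?thesis
      by (simp add: sum_subtractf sum_distrib_left del: of_nat_Suc)
  qed
  finally have B: "(\<Prod>k<N. Barnes_factor k z) = P * exp (z\<^sup>2 / 2 * of_real (harm N) - of_nat N * z)" .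
  have Bnz: "(\<Prod>k<N. Barnes_factor k z) \<noteq> 0"
    using Barnes_factor_nonzero[OF z] by simp
  then have Pnz: "P \<noteq> 0" unfolding B by simp
  have "Gamma_prod N z * P = (Gamma_ratio N z * exp (z * l)) ^ N"
    using Gamma_prod_times_prod[OF z, of N] by (simp add: P_def Gamma_ratio_def l_def)
  also have "\<dots> = Gamma_ratio N z ^ N * exp (of_nat N * (z * l))"
    by (simp add: power_mult_distrib exp_of_nat_mult)
  also have "Gamma_ratio N z = Gamma_ratio_corrected N z * exp ((z\<^sup>2 + z) / 2 / of_nat N)"
    by (simp add: Gamma_ratio_corrected_def exp_minus)
  also have "\<dots> ^ N = Gamma_ratio_corrected N z ^ N * exp ((z\<^sup>2 + z) / 2)"
    using N by (simp add: power_mult_distrib exp_of_nat_mult[symmetric])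
  finally have GP: "Gamma_prod N z * P = Gamma_ratio_corrected N z ^ N * exp ((z\<^sup>2 + z) / 2) * exp (of_nat N * (z * l))" .
  have "Gamma_prod_normalized N z * (\<Prod>k<N. Barnes_factor k z) =
    (Gamma_prod N z * P) * (exp (of_nat N * z - of_nat N * z * l - z\<^sup>2 / 2 * l) * exp (z\<^sup>2 / 2 * of_real (harm N) - of_nat N * z))"
    by (simp add: Gamma_prod_normalized_def B l_def)
  also have "\<dots> = Gamma_ratio_corrected N z ^ N * (exp ((z\<^sup>2 + z) / 2) * exp (of_nat N * (z * l)) *
      (exp (of_nat N * z - of_nat N * z * l - z\<^sup>2 / 2 * l) * exp (z\<^sup>2 / 2 * of_real (harm N) - of_nat N * z)))"
    by (simp add: GP)
  also have "exp ((z\<^sup>2 + z) / 2) * exp (of_nat N * (z * l)) *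
      (exp (of_nat N * z - of_nat N * z * l - z\<^sup>2 / 2 * l) * exp (z\<^sup>2 / 2 * of_real (harm N) - of_nat N * z)) =
      exp ((z\<^sup>2 + z) / 2 + z\<^sup>2 / 2 * of_real (harm N - ln (real N)))"
    unfolding exp_add[symmetric] by (rule arg_cong[where f = exp]) (simp add: l_def field_simps)
  finally show ?thesis using Bnz by (simp add: field_simps)
qed

lemma Gamma_prod_limit_eq:
  assumes "z \<notin> {- of_nat k | k. k \<ge> 1}"
  shows "Gamma_prod_limit z = exp ((z\<^sup>2 + z) / 2 + z\<^sup>2 / 2 * of_real euler_mascheroni) / (\<Prod>k. Barnes_factor k z)"
proof -
  have "(z + (1 + of_real euler_mascheroni) * z\<^sup>2) / 2 = (z\<^sup>2 + z) / 2 + z\<^sup>2 / 2 * of_real euler_mascheroni"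
    by (simp add: field_simps)
  then have e: "exp (- (z + (1 + of_real euler_mascheroni) * z\<^sup>2) / 2) =
      inverse (exp ((z\<^sup>2 + z) / 2 + z\<^sup>2 / 2 * of_real euler_mascheroni))"
    by (metis exp_minus minus_divide_left)
  have "complex_of_real (2 * pi) powr (z / 2) \<noteq> 0" by simp
  then show ?thesis
    unfolding Gamma_prod_limit_def Barnes_G_1_plus e by (simp add: field_simps)
qed

text \<open>A continuous function without zeros is bounded away from 0 on a compact set; the
  quotient of uniform limits requires such a bound.\<close>

lemma bounded_below_Barnes_prod:
  assumes K: "compact K" "K \<inter> {- of_nat k | k. k \<ge> 1} = {}"
  obtains b where "b > 0" "\<And>z. z \<in> K \<Longrightarrow> b \<le> norm (\<Prod>k. Barnes_factor k z)"
proof (cases "K = {}")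
  case False
  have "continuous_on K (\<lambda>z. \<Prod>k. Barnes_factor k z)"
    by (rule uniform_limit_theorem[OF _ uniform_limit_Barnes_prod[OF K(1)]])
      (auto simp: Barnes_factor_def simp del: of_nat_Suc power_Suc intro!: always_eventually continuous_intros)
  then have "continuous_on K (\<lambda>z. norm (\<Prod>k. Barnes_factor k z))"
    by (rule continuous_on_norm)
  then obtain x where x: "x \<in> K" "\<And>z. z \<in> K \<Longrightarrow> norm (\<Prod>k. Barnes_factor k x) \<le> norm (\<Prod>k. Barnes_factor k z)"
    using continuous_attains_inf[OF K(1) False] by blast
  have "norm (\<Prod>k. Barnes_factor k x) > 0"
    using Barnes_prod_nonzero[of x] x(1) K(2) by auto
  with x(2) show thesis by (intro that) auto
qed (use that[of 1] in auto)

lemma uniform_limit_Gamma_prod_normalized: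
  assumes K: "compact K" "K \<inter> {- of_nat k | k. k \<ge> 1} = {}"
  shows "uniform_limit K Gamma_prod_normalized Gamma_prod_limit sequentially"
proof -
  have ni: "z \<notin> {- of_nat k | k. k \<ge> 1}" if "z \<in> K" for z using that K(2) by auto
  obtain R where R: "\<And>z. z \<in> K \<Longrightarrow> norm z \<le> R"
    using compact_imp_bounded[OF K(1)] by (auto simp: bounded_iff)
  define C where "C = 2 * (3 * R + R\<^sup>2 + 2 * R ^ 3)"
  have evR: "eventually (\<lambda>N. 2 * R \<le> real N) sequentially"
    using eventually_ge_at_top[of "nat \<lceil>2 * R\<rceil>"] by eventually_elim linarith
  have U1: "uniform_limit K (\<lambda>N z. Gamma_ratio_corrected N z ^ N) (\<lambda>_. 1) sequentially"
  proof (rule uniform_limit_of_bound)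
    show "eventually (\<lambda>N. \<forall>z\<in>K. norm (Gamma_ratio_corrected N z ^ N - 1) \<le> C / real N * exp C) sequentially"
      using evR eventually_ge_at_top[of 2]
    proof eventually_elim
      case (elim N)
      then show ?case unfolding C_def by (intro ballI norm_Gamma_ratio_corrected_power_le ni R)
    qed
    show "(\<lambda>N. C / real N * exp C) \<longlonglongrightarrow> 0"
      by real_asymp
  qed
  define h where "h = (\<lambda>N. complex_of_real (harm N - ln (real N)))"
  have h: "h \<longlonglongrightarrow> of_real euler_mascheroni"
    unfolding h_def by (intro tendsto_of_real euler_mascheroni_LIMSEQ)
  have U2: "uniform_limit K (\<lambda>N z. exp ((z\<^sup>2 + z) / 2 + z\<^sup>2 / 2 * h N))
      (\<lambda>z. exp ((z\<^sup>2 + z) / 2 + z\<^sup>2 / 2 * of_real euler_mascheroni)) sequentially"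
  proof (intro uniform_limit_exp uniform_limit_add uniform_limit_const uniform_lim_mult
      uniform_limit_sequence_const[OF h])
    show "bounded ((\<lambda>z. z\<^sup>2 / 2) ` K)"
      "bounded ((\<lambda>z. (z\<^sup>2 + z) / 2 + z\<^sup>2 / 2 * complex_of_real euler_mascheroni) ` K)"
      by (intro compact_imp_bounded compact_continuous_image K(1) continuous_intros; simp)+
  qed (auto simp: bounded_iff)
  have bdd: "bounded ((\<lambda>z. exp ((z\<^sup>2 + z) / 2 + z\<^sup>2 / 2 * complex_of_real euler_mascheroni)) ` K)"
    by (intro compact_imp_bounded compact_continuous_image K(1) continuous_intros) auto
  have U3: "uniform_limit K (\<lambda>N z. Gamma_ratio_corrected N z ^ N * exp ((z\<^sup>2 + z) / 2 + z\<^sup>2 / 2 * h N))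
      (\<lambda>z. 1 * exp ((z\<^sup>2 + z) / 2 + z\<^sup>2 / 2 * of_real euler_mascheroni)) sequentially"
    by (intro uniform_lim_mult U1 U2 bdd) (auto simp: bounded_iff)
  obtain b where b: "b > 0" "\<And>z. z \<in> K \<Longrightarrow> b \<le> norm (\<Prod>k. Barnes_factor k z)"
    using bounded_below_Barnes_prod[OF K] by blast
  have "uniform_limit K (\<lambda>N z. Gamma_ratio_corrected N z ^ N * exp ((z\<^sup>2 + z) / 2 + z\<^sup>2 / 2 * h N) / (\<Prod>k<N. Barnes_factor k z))
      (\<lambda>z. 1 * exp ((z\<^sup>2 + z) / 2 + z\<^sup>2 / 2 * of_real euler_mascheroni) / (\<Prod>k. Barnes_factor k z)) sequentially"
    by (rule uniform_lim_divide[OF U3 uniform_limit_Barnes_prod[OF K(1)] _ b(2,1)]) (use bdd in simp_all)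
  moreover have "eventually (\<lambda>N. \<forall>z\<in>K. Gamma_prod_normalized N z =
      Gamma_ratio_corrected N z ^ N * exp ((z\<^sup>2 + z) / 2 + z\<^sup>2 / 2 * h N) / (\<Prod>k<N. Barnes_factor k z)) sequentially"
    using eventually_gt_at_top[of 0] by eventually_elim (use ni in \<open>simp add: Gamma_prod_normalized_eq h_def\<close>)
  ultimately show ?thesis
    by (subst uniform_limit_cong) (use ni in \<open>auto simp: Gamma_prod_limit_eq\<close>)
qed

section \<open>Mod-Gaussian convergence\<close>

lemma infinitely_divisible_std_normal: "infinitely_divisible std_normal_distribution"
  unfolding infinitely_divisible_def
proof (intro conjI allI impI)
  show "real_distribution std_normal_distribution" by (rule real_dist_normal_dist)
  fix n :: nat assume n: "1 \<le> n"
  \<comment> \<open>The n-th convolution root of the standard normal law is the centred normal law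
    of variance 1 / n.\<close>
  define \<sigma> where "\<sigma> = 1 / sqrt (real n)"
  define \<nu> where "\<nu> = density lborel (\<lambda>x. ennreal (normal_density 0 \<sigma> x))"
  have \<sigma>: "\<sigma> > 0" using n by (simp add: \<sigma>_def)
  have \<nu>: "prob_space \<nu>" unfolding \<nu>_def by (rule prob_space_normal_density[OF \<sigma>])
  let ?P = "\<Pi>\<^sub>M i\<in>{..<n}. \<nu>"
  interpret P: prob_space ?P by (intro prob_space_PiM \<nu>)
  have sets_\<nu>: "sets \<nu> = sets borel" by (simp add: \<nu>_def)
  have comp: "distr ?P borel (\<lambda>x. x i) = \<nu>" if "i < n" for i
  proof -
    have "distr ?P borel (\<lambda>x. x i) = distr ?P \<nu> (\<lambda>x. x i)"
      by (rule distr_cong) (auto simp: sets_\<nu>)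
    also have "\<dots> = \<nu>" using that by (intro distr_PiM_component \<nu>) auto
    finally show ?thesis .
  qed
  have meas: "(\<lambda>x. x i) \<in> borel_measurable ?P" if "i < n" for i
    using measurable_component_singleton[of i "{..<n}" "\<lambda>_. \<nu>"] that
    by (simp cong: measurable_cong_sets add: sets_\<nu>)
  have "distr ?P (\<Pi>\<^sub>M i\<in>{..<n}. borel) (\<lambda>x. \<lambda>i\<in>{..<n}. x i) = distr ?P ?P (\<lambda>x. x)"
    by (rule distr_cong) (auto simp: space_PiM PiE_def extensional_restrict sets_\<nu> intro!: sets_PiM_cong)
  also have "\<dots> = ?P" by simp
  also have "\<dots> = (\<Pi>\<^sub>M i\<in>{..<n}. distr ?P borel (\<lambda>x. x i))"
    by (intro PiM_cong) (auto simp: comp)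
  finally have ind: "P.indep_vars (\<lambda>_. borel) (\<lambda>i x. x i) {..<n}"
    using n by (subst P.indep_vars_iff_distr_eq_PiM') (auto simp: lessThan_empty_iff intro: meas)
  have "distributed ?P lborel (\<lambda>x. x i) (\<lambda>x. ennreal (normal_density 0 \<sigma> x))" if "i \<in> {..<n}" for i
  proof -
    have "distr ?P lborel (\<lambda>x. x i) = distr ?P borel (\<lambda>x. x i)"
      by (rule distr_cong) auto
    then show ?thesis
      using that meas comp[of i] by (auto simp: distributed_def \<nu>_def)
  qed
  then have "distributed ?P lborel (\<lambda>x. \<Sum>i<n. x i)
      (\<lambda>x. ennreal (normal_density (\<Sum>i<n. 0) (sqrt (\<Sum>i<n. \<sigma>\<^sup>2)) x))"
    using n \<sigma> ind by (intro P.sum_indep_normal) (auto simp: lessThan_empty_iff)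
  moreover have "sqrt (\<Sum>i<n. \<sigma>\<^sup>2) = 1"
    using n by (simp add: \<sigma>_def power_divide)
  ultimately have "distr ?P lborel (\<lambda>x. \<Sum>i<n. x i) = std_normal_distribution"
    by (simp add: distributed_def)
  moreover have "distr ?P lborel (\<lambda>x. \<Sum>i<n. x i) = distr ?P borel (\<lambda>x. \<Sum>i<n. x i)"
    by (rule distr_cong) auto
  moreover have "real_distribution \<nu>"
    using \<nu> by (simp add: real_distribution_def real_distribution_axioms_def sets_\<nu>)
  ultimately show "\<exists>\<nu>. real_distribution \<nu> \<and>
      std_normal_distribution = distr (\<Pi>\<^sub>M i\<in>{..<n}. \<nu>) borel (\<lambda>x. \<Sum>i<n. x i)"
    by (intro exI[of _ \<nu>]) simp
qed

text \<open>Write t = a + i b. By completing the square, the shift x = a + y absorbs the real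
  exponential into the Gaussian weight and leaves the constant \<open>c\<close> times the
  characteristic function at \<open>b\<close>.\<close>

lemma
  shows std_normal_exp_integrable: "integrable std_normal_distribution (\<lambda>x. exp (t * complex_of_real x))"
    and std_normal_exp_integral: "(LINT x|std_normal_distribution. exp (t * complex_of_real x)) = exp (t\<^sup>2 / 2)"
proof -
  define a where "a = Re t"
  define b where "b = Im t"
  define c where "c = exp (of_real (a\<^sup>2 / 2) + \<i> * of_real (b * a))"
  have t: "t = of_real a + \<i> * of_real b" by (simp add: a_def b_def complex_eq)
  let ?f = "\<lambda>x. std_normal_density x *\<^sub>R exp (t * complex_of_real x)"
  let ?g = "\<lambda>x. std_normal_density x *\<^sub>R iexp (b * x)"
  interpret real_distribution std_normal_distribution by (rule real_dist_normal_dist)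
  have shift: "?f (a + 1 * y) = c * ?g y" for y
  proof -
    have "exp (- (a + y)\<^sup>2 / 2) = exp (- y\<^sup>2 / 2) * exp (- (a\<^sup>2 + 2 * a * y) / 2)"
      unfolding exp_add[symmetric] by (rule arg_cong[where f = exp]) (simp add: field_simps power2_eq_square)
    then have "std_normal_density (a + y) = std_normal_density y * exp (- (a\<^sup>2 + 2 * a * y) / 2)"
      by (simp add: normal_density_def)
    then have "complex_of_real (std_normal_density (a + y)) =
        of_real (std_normal_density y) * exp (of_real (- (a\<^sup>2 + 2 * a * y) / 2))"
      by (simp only: of_real_mult exp_of_real)
    then have "?f (a + 1 * y) = of_real (std_normal_density y) *
        (exp (of_real (- (a\<^sup>2 + 2 * a * y) / 2)) * exp (t * of_real (a + y)))"
      by (simp add: scaleR_conv_of_real)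
    also have "exp (of_real (- (a\<^sup>2 + 2 * a * y) / 2)) * exp (t * of_real (a + y)) = c * iexp (b * y)"
      unfolding c_def exp_add[symmetric] t
      by (rule arg_cong[where f = exp]) (simp add: field_simps power2_eq_square)
    finally show ?thesis by (simp add: scaleR_conv_of_real)
  qed
  have int_iexp: "integrable std_normal_distribution (\<lambda>x. iexp (b * x))"
    by (intro integrable_const_bound[where B = 1]) auto
  then have g: "integrable lborel ?g"
    by (subst (asm) integrable_density) auto
  have char: "(LBINT x. ?g x) = exp (- (of_real b)\<^sup>2 / 2)"
  proof -
    have "char std_normal_distribution b = (LBINT x. ?g x)"
      unfolding char_def by (subst integral_density) auto
    moreover have "exp (- (complex_of_real b)\<^sup>2 / 2) = of_real (exp (- b\<^sup>2 / 2))"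
      by (simp flip: exp_of_real)
    ultimately show ?thesis by (simp only: char_std_normal_distribution)
  qed
  have "integrable lborel ?f"
    using lborel_integrable_real_affine_iff[of 1 ?f a] integrable_mult_right[of c lborel ?g] g
    unfolding shift by (metis zero_neq_one)
  then show "integrable std_normal_distribution (\<lambda>x. exp (t * complex_of_real x))"
    by (subst integrable_density) auto
  have "(LINT x|std_normal_distribution. exp (t * complex_of_real x)) = (LBINT x. ?f x)"
    by (subst integral_density) auto
  also have "\<dots> = c * (LBINT x. ?g x)"
    using lborel_integral_real_affine[of 1 ?f a] unfolding shift
    by (simp only: abs_one scaleR_one integral_mult_right_zero)
  also have "\<dots> = exp (t\<^sup>2 / 2)"
    unfolding char c_def exp_add[symmetric] t
    by (rule arg_cong[where f = exp]) (simp add: field_simps power2_eq_square)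
  finally show "(LINT x|std_normal_distribution. exp (t * complex_of_real x)) = exp (t\<^sup>2 / 2)" .
qed

section \<open>Even and odd degrees of freedom\<close>

lemma Gamma_prod_Suc: "Gamma_prod (Suc N) z = Gamma_prod N z * (Gamma (of_nat (Suc N) + z) / Gamma (of_nat (Suc N)))"
  by (simp add: Gamma_prod_def prod.nat_ivl_Suc')

lemma minus_half_not_neg_int: "(- 1 / 2 :: complex) \<notin> {- of_nat k | k. k \<ge> 1}"
proof
  assume "(- 1 / 2 :: complex) \<in> {- of_nat k | k. k \<ge> 1}"
  then obtain k :: nat where k: "(- 1 / 2 :: complex) = - of_nat k" "k \<ge> 1" by blast
  then have "Re (- 1 / 2) = Re (- complex_of_nat k)" by (simp only:)
  then have "real k = 1 / 2" by simp
  moreover have "real k \<ge> 1" using k(2) by simp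
  ultimately show False by simp
qed

text \<open>For j = 2 i the argument (j + t) / 2 is i + t / 2, and for j = 2 i - 1 it is i + (t - 1)
  / 2; up to \<open>n\<close> there are \<open>n div 2\<close> even and \<open>Suc n div 2\<close>
  odd indices. For odd j the denominators are Gamma (i - 1/2) instead of the Gamma (i) in
  \<open>Gamma_prod\<close>, and dividing by the value at -1/2 exchanges them.\<close>

lemma prod_half_Gamma:
  "(\<Prod>j=1..n. Gamma ((of_nat j + t) / 2) / Gamma (of_nat j / 2)) =
   Gamma_prod (n div 2) (t / 2) * (Gamma_prod (Suc n div 2) (t / 2 - 1 / 2) / Gamma_prod (Suc n div 2) (- 1 / 2))"
proof (induction n)
  case (Suc n)
  show ?case
  proof (cases "even n")
    case True
    then obtain m where m: "n = 2 * m" by (auto elim: evenE)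
    have a: "(complex_of_nat (Suc n) + t) / 2 = of_nat (Suc m) + (t / 2 - 1 / 2)"
      "complex_of_nat (Suc n) / 2 = of_nat (Suc m) + (- 1 / 2)"
      by (simp_all add: m field_simps)
    have "of_nat (Suc m) \<notin> (\<int>\<^sub>\<le>\<^sub>0 :: complex set)" by (rule Re_pos_not_nonpos_Ints) simp
    then have "Gamma (of_nat (Suc m) :: complex) \<noteq> 0" by (simp add: Gamma_eq_zero_iff)
    moreover have "Suc n div 2 = m" "Suc (Suc n) div 2 = Suc m" "n div 2 = m" by (simp_all add: m)
    ultimately show ?thesis
      using Suc.IH by (simp add: prod.nat_ivl_Suc' a Gamma_prod_Suc del: of_nat_Suc)
  next
    case False
    then obtain m where m: "n = 2 * m + 1" by (auto elim: oddE)
    have a: "(complex_of_nat (Suc n) + t) / 2 = of_nat (Suc m) + t / 2"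
      "complex_of_nat (Suc n) / 2 = of_nat (Suc m)"
      by (simp_all add: m field_simps)
    have "Suc n div 2 = Suc m" "Suc (Suc n) div 2 = Suc m" "n div 2 = m" by (simp_all add: m)
    then show ?thesis
      using Suc.IH by (simp add: prod.nat_ivl_Suc' a Gamma_prod_Suc mult_ac del: of_nat_Suc)
  qed
qed (simp add: Gamma_prod_def)

section \<open>Elementary growth rates\<close>

lemma Gamma_prod_eq_normalized:
  "Gamma_prod N z = Gamma_prod_normalized N z *
     exp (of_nat N * z * of_real (ln (real N)) + z\<^sup>2 / 2 * of_real (ln (real N)) - of_nat N * z)"
  unfolding Gamma_prod_normalized_def mult.assoc exp_add[symmetric] by simp

lemma tendsto_even_odd:
  fixes f :: "nat \<Rightarrow> 'a::topological_space"
  assumes "(\<lambda>m. f (2 * m)) \<longlonglongrightarrow> l" "(\<lambda>m. f (2 * m + 1)) \<longlonglongrightarrow> l"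
  shows "f \<longlonglongrightarrow> l"
proof (rule topological_tendstoI)
  fix S assume S: "open S" "l \<in> S"
  then obtain a b where ab: "\<And>m. m \<ge> a \<Longrightarrow> f (2 * m) \<in> S" "\<And>m. m \<ge> b \<Longrightarrow> f (2 * m + 1) \<in> S"
    using assms[THEN topological_tendstoD, OF S] by (auto simp: eventually_sequentially)
  have "f n \<in> S" if "n \<ge> 2 * (a + b) + 2" for n
  proof (cases "even n")
    case True
    then obtain m where m: "n = 2 * m" by (auto elim: evenE)
    with that have "m \<ge> a" by simp
    with ab(1) m show ?thesis by simp
  next
    case False
    then obtain m where m: "n = 2 * m + 1" by (auto elim: oddE)
    with that have "m \<ge> b" by simp
    with ab(2) m show ?thesis by simp
  qed
  then show "eventually (\<lambda>n. f n \<in> S) sequentially"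
    by (auto simp: eventually_sequentially)
qed

text \<open>The coefficient of s = t / 2 in the exponent once all elementary factors are collected:
  ln (n + 1) from the factor sqrt (n + 1), n ln 2 from the \<chi> moments, then the centring and the
  growth of \<open>Gamma_prod\<close> for even and odd indices. The final term comes from expanding
  (s - 1/2)^2.\<close>

definition linear_rate :: "nat \<Rightarrow> real" where
  "linear_rate n = ln (real n + 1) + real n * ln 2 - 2 * centering n - real n
     + real (n div 2) * ln (real (n div 2)) + real (Suc n div 2) * ln (real (Suc n div 2))
     - ln (real (Suc n div 2)) / 2"

text \<open>The coefficient of s^2 in the same exponent, with the Gaussian factor exp (t^2 / 4 ln (n
  / 2)) divided out.\<close>

definition quadratic_rate :: "nat \<Rightarrow> real" where
  "quadratic_rate n = (ln (real (n div 2)) + ln (real (Suc n div 2))) / 2 - ln (real n / 2)"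

lemma centering_eq:
  assumes "n > 0"
  shows "2 * centering n = real n * ln (real n) - real n + ln (real n) / 2 + 3 / 2 * ln 2 + ln pi"
  using assms by (simp add: centering_def ln_mult ln_powr)

text \<open>The centring is chosen so that all growing terms cancel, and on each parity class the
  halves are affine in \<open>m\<close>, which makes the expansion explicit. The constant left over
  is the one that the powers of 2 pi in \<open>Gamma_prod_limit\<close> compensate.\<close>

lemma linear_rate_LIMSEQ: "linear_rate \<longlonglongrightarrow> - ln (2 * pi)"
proof (rule tendsto_even_odd)
  have "(\<lambda>m. ln (2 * real m + 1) + 2 * real m * ln 2 - (2 * real m * ln (2 * real m) - 2 * real m + ln (2 * real m) / 2 + 3 / 2 * ln 2 + ln pi) - 2 * real m
     + real m * ln (real m) + real m * ln (real m) - ln (real m) / 2) \<longlonglongrightarrow> - ln 2 - ln pi"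
    by real_asymp
  then show "(\<lambda>m. linear_rate (2 * m)) \<longlonglongrightarrow> - ln (2 * pi)"
    by (rule Lim_transform_eventually[THEN tendsto_eq_rhs])
      (use eventually_gt_at_top[of 0] in \<open>eventually_elim, simp add: linear_rate_def centering_eq\<close>, simp add: ln_mult)
  have "(\<lambda>m. ln (2 * real m + 2) + (2 * real m + 1) * ln 2 - ((2 * real m + 1) * ln (2 * real m + 1) - (2 * real m + 1) + ln (2 * real m + 1) / 2 + 3 / 2 * ln 2 + ln pi) - (2 * real m + 1)
     + real m * ln (real m) + (real m + 1) * ln (real m + 1) - ln (real m + 1) / 2) \<longlonglongrightarrow> - ln 2 - ln pi"
    by real_asymp
  then show "(\<lambda>m. linear_rate (2 * m + 1)) \<longlonglongrightarrow> - ln (2 * pi)"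
    by (rule Lim_transform_eventually[THEN tendsto_eq_rhs])
      (use eventually_gt_at_top[of 0] in \<open>eventually_elim, simp add: linear_rate_def centering_eq add_ac\<close>, simp add: ln_mult)
qed

lemma quadratic_rate_LIMSEQ: "quadratic_rate \<longlonglongrightarrow> 0"
proof (rule tendsto_even_odd)
  have "(\<lambda>m. (ln (real m) + ln (real m)) / 2 - ln (real m)) \<longlonglongrightarrow> 0" by real_asymp
  then show "(\<lambda>m. quadratic_rate (2 * m)) \<longlonglongrightarrow> 0" by (simp add: quadratic_rate_def)
  have "(\<lambda>m. (ln (real m) + ln (real m + 1)) / 2 - ln ((2 * real m + 1) / 2)) \<longlonglongrightarrow> 0" by real_asymp
  then show "(\<lambda>m. quadratic_rate (2 * m + 1)) \<longlonglongrightarrow> 0" by (simp add: quadratic_rate_def add_ac)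
qed

context iid_Gaussian
begin

lemma mgf_formula_eq:
  fixes t :: complex
  defines "s \<equiv> t / 2"
  shows "mgf_formula t / exp (t\<^sup>2 / 4 * of_real (ln (real n / 2))) =
    exp (of_real (linear_rate n) * s + of_real (quadratic_rate n) * s\<^sup>2) *
    (Gamma_prod_normalized (n div 2) s *
      (Gamma_prod_normalized (Suc n div 2) (s - 1 / 2) / Gamma_prod_normalized (Suc n div 2) (- 1 / 2)))"
proof -
  \<comment> \<open>With the logarithms as atoms and n = p + q, the comparison of exponents at the
    end becomes a polynomial identity.\<close>
  define p where "p = n div 2"
  define q where "q = Suc n div 2"
  define P where "P = complex_of_nat p"
  define Q where "Q = complex_of_nat q"
  define lp where "lp = complex_of_real (ln (real p))"
  define lq where "lq = complex_of_real (ln (real q))"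
  define l2 where "l2 = complex_of_real (ln 2)"
  define ln1 where "ln1 = complex_of_real (ln (real n + 1))"
  define lh where "lh = complex_of_real (ln (real n / 2))"
  define c where "c = complex_of_real (centering n)"
  have "p + q = n" by (auto simp: p_def q_def)
  then have pq: "complex_of_nat n = P + Q" by (auto simp: P_def Q_def)
  have t: "t = 2 * s" by (simp add: s_def)
  have sq: "rpow t (sqrt (real n + 1)) = exp (s * ln1)"
  proof -
    have "0 < sqrt (real n + 1)" by (simp add: add_nonneg_pos)
    then show ?thesis by (simp add: rpow_pos ln_sqrt t ln1_def)
  qed
  have "(\<Prod>j=1..n. chi_moment j t) = (\<Prod>j=1..n. rpow s 2 * (Gamma ((of_nat j + t) / 2) / Gamma (of_nat j / 2)))"
    by (simp add: chi_moment_def s_def)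
  also have "\<dots> = exp ((P + Q) * (s * l2)) * (\<Prod>j=1..n. Gamma ((of_nat j + t) / 2) / Gamma (of_nat j / 2))"
  proof -
    have "(\<Prod>j=1..n. rpow s 2) = exp ((P + Q) * (s * l2))"
      by (simp add: rpow_pos pq[symmetric] exp_of_nat_mult l2_def)
    then show ?thesis by (simp only: prod.distrib)
  qed
  finally have chi: "(\<Prod>j=1..n. chi_moment j t) = exp ((P + Q) * (s * l2)) *
      (Gamma_prod p s * (Gamma_prod q (s - 1 / 2) / Gamma_prod q (- 1 / 2)))"
    by (simp only: prod_half_Gamma p_def q_def s_def)
  have r1: "complex_of_real (linear_rate n) = ln1 + (P + Q) * l2 - 2 * c - (P + Q) + P * lp + Q * lq - lq / 2"
    unfolding linear_rate_def p_def[symmetric] q_def[symmetric] pq[symmetric]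
    by (simp add: ln1_def l2_def c_def P_def Q_def lp_def lq_def)
  have r2: "complex_of_real (quadratic_rate n) = (lp + lq) / 2 - lh"
    unfolding quadratic_rate_def p_def[symmetric] q_def[symmetric] by (simp add: lp_def lq_def lh_def)
  define A where "A = Gamma_prod_normalized p s"
  define B where "B = Gamma_prod_normalized q (s - 1 / 2)"
  define D where "D = Gamma_prod_normalized q (- 1 / 2)"
  have F: "Gamma_prod p s = A * exp (P * s * lp + s\<^sup>2 / 2 * lp - P * s)"
    "Gamma_prod q (s - 1 / 2) = B * exp (Q * (s - 1 / 2) * lq + (s - 1 / 2)\<^sup>2 / 2 * lq - Q * (s - 1 / 2))"
    "Gamma_prod q (- 1 / 2) = D * exp (Q * (- 1 / 2) * lq + (- 1 / 2)\<^sup>2 / 2 * lq - Q * (- 1 / 2))"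
    unfolding A_def B_def D_def P_def Q_def lp_def lq_def by (rule Gamma_prod_eq_normalized)+
  have "mgf_formula t / exp (t\<^sup>2 / 4 * lh) = A * (B / D) *
     (exp (- t * c) * exp (s * ln1) * exp ((P + Q) * (s * l2)) * exp (P * s * lp + s\<^sup>2 / 2 * lp - P * s) *
      exp (Q * (s - 1 / 2) * lq + (s - 1 / 2)\<^sup>2 / 2 * lq - Q * (s - 1 / 2)) /
      exp (Q * (- 1 / 2) * lq + (- 1 / 2)\<^sup>2 / 2 * lq - Q * (- 1 / 2)) / exp (t\<^sup>2 / 4 * lh))"
    unfolding mgf_formula_def content_moment_def chi sq F c_def[symmetric] by (simp add: mult_ac)
  also have "exp (- t * c) * exp (s * ln1) * exp ((P + Q) * (s * l2)) * exp (P * s * lp + s\<^sup>2 / 2 * lp - P * s) *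
      exp (Q * (s - 1 / 2) * lq + (s - 1 / 2)\<^sup>2 / 2 * lq - Q * (s - 1 / 2)) /
      exp (Q * (- 1 / 2) * lq + (- 1 / 2)\<^sup>2 / 2 * lq - Q * (- 1 / 2)) / exp (t\<^sup>2 / 4 * lh) =
      exp (of_real (linear_rate n) * s + of_real (quadratic_rate n) * s\<^sup>2)"
    unfolding exp_add[symmetric] exp_diff[symmetric] r1 r2 t
    by (rule arg_cong[where f = exp]) (simp add: field_simps power2_eq_square)
  finally show ?thesis
    by (simp only: lh_def A_def B_def D_def p_def q_def mult_ac)
qed

end

section \<open>Passage to the limit on compact sets\<close>

lemma Gamma_prod_limit_nonzero:
  assumes "z \<notin> {- of_nat k | k. k \<ge> 1}"
  shows "Gamma_prod_limit z \<noteq> 0"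
  using Barnes_prod_nonzero[OF assms] by (simp add: Gamma_prod_limit_eq[OF assms])

lemma bounded_image_mult:
  fixes f g :: "'a \<Rightarrow> 'b::real_normed_algebra"
  assumes "bounded (f ` K)" "bounded (g ` K)"
  shows "bounded ((\<lambda>x. f x * g x) ` K)"
proof -
  obtain a b where ab: "\<And>x. x \<in> K \<Longrightarrow> norm (f x) \<le> a" "\<And>x. x \<in> K \<Longrightarrow> norm (g x) \<le> b"
    using assms by (auto simp: bounded_iff)
  have "norm (f x * g x) \<le> a * b" if "x \<in> K" for x
    using ab[OF that] order_trans[OF norm_ge_zero ab(1)[OF that]]
    by (intro order_trans[OF norm_mult_ineq] mult_mono) auto
  then show ?thesis by (auto simp: bounded_iff)
qed

lemma bounded_Gamma_prod_limit:
  assumes K: "compact K" "K \<inter> {- of_nat k | k. k \<ge> 1} = {}"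
  shows "bounded (Gamma_prod_limit ` K)"
proof -
  obtain b where b: "b > 0" "\<And>z. z \<in> K \<Longrightarrow> b \<le> norm (\<Prod>k. Barnes_factor k z)"
    using bounded_below_Barnes_prod[OF K] by blast
  have "bounded ((\<lambda>z. exp ((z\<^sup>2 + z) / 2 + z\<^sup>2 / 2 * complex_of_real euler_mascheroni)) ` K)"
    by (intro compact_imp_bounded compact_continuous_image K(1) continuous_intros) auto
  then obtain B where B: "\<And>z. z \<in> K \<Longrightarrow> norm (exp ((z\<^sup>2 + z) / 2 + z\<^sup>2 / 2 * complex_of_real euler_mascheroni)) \<le> B"
    by (auto simp: bounded_iff)
  have "norm (Gamma_prod_limit z) \<le> B / b" if "z \<in> K" for z
  proof -
    have "z \<notin> {- of_nat k | k. k \<ge> 1}" using that K(2) by blast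
    then show ?thesis
      unfolding Gamma_prod_limit_eq[OF \<open>z \<notin> _\<close>] norm_divide
      using b B[OF that] that by (intro frac_le order_trans[OF norm_ge_zero B]) auto
  qed
  then show ?thesis by (auto simp: bounded_iff)
qed

text \<open>With s = t / 2, the powers of 2 pi have the exponents -s, s / 2, (s - 1/2) / 2 and 1/4,
  which add up to 0; only the Barnes functions remain.\<close>

lemma limit_function_eq:
  "limit_function t = exp (- of_real (ln (2 * pi)) * (t / 2)) *
     (Gamma_prod_limit (t / 2) * (Gamma_prod_limit (t / 2 - 1 / 2) / Gamma_prod_limit (- 1 / 2)))"
proof -
  define L where "L = complex_of_real (ln (2 * pi))"
  have pw: "complex_of_real (2 * pi) powr z = exp (z * L)" for z
    by (simp add: powr_def L_def Ln_of_real del: of_real_mult)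
  have G: "Barnes_G (1 + (t / 2 - 1 / 2)) = Barnes_G (1 / 2 + t / 2)" "Barnes_G (1 + - 1 / 2) = Barnes_G (1 / 2)"
    by (simp_all add: algebra_simps)
  have "exp (- L * (t / 2)) * (exp (t / 2 / 2 * L) * (exp ((t / 2 - 1 / 2) / 2 * L) / exp (- 1 / 2 / 2 * L))) = 1"
    unfolding exp_add[symmetric] exp_diff[symmetric] by (simp add: field_simps)
  moreover have "exp (- of_real (ln (2 * pi)) * (t / 2)) *
     (Gamma_prod_limit (t / 2) * (Gamma_prod_limit (t / 2 - 1 / 2) / Gamma_prod_limit (- 1 / 2))) =
     (exp (- L * (t / 2)) * (exp (t / 2 / 2 * L) * (exp ((t / 2 - 1 / 2) / 2 * L) / exp (- 1 / 2 / 2 * L)))) *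
     (Barnes_G (1 / 2) / (Barnes_G (1 / 2 + t / 2) * Barnes_G (1 + t / 2)))"
    unfolding Gamma_prod_limit_def pw G L_def[symmetric] by (simp add: mult_ac)
  ultimately show ?thesis by (simp add: limit_function_def)
qed

text \<open>t / 2 is a negative integer exactly for t = -2, -4, ..., and t / 2 - 1 / 2 exactly for t
  = -1, -3, ...; together these are the excluded points.\<close>

lemma half_image_disjoint:
  assumes "K \<subseteq> - {- of_nat k | k. k \<ge> 1}"
  shows "(\<lambda>t. t / 2) ` K \<inter> {- of_nat k | k. k \<ge> (1::nat)} = ({} :: complex set)"
    and "(\<lambda>t. t / 2 - 1 / 2) ` K \<inter> {- of_nat k | k. k \<ge> (1::nat)} = ({} :: complex set)"
proof -
  have "t / 2 \<noteq> - of_nat k" "t / 2 - 1 / 2 \<noteq> - of_nat k" if "t \<in> K" "k \<ge> 1" for t and k :: nat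
  proof -
    show "t / 2 \<noteq> - of_nat k"
    proof
      assume "t / 2 = - of_nat k"
      then have "t = - of_nat (2 * k)" by (simp add: divide_eq_eq)
      moreover have "2 * k \<ge> 1" using that(2) by simp
      ultimately show False using that(1) assms by blast
    qed
    show "t / 2 - 1 / 2 \<noteq> - of_nat k"
    proof
      assume "t / 2 - 1 / 2 = - of_nat k"
      then have "2 * (t / 2 - 1 / 2) + 1 = 2 * (- of_nat k) + 1" by (simp only:)
      then have "t = - of_nat (2 * k - 1)" using that(2) by (simp add: of_nat_diff)
      moreover have "2 * k - 1 \<ge> 1" using that(2) by simp
      ultimately show False using that(1) assms by blast
    qed
  qed
  then show "(\<lambda>t. t / 2) ` K \<inter> {- of_nat k | k. k \<ge> (1::nat)} = ({} :: complex set)"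
    "(\<lambda>t. t / 2 - 1 / 2) ` K \<inter> {- of_nat k | k. k \<ge> (1::nat)} = ({} :: complex set)"
    by blast+
qed

lemma uniform_limit_Gamma_side:
  assumes K: "compact K" "K \<subseteq> - {- of_nat k | k. k \<ge> 1}"
  shows "uniform_limit K (\<lambda>n t. exp (of_real (linear_rate n) * (t / 2) + of_real (quadratic_rate n) * (t / 2)\<^sup>2) *
      (Gamma_prod_normalized (n div 2) (t / 2) *
        (Gamma_prod_normalized (Suc n div 2) (t / 2 - 1 / 2) / Gamma_prod_normalized (Suc n div 2) (- 1 / 2))))
    limit_function sequentially"
proof -
  note disj = half_image_disjoint[OF K(2)]
  have c1: "compact ((\<lambda>t. t / 2) ` K)" and c2: "compact ((\<lambda>t. t / 2 - 1 / 2) ` K)"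
    by (intro compact_continuous_image K(1) continuous_intros; simp)+
  have d1: "filterlim (\<lambda>n::nat. n div 2) at_top sequentially"
    unfolding filterlim_at_top
  proof
    fix Z :: nat
    show "eventually (\<lambda>n. Z \<le> n div 2) sequentially"
      using eventually_ge_at_top[of "2 * Z"] by eventually_elim presburger
  qed
  have d2: "filterlim (\<lambda>n::nat. Suc n div 2) at_top sequentially"
    unfolding filterlim_at_top
  proof
    fix Z :: nat
    show "eventually (\<lambda>n. Z \<le> Suc n div 2) sequentially"
      using eventually_ge_at_top[of "2 * Z"] by eventually_elim presburger
  qed
  have U1: "uniform_limit K (\<lambda>n t. Gamma_prod_normalized (n div 2) (t / 2)) (\<lambda>t. Gamma_prod_limit (t / 2)) sequentially"
    using filterlim_compose[OF uniform_limit_Gamma_prod_normalized[OF c1 disj(1)] d1]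
    by (rule uniform_limit_compose') auto
  have U2: "uniform_limit K (\<lambda>n t. Gamma_prod_normalized (Suc n div 2) (t / 2 - 1 / 2))
      (\<lambda>t. Gamma_prod_limit (t / 2 - 1 / 2)) sequentially"
    using filterlim_compose[OF uniform_limit_Gamma_prod_normalized[OF c2 disj(2)] d2]
    by (rule uniform_limit_compose') auto
  \<comment> \<open>At the fixed argument -1/2 the compact set is a singleton, and composing with a
    constant map makes the convergence uniform in \<open>t\<close>.\<close>
  have "uniform_limit {- 1 / 2} Gamma_prod_normalized Gamma_prod_limit sequentially"
    using minus_half_not_neg_int by (intro uniform_limit_Gamma_prod_normalized) auto
  then have "uniform_limit {- 1 / 2} (\<lambda>n. Gamma_prod_normalized (Suc n div 2)) Gamma_prod_limit sequentially"
    by (rule filterlim_compose[OF _ d2])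
  then have "uniform_limit K (\<lambda>n t. Gamma_prod_normalized (Suc n div 2) (- 1 / 2)) (\<lambda>t. Gamma_prod_limit (- 1 / 2)) sequentially"
    by (rule uniform_limit_compose') auto
  have b1: "bounded ((\<lambda>t. Gamma_prod_limit (t / 2)) ` K)"
    using bounded_Gamma_prod_limit[OF c1 disj(1)] by (simp add: image_image)
  have b2: "bounded ((\<lambda>t. Gamma_prod_limit (t / 2 - 1 / 2)) ` K)"
    using bounded_Gamma_prod_limit[OF c2 disj(2)] by (simp add: image_image)
  have nz: "norm (Gamma_prod_limit (- 1 / 2)) > 0"
    using Gamma_prod_limit_nonzero[OF minus_half_not_neg_int] by simp
  have U3: "uniform_limit K (\<lambda>n t. Gamma_prod_normalized (Suc n div 2) (t / 2 - 1 / 2) / Gamma_prod_normalized (Suc n div 2) (- 1 / 2))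
      (\<lambda>t. Gamma_prod_limit (t / 2 - 1 / 2) / Gamma_prod_limit (- 1 / 2)) sequentially"
    by (rule uniform_lim_divide[OF U2 \<open>uniform_limit K _ (\<lambda>t. Gamma_prod_limit (- 1 / 2)) _\<close> b2 order_refl nz])
  have b3: "bounded ((\<lambda>t. Gamma_prod_limit (t / 2 - 1 / 2) / Gamma_prod_limit (- 1 / 2)) ` K)"
  proof -
    have "bounded ((\<lambda>_. inverse (Gamma_prod_limit (- 1 / 2))) ` K)"
      by (auto simp: bounded_iff)
    from bounded_image_mult[OF b2 this] show ?thesis
      by (simp only: divide_inverse[of "Gamma_prod_limit _"])
  qed
  have b4: "bounded ((\<lambda>t. Gamma_prod_limit (t / 2) * (Gamma_prod_limit (t / 2 - 1 / 2) / Gamma_prod_limit (- 1 / 2))) ` K)"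
    by (rule bounded_image_mult[OF b1 b3])
  have E: "uniform_limit K (\<lambda>n t. exp (of_real (linear_rate n) * (t / 2) + of_real (quadratic_rate n) * (t / 2)\<^sup>2))
      (\<lambda>t. exp (of_real (- ln (2 * pi)) * (t / 2) + of_real 0 * (t / 2)\<^sup>2)) sequentially"
  proof (intro uniform_limit_exp uniform_limit_add uniform_lim_mult uniform_limit_const
      uniform_limit_sequence_const tendsto_of_real linear_rate_LIMSEQ quadratic_rate_LIMSEQ)
    show "bounded ((\<lambda>t. t / 2) ` K)" "bounded ((\<lambda>t. (t / 2)\<^sup>2) ` K)"
      "bounded ((\<lambda>t. of_real (- ln (2 * pi)) * (t / 2) + of_real 0 * (t / 2)\<^sup>2) ` K)"
      by (intro compact_imp_bounded compact_continuous_image K(1) continuous_intros; simp)+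
  qed (auto simp: bounded_iff)
  have b5: "bounded ((\<lambda>t. exp (of_real (- ln (2 * pi)) * (t / 2) + of_real 0 * (t / 2)\<^sup>2)) ` K)"
    by (intro compact_imp_bounded compact_continuous_image K(1) continuous_intros; simp)
  have "uniform_limit K (\<lambda>n t. exp (of_real (linear_rate n) * (t / 2) + of_real (quadratic_rate n) * (t / 2)\<^sup>2) *
      (Gamma_prod_normalized (n div 2) (t / 2) *
        (Gamma_prod_normalized (Suc n div 2) (t / 2 - 1 / 2) / Gamma_prod_normalized (Suc n div 2) (- 1 / 2))))
    (\<lambda>t. exp (of_real (- ln (2 * pi)) * (t / 2) + of_real 0 * (t / 2)\<^sup>2) *
      (Gamma_prod_limit (t / 2) * (Gamma_prod_limit (t / 2 - 1 / 2) / Gamma_prod_limit (- 1 / 2)))) sequentially"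
    by (intro uniform_lim_mult[OF E uniform_lim_mult[OF U1 U3 b1 b3] b5 b4])
  then show ?thesis
    unfolding limit_function_eq[abs_def] by simp
qed

theorem proposition4p7:
  fixes M :: "nat \<Rightarrow> 'a measure"
    and X :: "nat \<Rightarrow> nat \<Rightarrow> 'a \<Rightarrow> nat \<Rightarrow> real"
  assumes "\<And>n. n \<ge> 1 \<Longrightarrow> iid_std_Gaussian_points n (M n) (X n)"
  shows "mod_Gaussian_convergent (-1) \<infinity> M (\<lambda>n. centered_log_volume n (X n))
           (\<lambda>n. ln (real n / 2) / 2) limit_function
       \<and> (\<forall>n\<ge>1. \<exists>F. mgf_continuation (M n) (centered_log_volume n (X n)) F
            \<and> F analytic_on - {- of_nat k | k. k \<ge> 1})
       \<and> (\<forall>K. compact K \<and> K \<subseteq> - {- of_nat k | k. k \<ge> 1} \<longrightarrow>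
            uniform_limit K
              (\<lambda>n t. mgf (M n) (centered_log_volume n (X n)) t
                     / exp (t\<^sup>2 / 4 * of_real (ln (real n / 2))))
              limit_function sequentially)"
proof -
  let ?D = "- {- of_nat k | k. k \<ge> (1::nat)} :: complex set"
  let ?S = "vertical_strip (-1) \<infinity>"
  have loc: "iid_Gaussian n (M n) (X n)" if "n \<ge> 1" for n
    using assms[OF that] that by (simp add: iid_Gaussian_def)
  have cont: "\<exists>F. mgf_continuation (M n) (centered_log_volume n (X n)) F \<and> F analytic_on ?D" if "n \<ge> 1" for n
    using iid_Gaussian.mgf_continuation_Y[OF loc[OF that]]
      remove_sings_analytic_on[OF iid_Gaussian.mgf_formula_analytic[OF loc[OF that]]] by blast
  define H where "H = (\<lambda>n t. mgf (M n) (centered_log_volume n (X n)) t / exp (t\<^sup>2 / 4 * of_real (ln (real n / 2))))"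
  have lim: "uniform_limit K H limit_function sequentially" if K: "compact K" "K \<subseteq> ?D" for K
  proof -
    have "eventually (\<lambda>n. \<forall>t\<in>K. H n t = exp (of_real (linear_rate n) * (t / 2) + of_real (quadratic_rate n) * (t / 2)\<^sup>2) *
      (Gamma_prod_normalized (n div 2) (t / 2) *
        (Gamma_prod_normalized (Suc n div 2) (t / 2 - 1 / 2) / Gamma_prod_normalized (Suc n div 2) (- 1 / 2)))) sequentially"
      using eventually_ge_at_top[of 1]
    proof eventually_elim
      case (elim n)
      show ?case
        using iid_Gaussian.mgf_Y[OF loc[OF elim]] iid_Gaussian.mgf_formula_eq[OF loc[OF elim]] K(2)
        by (auto simp: H_def subset_iff)
    qed
    then show ?thesis
      using uniform_limit_Gamma_side[OF K] by (subst uniform_limit_cong) auto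
  qed
  have strip: "?S = {t. Re t > -1}"
    by (auto simp: vertical_strip_def one_ereal_def)
  have S_open: "open ?S" unfolding strip by (rule open_halfspace_Re_gt)
  have S_sub: "?S \<subseteq> ?D" by (auto simp: strip)
  have ball: "\<exists>\<epsilon>>0. cball z \<epsilon> \<subseteq> ?S \<and> uniform_limit (cball z \<epsilon>) H limit_function sequentially" if z: "z \<in> ?S" for z
  proof -
    obtain \<epsilon> where \<epsilon>: "\<epsilon> > 0" "cball z \<epsilon> \<subseteq> ?S"
      using S_open[unfolded open_contains_cball, rule_format, OF z] by (elim exE conjE)
    from lim[OF compact_cball order_trans[OF \<epsilon>(2) S_sub]] \<epsilon> show ?thesis
      by (intro exI[of _ \<epsilon>] conjI)
  qed
  \<comment> \<open>A locally uniform limit of holomorphic functions is holomorphic; the sequence is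
    shifted by one because the assumption on the points starts at index 1.\<close>
  have "limit_function holomorphic_on ?S"
  proof (rule holomorphic_uniform_sequence[OF S_open])
    fix n
    have l: "iid_Gaussian (Suc n) (M (Suc n)) (X (Suc n))" by (rule loc) simp
    have "iid_Gaussian.mgf_formula (Suc n) analytic_on ?S"
      by (rule analytic_on_subset[OF iid_Gaussian.mgf_formula_analytic[OF l] S_sub])
    then have "(\<lambda>t. iid_Gaussian.mgf_formula (Suc n) t / exp (t\<^sup>2 / 4 * of_real (ln (real (Suc n) / 2)))) holomorphic_on ?S"
      by (intro holomorphic_intros analytic_imp_holomorphic) auto
    then show "H (Suc n) holomorphic_on ?S"
      by (rule holomorphic_transform) (use S_sub iid_Gaussian.mgf_Y[OF l] in \<open>auto simp: H_def subset_iff\<close>)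
  next
    fix z assume "z \<in> ?S"
    from ball[OF this] obtain d where d: "d > 0" "cball z d \<subseteq> ?S"
      "uniform_limit (cball z d) H limit_function sequentially" by (elim exE conjE)
    from d(1,2) filterlim_compose[OF d(3) filterlim_Suc]
    show "\<exists>d>0. cball z d \<subseteq> ?S \<and> uniform_limit (cball z d) (\<lambda>n. H (Suc n)) limit_function sequentially"
      by (intro exI[of _ d] conjI)
  qed
  then have an: "limit_function analytic_on ?S"
    using S_open by (simp add: analytic_on_open)
  have "mod_Gaussian_convergent (-1) \<infinity> M (\<lambda>n. centered_log_volume n (X n)) (\<lambda>n. ln (real n / 2) / 2) limit_function"
    unfolding mod_phi_convergent_def
  proof (intro conjI ballI allI impI)
    show "(-1 :: ereal) < \<infinity>" by (simp add: one_ereal_def)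
    show "filterlim (\<lambda>n. ln (real n / 2) / 2) at_top sequentially" by real_asymp
    fix z assume "z \<in> ?S"
    have "H = (\<lambda>n t. mgf (M n) (centered_log_volume n (X n)) t / exp (of_real (ln (real n / 2) / 2) * (t\<^sup>2 / 2)))"
      by (simp add: H_def fun_eq_iff mult.commute)
    then show "\<exists>\<epsilon>>0. cball z \<epsilon> \<subseteq> ?S \<and> uniform_limit (cball z \<epsilon>)
        (\<lambda>n t. mgf (M n) (centered_log_volume n (X n)) t / exp (of_real (ln (real n / 2) / 2) * (t\<^sup>2 / 2))) limit_function sequentially"
      using ball[OF \<open>z \<in> ?S\<close>] by simp
  next
    fix n :: nat assume n: "n \<ge> 1"
    interpret iid_Gaussian n "M n" "X n" by (rule loc[OF n])
    show "prob_space (M n)" by (rule prob_space_axioms)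
    show "centered_log_volume n (X n) \<in> borel_measurable (M n)" by (rule measurable_Y)
    show "(\<exists>F. mgf_continuation (M n) (centered_log_volume n (X n)) F) \<or>
      (\<forall>t\<in>?S. integrable (M n) (\<lambda>\<omega>. exp (t * of_real (centered_log_volume n (X n) \<omega>))))"
      using cont[OF n] by blast
  qed (simp_all add: infinitely_divisible_std_normal std_normal_exp_integrable std_normal_exp_integral an)
  then show ?thesis
    using cont lim unfolding H_def by (intro conjI allI impI) (assumption | elim conjE)+
qed

end
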